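(* Let $(X,d,\sigma)$ be a compatible metric-topological space with $(X,d)$ complete, let $\phi:X\to(-\infty,\infty]$ be proper and satisfy the LSCC assumptions with coercivity constant $\mathsf B$, and let $\varepsilon>0$ with $\frac1{16\varepsilon}>\mathsf B$. For every $T\in(0,\infty)$ and every $u\in AC^2([0,T];X)$ such that $V_\varepsilon\circ u\in L^1(0,T)$ and $G_\varepsilon\circ u\in L^2(0,T)$, the map $t\mapsto V_\varepsilon(u(t))$ is absolutely continuous on $[0,T]$ and $$\Big|\frac{d}{dt}V_\varepsilon(u(t))\Big|\le\frac12G_\varepsilon^2(u(t))+\frac12|u'|^2(t)\qquad\text{for a.e. }t\in(0,T).$$ In particular, $G_\varepsilon$ is an $L^1$-moderated upper gradient of $V_\varepsilon$.
   Context: **Setting.** $(X,d)$ is a complete metric space and $\sigma$ is a Hausdorff topology on $X$; $(X,d,\sigma)$ is called compatible if (MT1) $u_n\to u$ and $v_n\to v$ in $\sigma$ imply $\liminf_n d(u_n,v_n)\ge d(u,v)$; (MT2) for every $\sigma$-open set $U$ and $x\in U$ there exist a $\sigma$-open neighborhood $V$ of $x$ and $\delta>0$ such that $d(y,V)<\delta$ implies $y\in U$, where $d(y,V)=\inf_{v\in V}d(y,v)$. For an interval $I\subset\mathbb R$ and $p\in[1,\infty]$, $AC^p(I;X)$ is the set of curves $u:I\to X$ for which there is $m\in L^p(I)$ with $d(u(s),u(t))\le\int_s^t m(r)\,dr$ for all $s\le t$ in $I$; $AC=AC^1$; $AC^p_{\rm loc}(I;X)$ is the set of curves belonging to $AC^p(J;X)$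 for every compact interval $J\subset I$. The metric derivative $|u'|(t)=\lim_{s\to t}\frac{d(u(s),u(t))}{|t-s|}$ exists for a.e. $t\in I$. **LSCC assumptions.** $\phi:X\to(-\infty,\infty]$ is proper, and: (Lower semicontinuity) if $\sup_{n,m}d(u_n,u_m)<\infty$ and $u_n\to u$ in $\sigma$, then $\liminf_n\phi(u_n)\ge\phi(u)$; (Compactness) every sequence with $\sup_n\phi(u_n)<\infty$ and $\sup_{n,m}d(u_n,u_m)<\infty$ has a $\sigma$-convergent subsequence; (Coercivity) there are $u_*\in X$ and constants $\mathsf A,\mathsf B\ge0$ such that $\phi(u)\ge-\mathsf B\,d^2(u,v)-\mathsf Q(v)$ for all $u,v\in X$, where $\mathsf Q(v)=\mathsf B\,d^2(v,u_* )+\mathsf A$. **WED functional and value function.** $\mu_\varepsilon$ is the probability measure on $(0,\infty)$ with density $\frac1\varepsilon e^{-t/\varepsilon}$; $\mathcal I_\varepsilon[u]=\int_0^\infty\big(\frac\varepsilon2|u'|^2+\phi(u)\big)\,d\mu_\varepsilon$ for $u\in\mathscr C_\varepsilon(x)=\{u\in AC^2_{\rm loc}([0,\infty);X): u(0)=x,\ \int_0^\infty|u'|^2\,d\mu_\varepsilon<\infty\}$. The value function is $V_\varepsilon(x)=\inf_{u\in\mathscr C_\varepsilon(x)}\mathcal I_\varepsilon[u]$, with $D(V_\varepsilon)=\{V_\varepsilon<\infty\}$ (one has $V_\varepsilon\le\phi$). Set $G_\varepsilon(x)=\sqrt{2\,\frac{\phi(x)-V_\varepsilon(x)}{\varepsilon}}$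 if $x\in D(V_\varepsilon)$ and $G_\varepsilon(x)=\infty$ otherwise. **Moderated upper gradients.** For $p\in[1,\infty]$ and $\psi:X\to(-\infty,\infty]$, a function $g:X\to[0,\infty]$ is an $L^p$-moderated upper gradient for $\psi$ if for every curve $u\in AC(I;X)$ with $\psi\circ u\in L^p(I;|u'|\mathscr L^1)$ and $g\circ u\in L^1(I;|u'|\mathscr L^1)$ one has $|\psi(u(t))-\psi(u(s))|\le\int_s^t g(u(r))|u'|(r)\,dr$ for all $s\le t$ in $I$ ($\mathscr L^1$ is Lebesgue measure). *)

theory Defs
  imports "HOL-Analysis.Analysis"
begin

section \<open>Integrals and Lebesgue spaces of extended real-valued functions\<close>

text \<open>
  Integral of a function with values in $[-\infty,\infty]$, as the difference of the integrals of
  its positive and negative parts (\<^const>\<open>e2ennreal\<close> truncates at 0); it is \<open>\<infinity>\<close> if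
  both parts have integral \<open>\<infinity>\<close>, since \<open>\<infinity> - \<infinity> = (\<infinity>::ereal)\<close>.
\<close>

definition ext_integral :: "'b measure \<Rightarrow> ('b \<Rightarrow> ereal) \<Rightarrow> ereal" where
  "ext_integral M f =
     enn2ereal (\<integral>\<^sup>+ x. e2ennreal (f x) \<partial>M) - enn2ereal (\<integral>\<^sup>+ x. e2ennreal (- f x) \<partial>M)"

definition in_Lp :: "ennreal \<Rightarrow> 'b measure \<Rightarrow> ('b \<Rightarrow> ereal) \<Rightarrow> bool" where
  "in_Lp p M f \<longleftrightarrow>
     f \<in> borel_measurable M \<and>
     (if p = \<infinity> then \<exists>C::real. AE x in M. \<bar>f x\<bar> \<le> ereal C
      else (AE x in M. \<bar>f x\<bar> \<noteq> \<infinity>) \<and>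
           integrable M (\<lambda>x. \<bar>real_of_ereal (f x)\<bar> powr enn2real p))"


section \<open>Compatible metric-topological spaces\<close>

text \<open>
  The space $X$ is the whole type \<^typ>\<open>'a\<close>, with its metric \<^const>\<open>dist\<close>; \<open>\<sigma>\<close> is a second
  topology on it. In the second clause below, \<^const>\<open>infdist\<close> is the distance to a set, which is
  nonempty there.
\<close>

definition compatible :: "'a::metric_space topology \<Rightarrow> bool" where
  "compatible \<sigma> \<longleftrightarrow>
     topspace \<sigma> = UNIV \<and> Hausdorff_space \<sigma> \<and>
     (\<forall>u v x y. limitin \<sigma> u x sequentially \<longrightarrow> limitin \<sigma> v y sequentially \<longrightarrow>
        ereal (dist x y) \<le> liminf (\<lambda>n. ereal (dist (u n) (v n)))) \<and>
     (\<forall>U x. openin \<sigma> U \<longrightarrow> x \<in> U \<longrightarrow>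
        (\<exists>V \<delta>. openin \<sigma> V \<and> x \<in> V \<and> \<delta> > 0 \<and> (\<forall>y. infdist y V < \<delta> \<longrightarrow> y \<in> U)))"


section \<open>Absolutely continuous curves and metric derivative\<close>

text \<open>
  A curve $I \to X$ is a total function of which only the values on \<open>I\<close> matter.
\<close>

definition AC :: "ennreal \<Rightarrow> real set \<Rightarrow> (real \<Rightarrow> 'a::metric_space) \<Rightarrow> bool" where
  "AC p I u \<longleftrightarrow>
     (\<exists>m::real \<Rightarrow> real. in_Lp p (lebesgue_on I) (\<lambda>t. ereal (m t)) \<and>
        (\<forall>s\<in>I. \<forall>t\<in>I. s \<le> t \<longrightarrow> dist (u s) (u t) \<le> (LINT r:{s..t}|lebesgue. m r)))"

definition AC_loc :: "ennreal \<Rightarrow> real set \<Rightarrow> (real \<Rightarrow> 'a::metric_space) \<Rightarrow> bool" where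
  "AC_loc p I u \<longleftrightarrow> (\<forall>a b. {a..b} \<subseteq> I \<longrightarrow> AC p {a..b} u)"

text \<open>
  Where the limit does not exist (a null set, if \<open>u\<close> is absolutely continuous), \<^const>\<open>Lim\<close>
  returns an unspecified constant.
\<close>

definition metric_deriv :: "real set \<Rightarrow> (real \<Rightarrow> 'a::metric_space) \<Rightarrow> real \<Rightarrow> real" where
  "metric_deriv I u t = Lim (at t within I) (\<lambda>s. dist (u s) (u t) / \<bar>t - s\<bar>)"

text \<open>
  The measure $|u'|\,\mathscr L^1$ on \<open>I\<close>. It is completed so that measurability with respect to
  it does not depend on values on the set where $|u'| = 0$.
\<close>

definition speed_measure :: "real set \<Rightarrow> (real \<Rightarrow> 'a::metric_space) \<Rightarrow> real measure" where
  "speed_measure I u = completion (density (lebesgue_on I) (\<lambda>t. ennreal (metric_deriv I u t)))"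


section \<open>The assumptions on the functional\<close>

text \<open>
  Functionals with values in $(-\infty,\infty]$ are \<^typ>\<open>ereal\<close>-valued functions that omit
  \<open>- \<infinity>\<close>.
\<close>

definition proper :: "('a \<Rightarrow> ereal) \<Rightarrow> bool" where
  "proper \<phi> \<longleftrightarrow> (\<forall>x. \<phi> x \<noteq> - \<infinity>) \<and> (\<exists>x. \<phi> x \<noteq> \<infinity>)"

definition LSCC ::
  "'a::metric_space topology \<Rightarrow> ('a \<Rightarrow> ereal) \<Rightarrow> 'a \<Rightarrow> real \<Rightarrow> real \<Rightarrow> bool" where
  "LSCC \<sigma> \<phi> u0 A B \<longleftrightarrow>
     (\<forall>u x. bounded (range u) \<longrightarrow> limitin \<sigma> u x sequentially \<longrightarrow>
        \<phi> x \<le> liminf (\<lambda>n. \<phi> (u n))) \<and>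
     (\<forall>u::nat \<Rightarrow> 'a. (SUP n. \<phi> (u n)) < \<infinity> \<longrightarrow> bounded (range u) \<longrightarrow>
        (\<exists>r x. strict_mono r \<and> limitin \<sigma> (u \<circ> r) x sequentially)) \<and>
     A \<ge> 0 \<and> B \<ge> 0 \<and>
     (\<forall>x y. ereal (- B * (dist x y)\<^sup>2 - (B * (dist y u0)\<^sup>2 + A)) \<le> \<phi> x)"


section \<open>The WED functional and its value function\<close>

definition wed_measure :: "real \<Rightarrow> real measure" where
  "wed_measure \<epsilon> = density (lebesgue_on {0<..}) (\<lambda>t. ennreal (1 / \<epsilon> * exp (- t / \<epsilon>)))"

definition wed_functional ::
  "('a::metric_space \<Rightarrow> ereal) \<Rightarrow> real \<Rightarrow> (real \<Rightarrow> 'a) \<Rightarrow> ereal" where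
  "wed_functional \<phi> \<epsilon> u =
     ext_integral (wed_measure \<epsilon>)
       (\<lambda>t. ereal (\<epsilon> / 2 * (metric_deriv {0..} u t)\<^sup>2) + \<phi> (u t))"

definition wed_curves :: "real \<Rightarrow> 'a::metric_space \<Rightarrow> (real \<Rightarrow> 'a) set" where
  "wed_curves \<epsilon> x =
     {u. AC_loc 2 {0..} u \<and> u 0 = x \<and>
         (\<integral>\<^sup>+ t. ennreal ((metric_deriv {0..} u t)\<^sup>2) \<partial>wed_measure \<epsilon>) < \<infinity>}"

definition value_fun :: "('a::metric_space \<Rightarrow> ereal) \<Rightarrow> real \<Rightarrow> 'a \<Rightarrow> ereal" where
  "value_fun \<phi> \<epsilon> x = (INF u \<in> wed_curves \<epsilon> x. wed_functional \<phi> \<epsilon> u)"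

definition ext_sqrt :: "ereal \<Rightarrow> ereal" where
  "ext_sqrt x = (if x = \<infinity> then \<infinity> else ereal (sqrt (real_of_ereal x)))"

definition value_slope :: "('a::metric_space \<Rightarrow> ereal) \<Rightarrow> real \<Rightarrow> 'a \<Rightarrow> ereal" where
  "value_slope \<phi> \<epsilon> x =
     (if value_fun \<phi> \<epsilon> x < \<infinity>
      then ext_sqrt (2 * ((\<phi> x - value_fun \<phi> \<epsilon> x) / ereal \<epsilon>))
      else \<infinity>)"


section \<open>Moderated upper gradients\<close>

text \<open>
  $|a-b|$ with the convention $|\infty-\infty| = 0$, whereas \<open>\<infinity> - \<infinity> = (\<infinity>::ereal)\<close>.
  In the definition of upper gradient the convention matters only if \<open>u\<close> is constant on
  \<open>{s..t}\<close> with value where $\psi=\infty$. Otherwise, \<open>\<psi> \<circ> u\<close> is finite somewhere in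
  \<open>{s..t}\<close>, and the inequality from there to \<open>s\<close> and to \<open>t\<close> forces finiteness at both.
\<close>

definition ext_absdiff :: "ereal \<Rightarrow> ereal \<Rightarrow> ereal" where
  "ext_absdiff a b = (if a = b then 0 else \<bar>a - b\<bar>)"

definition moderated_upper_gradient ::
  "ennreal \<Rightarrow> ('a::metric_space \<Rightarrow> ereal) \<Rightarrow> ('a \<Rightarrow> ereal) \<Rightarrow> bool" where
  "moderated_upper_gradient p \<psi> g \<longleftrightarrow>
     (\<forall>x. \<psi> x \<noteq> - \<infinity>) \<and> (\<forall>x. 0 \<le> g x) \<and>
     (\<forall>I u. is_interval I \<longrightarrow> AC 1 I u \<longrightarrow>
        in_Lp p (speed_measure I u) (\<lambda>t. \<psi> (u t)) \<longrightarrow>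
        in_Lp 1 (speed_measure I u) (\<lambda>t. g (u t)) \<longrightarrow>
        (\<forall>s\<in>I. \<forall>t\<in>I. s \<le> t \<longrightarrow>
           ext_absdiff (\<psi> (u t)) (\<psi> (u s)) \<le>
             enn2ereal (\<integral>\<^sup>+ r\<in>{s..t}.
               (e2ennreal (g (u r)) * ennreal (metric_deriv I u r)) \<partial>lebesgue)))"

end

theory Submission
  imports Defs
begin

text \<open>
  Write \<open>V\<close> for the value function and \<open>G\<close> for \<^const>\<open>value_slope\<close>, so that
  \<open>G\<^sup>2 / 2 = (\<phi> - V) / \<epsilon>\<close>. The derivative bound is dynamic programming used twice. Starting at
  \<open>u s\<close> one may follow \<open>u\<close> up to time \<open>t\<close> and then continue almost optimally from \<open>u t\<close>; starting at
  \<open>u t\<close> one may run \<open>u\<close> backwards to \<open>u s\<close> and continue almost optimally from there. With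
  \<open>g = |u'|\<^sup>2 / 2 + \<phi> \<circ> u / \<epsilon>\<close> and \<open>f = V \<circ> u\<close> these two competitors give, for \<open>s \<le> t\<close>,
  \[ f(s) \le \int_s^t g(r) e^{-(r-s)/\epsilon} dr + e^{-(t-s)/\epsilon} f(t), \qquad
     f(t) \le \int_s^t g(r) e^{-(t-r)/\epsilon} dr + e^{-(t-s)/\epsilon} f(s). \]
  If \<open>f\<close> is finite at one time and \<open>g\<close> is integrable, then \<open>f\<close> is finite and bounded, the two inequalities
  bound its increments by an integral, and dividing by \<open>t - s\<close> gives \<open>\<bar>f'\<bar> \<le> g - f / \<epsilon>\<close>, which is
  \<open>|u'|\<^sup>2 / 2 + G\<^sup>2(u) / 2\<close> (lemmas \<open>dp_forward\<close>, \<open>dp_backward\<close>, \<open>ac_of_discounted_increments\<close>,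
  \<open>V_AC_along_curve\<close>).

  Three facts support the argument. First, \<open>V > -\<infinity>\<close>: by coercivity the negative part of \<open>\<phi>\<close> along a
  curve \<open>v\<close> is at most \<open>B d\<^sup>2(v(t), v(0))\<close> plus a constant, and a Hardy inequality for the exponential
  weight bounds the integral of \<open>d\<^sup>2\<close> by \<open>4 \<epsilon>\<^sup>2\<close> times that of \<open>|v'|\<^sup>2\<close> (lemmas \<open>weighted_hardy\<close>,
  \<open>wed_functional_facts\<close>). Second, convergence in the metric implies convergence in \<open>\<sigma>\<close>, so \<open>\<phi>\<close> is
  lower semicontinuous for the metric and \<open>\<phi> \<circ> u\<close> is Borel along continuous curves. Third, the metric
  derivative of an absolutely continuous curve exists almost everywhere, is its smallest admissible speed,
  and real absolutely continuous functions are integrals of their derivatives; these are derived here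
  from the Radon-Nikodym theorem and Lebesgue's differentiation theorem.

  For the upper gradient only \<open>V \<circ> u\<close> and \<open>G \<circ> u\<close> are known to be integrable, with respect to arc length.
  Fix \<open>\<delta> > 0\<close> and run through \<open>u\<close> with speed \<open>H = G \<circ> u + \<delta>\<close>. The time spent on an arc element is
  \<open>|u'| / H\<close>, so that after this change of time the energy \<open>\<integral> H\<^sup>2\<close> becomes \<open>\<integral> H |u'|\<close> in the old time,
  and \<open>\<integral> \<phi>\<^sup>+\<close> is bounded by \<open>\<integral> |V| |u'| / \<delta> + \<epsilon>/2 \<integral> G |u'|\<close>; both are finite. The first part applies to the new
  curve and gives \<open>\<integral> (G\<^sup>2 / 2 + H\<^sup>2 / 2) |u'| / H \<le> \<integral> (G + \<delta>) |u'|\<close> as a bound for the increment of \<open>V\<close>.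
  Let \<open>\<delta>\<close> tend to 0 (lemmas \<open>has_speed_time_change\<close>, \<open>upper_gradient_core\<close>).
\<close>

section \<open>Absolutely continuous functions of one real variable\<close>

lemma set_integrable_of_integrable:
  fixes g :: "real \<Rightarrow> real"
  assumes "integrable lebesgue g" "S \<in> sets lebesgue"
  shows "set_integrable lebesgue S g"
  using integrable_mult_indicator[OF assms(2,1)] by (simp add: set_integrable_def)

lemma set_integral_Iic_diff:
  fixes g :: "real \<Rightarrow> real"
  assumes "integrable lebesgue g" "s \<le> t"
  shows "(LINT r:{..t}|lebesgue. g r) - (LINT r:{..s}|lebesgue. g r) = (LINT r:{s..t}|lebesgue. g r)"
proof -
  have "{..t} = {..s} \<union> {s<..t}" using assms(2) by auto
  then have "(LINT r:{..t}|lebesgue. g r) = (LINT r:{..s}|lebesgue. g r) + (LINT r:{s<..t}|lebesgue. g r)"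
    by (simp add: set_integral_Un set_integrable_of_integrable[OF assms(1)] ivl_disj_int_one)
  moreover have "(LINT r:{s<..t}|lebesgue. g r) = (LINT r:{s..t}|lebesgue. g r)"
    unfolding set_lebesgue_integral_def
  proof (rule integral_cong_AE)
    show "AE r in lebesgue. indicator {s<..t} r *\<^sub>R g r = indicator {s..t} r *\<^sub>R g r"
      by (rule AE_mp[OF AE_completion[OF AE_lborel_singleton[of s]]], rule AE_I2) (auto simp: indicator_def)
  qed (use integrable_mult_indicator[OF _ assms(1)] in \<open>auto intro!: borel_measurable_integrable\<close>)
  ultimately show ?thesis by simp
qed

text \<open>
  Lebesgue's differentiation theorem on the line, as \<open>integrable_ccontinuous_explicit\<close> gives it: only
  with intervals to the right. Reflection yields the other side.
\<close>

lemma right_lebesgue_differentiation: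
  fixes g :: "real \<Rightarrow> real"
  assumes g: "integrable lebesgue g"
  shows "AE t in lebesgue. ((\<lambda>h. (LINT r:{t..t+h}|lebesgue. g r) / h) \<longlongrightarrow> g t) (at_right 0)"
proof -
  have int: "set_integrable lebesgue S g" if "S \<in> sets lebesgue" for S
    using set_integrable_of_integrable[OF g that] .
  have "g integrable_on cbox a b" for a b
    using set_lebesgue_integral_eq_integral(1)[OF int] by simp
  then obtain N where N: "negligible N"
     "\<And>x e. \<lbrakk>x \<notin> N; 0 < e\<rbrakk> \<Longrightarrow>
               \<exists>d>0. \<forall>h. 0 < h \<and> h < d \<longrightarrow>
                         norm(integral (cbox x (x + h *\<^sub>R One)) g /\<^sub>R h ^ DIM(real) - g x) < e"
    by (rule integrable_ccontinuous_explicit) blast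
  have "((\<lambda>h. (LINT r:{t..t+h}|lebesgue. g r) / h) \<longlongrightarrow> g t) (at_right 0)" if tN: "t \<notin> N" for t
    unfolding tendsto_iff eventually_at_right_field
  proof safe
    fix e :: real assume "e > 0"
    obtain d where d: "d>0" "\<forall>h. 0 < h \<and> h < d \<longrightarrow>
        norm(integral (cbox t (t + h *\<^sub>R One)) g /\<^sub>R h ^ DIM(real) - g t) < e"
      using N(2)[OF tN \<open>e > 0\<close>] by blast
    have "dist ((LINT r:{t..t+h}|lebesgue. g r) / h) (g t) < e" if "0 < h" "h < d" for h
      using d(2)[rule_format, of h] that set_lebesgue_integral_eq_integral(2)[OF int, of "{t..t+h}"]
      by (simp add: dist_real_def divide_inverse mult.commute)
    then show "\<exists>b>0. \<forall>y>0. y < b \<longrightarrow> dist ((LINT r:{t..t+y}|lebesgue. g r) / y) (g t) < e"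
      using d(1) by blast
  qed
  then show ?thesis
    using N(1) by (intro AE_I'[of N]) (auto simp: negligible_iff_null_sets)
qed

lemma AE_lebesgue_real_affine:
  assumes "AE x in lebesgue. P (x::real)" "c \<noteq> 0"
  shows "AE x in lebesgue. P (t + c * x)"
proof -
  obtain N where N: "{x. \<not> P x} \<subseteq> N" "N \<in> null_sets lebesgue"
    using assms(1) by (auto elim!: AE_E simp: null_sets_def)
  have "AE x in lebesgue. x \<notin> N"
    using N(2) by (rule AE_not_in)
  then have "AE x in density (distr lebesgue lebesgue (\<lambda>x. t + c * x)) (\<lambda>_. ennreal \<bar>c\<bar>). x \<notin> N"
    by (subst (asm) lebesgue_real_affine[OF assms(2), of t])
  then have "AE x in distr lebesgue lebesgue (\<lambda>x. t + c * x). x \<notin> N"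
    using assms(2) by (simp add: AE_density)
  then have "AE x in lebesgue. t + c * x \<notin> N"
    using N(2) lebesgue_affine_measurable[where c="\<lambda>_::real. c" and t=t] assms(2)
    by (subst (asm) AE_distr_iff) (auto simp: Collect_neg_eq Compl_in_sets_lebesgue)
  then show ?thesis
    using N(1) by (auto elim!: AE_mp)
qed

lemma integrable_lebesgue_reflect:
  fixes g :: "real \<Rightarrow> real"
  assumes "integrable lebesgue g"
  shows "integrable lebesgue (\<lambda>x. g (- x))"
  using has_bochner_integral_lebesgue_real_affine_iff[of "-1" g "integral\<^sup>L lebesgue g" 0] assms
  by (simp add: has_bochner_integral_integrable integrable.intros has_bochner_integral_iff)

lemma set_integral_reflect_Icc:
  fixes g :: "real \<Rightarrow> real"
  shows "(LINT r:{a..b}|lebesgue. g (- r)) = (LINT r:{-b..-a}|lebesgue. g r)"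
proof -
  have *: "indicator {- b..- a} (- r) = (indicator {a..b} r :: real)" for r
    by (auto simp: indicator_def)
  show ?thesis
    using lebesgue_integral_real_affine[of "-1" "\<lambda>r. indicator {-b..-a} r *\<^sub>R g r" 0]
    unfolding set_lebesgue_integral_def by (simp add: *)
qed

text \<open>
  Indefinite integrals are taken from \<open>-\<infinity>\<close>, so that no base point has to be carried along.
\<close>

lemma lebesgue_differentiation:
  fixes g :: "real \<Rightarrow> real"
  assumes g: "integrable lebesgue g"
  shows "AE t in lebesgue. ((\<lambda>x. LINT r:{..x}|lebesgue. g r) has_real_derivative g t) (at t)"
proof -
  have "AE t in lebesgue. ((\<lambda>h. (LINT r:{t..t+h}|lebesgue. g r) / h) \<longlongrightarrow> g t) (at_right 0)"
    by (rule right_lebesgue_differentiation[OF g])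
  moreover have "AE t in lebesgue. ((\<lambda>h. (LINT r:{t-h..t}|lebesgue. g r) / h) \<longlongrightarrow> g t) (at_right 0)"
    using AE_lebesgue_real_affine[OF right_lebesgue_differentiation[OF integrable_lebesgue_reflect[OF g]], of "-1" 0]
    by (simp add: set_integral_reflect_Icc)
  ultimately show ?thesis
  proof eventually_elim
    case (elim t)
    let ?P = "\<lambda>x. LINT r:{..x}|lebesgue. g r"
    have "((\<lambda>h. (?P (t + h) - ?P t) / h) \<longlongrightarrow> g t) (at_right 0)"
      using elim(1)
      by (rule Lim_transform_eventually)
         (auto simp: eventually_at_right_field set_integral_Iic_diff[OF g] intro!: exI[of _ 1])
    moreover have "((\<lambda>h. (?P (t + h) - ?P t) / h) \<longlongrightarrow> g t) (at_left 0)"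
    proof -
      have "((\<lambda>h. (?P (t + - h) - ?P t) / - h) \<longlongrightarrow> g t) (at_right 0)"
        using elim(2)
      proof (rule Lim_transform_eventually)
        have "(LINT r:{t-h..t}|lebesgue. g r) / h = (?P (t + - h) - ?P t) / - h" if "h > 0" for h
          using set_integral_Iic_diff[OF g, of "t - h" t] that by (simp add: field_simps)
        then show "\<forall>\<^sub>F h in at_right 0. (LINT r:{t-h..t}|lebesgue. g r) / h = (?P (t + - h) - ?P t) / - h"
          by (auto simp: eventually_at_right_field intro!: exI[of _ 1])
      qed
      then show ?thesis
        using filterlim_at_left_to_right[of "\<lambda>h. (?P (t + h) - ?P t) / h" "nhds (g t)" 0] by simp
    qed
    ultimately show ?case
      unfolding DERIV_def by (intro filterlim_split_at)
  qed
qed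

lemma continuous_on_set_integral_Iic:
  fixes g :: "real \<Rightarrow> real"
  assumes g: "integrable lebesgue g"
  shows "continuous_on UNIV (\<lambda>x. LINT r:{..x}|lebesgue. g r)"
proof (rule continuous_at_imp_continuous_on, rule)
  fix x :: real
  show "isCont (\<lambda>x. LINT r:{..x}|lebesgue. g r) x"
    unfolding continuous_at_sequentially comp_def
  proof safe
    fix y :: "nat \<Rightarrow> real" assume y: "y \<longlonglongrightarrow> x"
    show "(\<lambda>n. LINT r:{..y n}|lebesgue. g r) \<longlonglongrightarrow> (LINT r:{..x}|lebesgue. g r)"
      unfolding set_lebesgue_integral_def
    proof (rule integral_dominated_convergence[where w="\<lambda>r. norm (g r)"])
      show "AE r in lebesgue. (\<lambda>n. indicator {..y n} r *\<^sub>R g r) \<longlonglongrightarrow> indicator {..x} r *\<^sub>R g r"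
      proof (rule AE_mp[OF AE_completion[OF AE_lborel_singleton[of x]]], rule AE_I2, rule impI)
        fix r assume "r \<noteq> x"
        then consider "r < x" | "r > x" by linarith
        then have "\<forall>\<^sub>F n in sequentially. indicator {..y n} r *\<^sub>R g r = indicator {..x} r *\<^sub>R g r"
        proof cases
          case 1
          then have "\<forall>\<^sub>F n in sequentially. y n > r" using y order_tendstoD(1) by blast
          then show ?thesis by eventually_elim (use 1 in \<open>auto simp: indicator_def\<close>)
        next
          case 2
          then have "\<forall>\<^sub>F n in sequentially. y n < r" using y order_tendstoD(2) by blast
          then show ?thesis by eventually_elim (use 2 in \<open>auto simp: indicator_def\<close>)
        qed
        then show "(\<lambda>n. indicator {..y n} r *\<^sub>R g r) \<longlonglongrightarrow> indicator {..x} r *\<^sub>R g r"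
          by (rule tendsto_eventually)
      qed
      show "AE r in lebesgue. norm (indicator {..y n} r *\<^sub>R g r) \<le> norm (g r)" for n
        by (auto simp: indicator_def)
    qed (use g integrable_mult_indicator[OF _ g] in \<open>auto intro!: borel_measurable_integrable\<close>)
  qed
qed

text \<open>
  Measures that agree on half-open intervals agree, but an inequality does not pass from intervals to
  Borel sets so easily. It does when the difference on intervals is itself given by a measure \<open>N\<close>: then
  \<open>M + N\<close> and \<open>K\<close> agree.
\<close>

lemma emeasure_le_of_Ioc_split:
  fixes M N K :: "real measure"
  assumes sets: "sets M = sets borel" "sets N = sets borel" "sets K = sets borel"
    and Ioc: "\<And>a b. a \<le> b \<Longrightarrow> emeasure M {a<..b} + emeasure N {a<..b} = emeasure K {a<..b}"
    and fin: "\<And>a b. a \<le> b \<Longrightarrow> emeasure K {a<..b} < \<infinity>"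
    and A: "A \<in> sets borel"
  shows "emeasure M A \<le> emeasure K A"
proof -
  have [measurable_cong]: "sets M = sets borel" "sets N = sets borel" by fact+
  define S where "S = measure_of UNIV (sets borel) (\<lambda>A. emeasure M A + emeasure N A)"
  have S: "emeasure S A = emeasure M A + emeasure N A" if "A \<in> sets borel" for A
    unfolding S_def
  proof (rule emeasure_measure_of_sigma)
    show "sigma_algebra UNIV (sets borel :: real set set)"
      using sets.sigma_algebra_axioms[of "borel :: real measure"] by simp
    show "positive (sets borel) (\<lambda>A. emeasure M A + emeasure N A)"
      by (simp add: positive_def)
    show "countably_additive (sets borel) (\<lambda>A. emeasure M A + emeasure N A)"
      unfolding countably_additive_def
    proof (intro allI impI)
      fix X :: "nat \<Rightarrow> real set"
      assume X: "range X \<subseteq> sets borel" "disjoint_family X" "\<Union> (range X) \<in> sets borel"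
      show "(\<Sum>i. emeasure M (X i) + emeasure N (X i)) = emeasure M (\<Union> (range X)) + emeasure N (\<Union> (range X))"
        using X sets by (subst suminf_add[symmetric]) (auto intro!: arg_cong2[where f="(+)"] suminf_emeasure)
    qed
  qed (fact that)
  have sS: "sets S = sets borel"
    unfolding S_def using sets.sigma_sets_eq[of "borel :: real measure"] by (simp add: sets_measure_of_conv)
  have "S = K"
  proof (rule measure_eqI_generator_eq[where E="range (\<lambda>(a, b). {a<..b})" and \<Omega>=UNIV and A="\<lambda>n::nat. {- real n<..real n}"])
    show "Int_stable (range (\<lambda>(a, b). {a<..b::real}))"
      by (auto simp: Int_stable_def)
    show "sets S = sigma_sets UNIV (range (\<lambda>(a, b). {a<..b}))" "sets K = sigma_sets UNIV (range (\<lambda>(a, b). {a<..b}))"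
      using sS sets(3) by (simp_all add: borel_sigma_sets_Ioc)
    show "(\<Union>n::nat. {- real n<..real n}) = UNIV"
    proof (rule set_eqI, simp)
      fix x :: real
      obtain n where "real n > \<bar>x\<bar>" using reals_Archimedean2 by blast
      then show "\<exists>n. - real n < x \<and> x \<le> real n" by (intro exI[of _ n]) auto
    qed
    show "emeasure S X = emeasure K X" if XE: "X \<in> range (\<lambda>(a, b). {a<..b})" for X
    proof -
      obtain a b where X: "X = {a<..b}" using XE by auto
      show ?thesis
      proof (cases "a \<le> b")
        case True then show ?thesis using Ioc by (simp add: X S)
      qed (simp add: X)
    qed
    show "emeasure S {- real n<..real n} \<noteq> \<infinity>" for n
      using fin[of "- real n" "real n"] Ioc[of "- real n" "real n"] by (simp add: S)
  qed auto
  then show ?thesis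
    using S[OF A] by simp
qed

lemma set_integral_cong_AE_lebesgue:
  fixes f g :: "real \<Rightarrow> real"
  assumes "integrable lebesgue f" "integrable lebesgue g" "AE x in lebesgue. x \<in> S \<longrightarrow> f x = g x" "S \<in> sets lebesgue"
  shows "(LINT r:S|lebesgue. f r) = (LINT r:S|lebesgue. g r)"
  unfolding set_lebesgue_integral_def
proof (rule integral_cong_AE)
  show "AE x in lebesgue. indicator S x *\<^sub>R f x = indicator S x *\<^sub>R g x"
    using assms(3) by eventually_elim (auto simp: indicator_def)
qed (use integrable_mult_indicator[OF assms(4,1)] integrable_mult_indicator[OF assms(4,2)] in \<open>auto intro!: borel_measurable_integrable\<close>)

lemma borel_representative:
  fixes g :: "real \<Rightarrow> real"
  assumes g: "integrable lebesgue g" "\<And>x. g x \<ge> 0"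
  obtains h where "h \<in> borel_measurable borel" "integrable lebesgue h" "\<And>x. h x \<ge> 0"
    "\<And>S. S \<in> sets lebesgue \<Longrightarrow> (LINT r:S|lebesgue. g r) = (LINT r:S|lebesgue. h r)"
    "AE x in lebesgue. g x = h x"
proof -
  obtain f where f: "f \<in> borel_measurable lborel" "AE x in lborel. g x = f x"
    using completion_ex_borel_measurable_real[OF borel_measurable_integrable[OF g(1)]] by blast
  define h where "h = (\<lambda>x. \<bar>f x\<bar>)"
  have hb: "h \<in> borel_measurable borel" using f(1) unfolding h_def by measurable
  have ae: "AE x in lebesgue. g x = h x"
    using AE_completion[OF f(2)]
  proof eventually_elim
    case (elim x)
    then show ?case using g(2)[of x] by (simp add: h_def)
  qed
  have hi: "integrable lebesgue h"
    using g(1) ae hb by (subst integrable_cong_AE[of _ _ g]) (auto intro: measurable_completion)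
  show thesis
  proof (rule that[OF hb hi])
    show "(LINT r:S|lebesgue. g r) = (LINT r:S|lebesgue. h r)" if "S \<in> sets lebesgue" for S
      using ae by (intro set_integral_cong_AE_lebesgue[OF g(1) hi _ that]) auto
  qed (use ae in \<open>auto simp: h_def\<close>)
qed

lemma nn_integral_eq_set_integral:
  fixes f :: "real \<Rightarrow> real"
  assumes f: "f \<in> borel_measurable borel" "\<And>x. f x \<ge> 0" "set_integrable lebesgue S f" and S: "S \<in> sets borel"
  shows "(\<integral>\<^sup>+x\<in>S. ennreal (f x) \<partial>lborel) = ennreal (LINT x:S|lebesgue. f x)"
proof -
  have "(\<integral>\<^sup>+x\<in>S. ennreal (f x) \<partial>lborel) = (\<integral>\<^sup>+x. ennreal (indicator S x *\<^sub>R f x) \<partial>lborel)"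
    by (intro nn_integral_cong) (auto simp: indicator_def)
  also have "\<dots> = (\<integral>\<^sup>+x. ennreal (indicator S x *\<^sub>R f x) \<partial>lebesgue)"
    using f(1) S by (intro nn_integral_completion[symmetric]) measurable
  also have "\<dots> = ennreal (LINT x:S|lebesgue. f x)"
    unfolding set_lebesgue_integral_def
    using f(2,3) by (intro nn_integral_eq_integral) (auto simp: set_integrable_def)
  finally show ?thesis .
qed

text \<open>
  The idea is to realise \<open>f\<close>, up to the integral \<open>P\<close> of \<open>m\<close>, as the distribution function of a
  measure. Both \<open>P + f\<close> and \<open>P - f\<close> are nondecreasing and continuous, and their Stieltjes measures add up
  to the measure with density \<open>2 m\<close>; hence the first one is absolutely continuous and has a density.
\<close>

lemma ac_real_representation:
  fixes f m :: "real \<Rightarrow> real"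
  assumes m: "integrable lebesgue m" "\<And>x. m x \<ge> 0"
    and f: "\<And>s t. s \<le> t \<Longrightarrow> \<bar>f t - f s\<bar> \<le> (LINT r:{s..t}|lebesgue. m r)"
  obtains g where "g \<in> borel_measurable borel" "integrable lebesgue g"
    "\<And>s t. s \<le> t \<Longrightarrow> f t - f s = (LINT r:{s..t}|lebesgue. g r)"
proof -
  obtain m' where m'b [measurable]: "m' \<in> borel_measurable borel" and m'i: "integrable lebesgue m'"
    and m'0: "\<And>x. m' x \<ge> 0"
    and m'_eq: "\<And>S. S \<in> sets lebesgue \<Longrightarrow> (LINT r:S|lebesgue. m r) = (LINT r:S|lebesgue. m' r)"
    and "AE x in lebesgue. m x = m' x"
    by (rule borel_representative[OF m]) (rule that)
  define P where "P x = (LINT r:{..x}|lebesgue. m' r)" for x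
  have Pd: "P t - P s = (LINT r:{s..t}|lebesgue. m' r)" if "s \<le> t" for s t
    unfolding P_def by (rule set_integral_Iic_diff[OF m'i that])
  have fP: "\<bar>f t - f s\<bar> \<le> P t - P s" if "s \<le> t" for s t
    using f[OF that] Pd[OF that] m'_eq[of "{s..t}"] by simp
  have cP: "isCont P x" for x
    using continuous_on_set_integral_Iic[OF m'i] unfolding P_def[symmetric] by (simp add: continuous_on_eq_continuous_at)
  have cf: "isCont f x" for x
    unfolding isCont_def LIM_def
  proof safe
    fix e :: real assume "e > 0"
    then obtain d where "d > 0" "\<forall>y. y \<noteq> x \<and> dist y x < d \<longrightarrow> dist (P y) (P x) < e"
      using cP[of x] unfolding isCont_def LIM_def by blast
    moreover have "dist (f y) (f x) \<le> dist (P y) (P x)" for y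
      using fP[of x y] fP[of y x] by (cases "x \<le> y") (auto simp: dist_real_def)
    ultimately show "\<exists>d>0. \<forall>y. y \<noteq> x \<and> dist y x < d \<longrightarrow> dist (f y) (f x) < e"
      by (meson le_less_trans)
  qed
  define F1 where "F1 x = P x + f x" for x
  define F2 where "F2 x = P x - f x" for x
  have c1: "continuous (at_right a) F1" and c2: "continuous (at_right a) F2" and c3: "continuous (at_right a) P" for a
    using continuous_at_imp_continuous_at_within[OF cP[of a]] continuous_at_imp_continuous_at_within[OF cf[of a]]
    unfolding F1_def F2_def by (simp_all add: continuous_add continuous_diff)
  have mono1: "F1 x \<le> F1 y" and mono2: "F2 x \<le> F2 y" if "x \<le> y" for x y
    using fP[OF that] unfolding F1_def F2_def by linarith+
  define K where "K = density lborel (\<lambda>x. ennreal (2 * m' x))"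
  have i2: "integrable lebesgue (\<lambda>x. 2 * m' x)" using m'i by simp
  have K: "emeasure K {a<..b} = ennreal (2 * (P b - P a))" if "a \<le> b" for a b
  proof -
    have "emeasure K {a<..b} = (\<integral>\<^sup>+x\<in>{a<..b}. ennreal (2 * m' x) \<partial>lborel)"
      by (simp add: K_def emeasure_density)
    also have "\<dots> = (\<integral>\<^sup>+x\<in>{a..b}. ennreal (2 * m' x) \<partial>lborel)"
    proof (rule nn_integral_cong_AE)
      show "AE x in lborel. ennreal (2 * m' x) * indicator {a<..b} x = ennreal (2 * m' x) * indicator {a..b} x"
        using AE_lborel_singleton[of a] by eventually_elim (auto simp: indicator_def)
    qed
    also have "\<dots> = ennreal (LINT x:{a..b}|lebesgue. 2 * m' x)"
      using m'0 set_integrable_of_integrable[OF i2] by (intro nn_integral_eq_set_integral) auto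
    finally show ?thesis by (simp add: Pd[OF that])
  qed
  let ?M = "interval_measure F1"
  have M: "emeasure ?M {a<..b} = ennreal (F1 b - F1 a)" if "a \<le> b" for a b
    by (rule emeasure_interval_measure_Ioc[OF that mono1 c1])
  have N: "emeasure (interval_measure F2) {a<..b} = ennreal (F2 b - F2 a)" if "a \<le> b" for a b
    by (rule emeasure_interval_measure_Ioc[OF that mono2 c2])
  have le: "emeasure ?M A \<le> emeasure K A" if "A \<in> sets borel" for A
  proof (rule emeasure_le_of_Ioc_split[OF _ _ _ _ _ that])
    show "emeasure ?M {a<..b} + emeasure (interval_measure F2) {a<..b} = emeasure K {a<..b}" if "a \<le> b" for a b
      using mono1[OF that] mono2[OF that] by (simp add: M N K that F1_def F2_def flip: ennreal_plus)
    show "emeasure K {a<..b} < \<infinity>" if "a \<le> b" for a b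
      by (simp add: K that)
  qed (auto simp: K_def)
  have "absolutely_continuous lborel ?M"
    unfolding absolutely_continuous_def
  proof
    fix A :: "real set" assume A: "A \<in> null_sets lborel"
    then have "A \<in> null_sets K"
      unfolding K_def by (subst null_sets_density_iff) (auto intro: AE_mp[OF AE_not_in[OF A]])
    then have "emeasure ?M A = 0"
      using le[of A] A by (auto simp: null_sets_def)
    then show "A \<in> null_sets ?M" using A by (auto simp: null_sets_def)
  qed
  then obtain h where h: "h \<in> borel_measurable lborel" "density lborel h = ?M"
    using sigma_finite_measure.Radon_Nikodym[OF sigma_finite_lborel, of ?M] by auto
  have h_int: "(\<integral>\<^sup>+x\<in>{s<..t}. h x \<partial>lborel) = ennreal (F1 t - F1 s)" if "s \<le> t" for s t
    using M[OF that] h emeasure_density[OF h(1), of "{s<..t}"] by simp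
  have "(\<integral>\<^sup>+x. h x \<partial>lborel) = emeasure ?M UNIV"
    using h emeasure_density[OF h(1), of UNIV] by simp
  also have "\<dots> \<le> emeasure K UNIV" by (rule le) simp
  also have "\<dots> = (\<integral>\<^sup>+x. ennreal (2 * m' x) \<partial>lebesgue)"
    by (simp add: K_def emeasure_density nn_integral_completion)
  also have "\<dots> < \<infinity>"
    using i2 m'0 by (subst nn_integral_eq_integral) auto
  finally have hfin: "(\<integral>\<^sup>+x. h x \<partial>lborel) < \<infinity>" .
  define k where "k = (\<lambda>x. enn2real (h x))"
  have kb: "k \<in> borel_measurable borel" using h(1) by (simp add: k_def)
  have hk: "AE x in lborel. h x = ennreal (k x)"
    using nn_integral_PInf_AE[of h lborel] h(1) hfin
    by (auto simp: k_def less_top elim!: AE_mp)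
  have "integrable lborel k"
    unfolding integrable_iff_bounded
  proof
    have "(\<integral>\<^sup>+x. ennreal (norm (k x)) \<partial>lborel) = (\<integral>\<^sup>+x. h x \<partial>lborel)"
      using hk by (intro nn_integral_cong_AE) (auto simp: k_def elim!: AE_mp)
    then show "(\<integral>\<^sup>+x. ennreal (norm (k x)) \<partial>lborel) < \<infinity>" using hfin by simp
  qed (use kb in simp)
  then have ki: "integrable lebesgue k" by (simp add: integrable_completion)
  have kF: "(LINT x:{s..t}|lebesgue. k x) = F1 t - F1 s" if "s \<le> t" for s t
  proof -
    have "ennreal (LINT x:{s..t}|lebesgue. k x) = (\<integral>\<^sup>+x\<in>{s..t}. ennreal (k x) \<partial>lborel)"
      by (intro nn_integral_eq_set_integral[symmetric] kb set_integrable_of_integrable[OF ki]) (auto simp: k_def)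
    also have "\<dots> = (\<integral>\<^sup>+x\<in>{s<..t}. h x \<partial>lborel)"
    proof (rule nn_integral_cong_AE)
      show "AE x in lborel. ennreal (k x) * indicator {s..t} x = h x * indicator {s<..t} x"
        using hk AE_lborel_singleton[of s] by eventually_elim (auto simp: indicator_def)
    qed
    also have "\<dots> = ennreal (F1 t - F1 s)" by (rule h_int[OF that])
    finally show ?thesis
      using mono1[OF that] by (subst (asm) ennreal_inj) (auto simp: k_def set_lebesgue_integral_def)
  qed
  show thesis
  proof (rule that[of "\<lambda>x. k x - m' x"])
    show "f t - f s = (LINT r:{s..t}|lebesgue. k r - m' r)" if "s \<le> t" for s t
      using kF[OF that] Pd[OF that] set_integrable_of_integrable[OF ki] set_integrable_of_integrable[OF m'i]
      by (simp add: set_integral_diff F1_def)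
  qed (use kb ki m'i in auto)
qed

section \<open>Metric derivatives and speed bounds\<close>

text \<open>
  The functions \<open>\<integral> m + \<integral> g\<close> and \<open>\<integral> m - \<integral> g\<close> are nondecreasing, so their derivatives \<open>m + g\<close> and \<open>m - g\<close>
  are nonnegative.
\<close>

lemma AE_abs_le_of_integral_le:
  fixes g m :: "real \<Rightarrow> real"
  assumes g: "integrable lebesgue g" and m: "integrable lebesgue m"
    and le: "\<And>s t. s \<le> t \<Longrightarrow> \<bar>LINT r:{s..t}|lebesgue. g r\<bar> \<le> (LINT r:{s..t}|lebesgue. m r)"
  shows "AE t in lebesgue. \<bar>g t\<bar> \<le> m t"
  using lebesgue_differentiation[OF g] lebesgue_differentiation[OF m]
proof eventually_elim
  case (elim t)
  let ?G = "\<lambda>x. LINT r:{..x}|lebesgue. g r" and ?M = "\<lambda>x. LINT r:{..x}|lebesgue. m r"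
  have *: "\<bar>?G y - ?G x\<bar> \<le> ?M y - ?M x" if "x \<le> y" for x y
    using le[OF that] by (simp add: set_integral_Iic_diff[OF g that] set_integral_Iic_diff[OF m that])
  have mono: "mono_on UNIV (\<lambda>x. ?M x + ?G x)" "mono_on UNIV (\<lambda>x. ?M x - ?G x)"
    by (intro mono_onI; use * in \<open>fastforce simp: abs_le_iff\<close>)+
  have "m t + g t \<ge> 0"
    by (rule mono_on_imp_deriv_nonneg[OF mono(1)]) (use elim in \<open>auto intro!: derivative_intros\<close>)
  moreover have "m t - g t \<ge> 0"
    by (rule mono_on_imp_deriv_nonneg[OF mono(2)]) (use elim in \<open>auto intro!: derivative_intros\<close>)
  ultimately show ?case by linarith
qed

lemma set_integral_mono_lebesgue:
  fixes f g :: "real \<Rightarrow> real"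
  assumes "integrable lebesgue f" "integrable lebesgue g" "AE x in lebesgue. x \<in> S \<longrightarrow> f x \<le> g x" "S \<in> sets lebesgue"
  shows "(LINT r:S|lebesgue. f r) \<le> (LINT r:S|lebesgue. g r)"
  unfolding set_lebesgue_integral_def
  by (rule integral_mono_AE[OF integrable_mult_indicator[OF assms(4,1)] integrable_mult_indicator[OF assms(4,2)]])
     (use assms(3) in \<open>eventually_elim, auto simp: indicator_def\<close>)

lemma set_integral_mono_subset:
  fixes f :: "real \<Rightarrow> real"
  assumes "integrable lebesgue f" "\<And>x. f x \<ge> 0" "S \<subseteq> T" "S \<in> sets lebesgue" "T \<in> sets lebesgue"
  shows "(LINT r:S|lebesgue. f r) \<le> (LINT r:T|lebesgue. f r)"
  unfolding set_lebesgue_integral_def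
  by (rule integral_mono[OF integrable_mult_indicator[OF assms(4,1)] integrable_mult_indicator[OF assms(5,1)]])
     (use assms(2,3) in \<open>auto simp: indicator_def\<close>)

lemma abs_set_integral_le:
  fixes f :: "real \<Rightarrow> real"
  shows "\<bar>LINT r:S|lebesgue. f r\<bar> \<le> (LINT r:S|lebesgue. \<bar>f r\<bar>)"
proof -
  have "\<bar>LINT r:S|lebesgue. f r\<bar> \<le> (LINT r|lebesgue. norm (indicator S r *\<^sub>R f r))"
    unfolding set_lebesgue_integral_def using integral_norm_bound[of lebesgue "\<lambda>r. indicator S r *\<^sub>R f r"] by simp
  also have "\<dots> = (LINT r:S|lebesgue. \<bar>f r\<bar>)"
    unfolding set_lebesgue_integral_def by (rule Bochner_Integration.integral_cong) (auto simp: indicator_def)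
  finally show ?thesis .
qed

text \<open>
  Stopping a curve outside \<open>{a..b}\<close> makes it a curve on the whole line with the same bound on its speed.
\<close>

lemma dist_clamp_le_set_integral:
  fixes u :: "real \<Rightarrow> 'a::metric_space"
  assumes ab: "a \<le> b" and m: "integrable lebesgue m" "\<And>x. m x \<ge> 0"
    and u: "\<And>s t. s \<in> {a..b} \<Longrightarrow> t \<in> {a..b} \<Longrightarrow> s \<le> t \<Longrightarrow> dist (u s) (u t) \<le> (LINT r:{s..t}|lebesgue. m r)"
    and st: "s \<le> t"
  shows "dist (u (max a (min b s))) (u (max a (min b t))) \<le> (LINT r:{s..t}|lebesgue. m r)"
proof -
  define c where "c t = max a (min b t)" for t
  have "dist (u (c s)) (u (c t)) \<le> (LINT r:{s..t}|lebesgue. m r)"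
  proof (cases "c s = c t")
    case True
    then show ?thesis using m(2) by (auto simp: set_lebesgue_integral_def intro!: integral_nonneg_AE)
  next
    case False
    have "dist (u (c s)) (u (c t)) \<le> (LINT r:{c s..c t}|lebesgue. m r)"
      using ab st by (intro u) (auto simp: c_def)
    also have "\<dots> \<le> (LINT r:{s..t}|lebesgue. m r)"
      using False st ab m(2)
      by (intro set_integral_mono_subset m(1)) (auto simp: c_def max_def min_def split: if_splits)
    finally show ?thesis .
  qed
  then show ?thesis by (simp add: c_def)
qed

text \<open>
  Existence of the metric derivative, and its minimality among the admissible speeds. The curve is tested
  with the real functions \<open>t \<mapsto> d(u t, u q)\<close> for rational \<open>q\<close>; these are absolutely continuous with some
  derivatives \<open>g q\<close>, and \<open>w = sup \<bar>g q\<bar>\<close> is the metric derivative. Indeed, \<open>\<integral> w\<close> bounds every increment of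
  every test function, and letting \<open>q\<close> tend to \<open>s\<close> it bounds \<open>d(u s, u t)\<close>; so the difference quotients
  have upper limit at most \<open>w\<close>. They dominate those of each test function, so the lower limit is at least
  \<open>w\<close>.
\<close>

lemma metric_derivative_Icc:
  fixes u :: "real \<Rightarrow> 'a::metric_space" and m :: "real \<Rightarrow> real"
  assumes ab: "a \<le> b" and m: "integrable lebesgue m" "\<And>x. m x \<ge> 0"
    and u: "\<And>s t. s \<in> {a..b} \<Longrightarrow> t \<in> {a..b} \<Longrightarrow> s \<le> t \<Longrightarrow> dist (u s) (u t) \<le> (LINT r:{s..t}|lebesgue. m r)"
  obtains w where "w \<in> borel_measurable borel" "\<And>x. w x \<ge> 0" "integrable lebesgue w" "AE x in lebesgue. w x \<le> m x"
    "\<And>s t. s \<in> {a..b} \<Longrightarrow> t \<in> {a..b} \<Longrightarrow> s \<le> t \<Longrightarrow> dist (u s) (u t) \<le> (LINT r:{s..t}|lebesgue. w r)"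
    "AE t in lebesgue. a < t \<and> t < b \<longrightarrow> ((\<lambda>s. dist (u s) (u t) / \<bar>t - s\<bar>) \<longlongrightarrow> w t) (at t)"
proof -
  obtain M where Mb: "M \<in> borel_measurable borel" and Mi: "integrable lebesgue M" and M0: "\<And>x. M x \<ge> 0"
    and M_eq: "\<And>S. S \<in> sets lebesgue \<Longrightarrow> (LINT r:S|lebesgue. m r) = (LINT r:S|lebesgue. M r)"
    and mM: "AE x in lebesgue. m x = M x"
    by (rule borel_representative[OF m]) (rule that)
  define c where "c t = max a (min b t)" for t
  define v where "v t = u (c t)" for t
  have v_eq: "v t = u t" if "t \<in> {a..b}" for t using that by (auto simp: v_def c_def)
  have vM: "dist (v s) (v t) \<le> (LINT r:{s..t}|lebesgue. M r)" if st: "s \<le> t" for s t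
    using dist_clamp_le_set_integral[OF ab m u st] M_eq[of "{s..t}"] by (simp add: v_def c_def)
  define \<xi> where "\<xi> q t = dist (v t) (v q)" for q t
  have "\<exists>g. g \<in> borel_measurable borel \<and> integrable lebesgue g \<and>
      (\<forall>s t. s \<le> t \<longrightarrow> \<xi> q t - \<xi> q s = (LINT r:{s..t}|lebesgue. g r))" for q
  proof -
    have "\<bar>\<xi> q t - \<xi> q s\<bar> \<le> (LINT r:{s..t}|lebesgue. M r)" if "s \<le> t" for s t
      using vM[OF that] abs_dist_diff_le[of "v t" "v q" "v s"] by (simp add: \<xi>_def dist_commute)
    then show ?thesis using ac_real_representation[OF Mi M0, of "\<xi> q"] by metis
  qed
  then obtain g where g: "\<And>q. g q \<in> borel_measurable borel" "\<And>q. integrable lebesgue (g q)"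
      "\<And>q s t. s \<le> t \<Longrightarrow> \<xi> q t - \<xi> q s = (LINT r:{s..t}|lebesgue. g q r)"
    by metis
  have gM: "AE t in lebesgue. \<forall>q\<in>\<rat>. \<bar>g q t\<bar> \<le> M t"
  proof (subst AE_ball_countable[OF countable_rat], rule ballI)
    fix q :: real
    have "\<bar>LINT r:{s..t}|lebesgue. g q r\<bar> \<le> (LINT r:{s..t}|lebesgue. M r)" if "s \<le> t" for s t
      using vM[OF that] abs_dist_diff_le[of "v t" "v q" "v s"] g(3)[OF that, of q, symmetric]
      by (simp add: \<xi>_def dist_commute)
    then show "AE t in lebesgue. \<bar>g q t\<bar> \<le> M t"
      by (intro AE_abs_le_of_integral_le g Mi)
  qed
  \<comment> \<open>The minimum with \<open>M\<close> makes the supremum finite everywhere; almost everywhere it has no effect.\<close>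
  define w where "w t = (SUP q\<in>(\<rat>::real set). min \<bar>g q t\<bar> (M t))" for t
  have bdd: "bdd_above ((\<lambda>q. min \<bar>g q t\<bar> (M t)) ` \<rat>)" for t
    by (rule bdd_aboveI[of _ "M t"]) auto
  have wb: "w \<in> borel_measurable borel"
    unfolding w_def using g(1) Mb bdd by (intro borel_measurable_cSUP countable_rat) auto
  have w_ge: "min \<bar>g q t\<bar> (M t) \<le> w t" if "q \<in> \<rat>" for q t
    unfolding w_def by (rule cSUP_upper[OF that bdd])
  have w0: "w t \<ge> 0" for t
    using w_ge[of 0 t] M0[of t] by auto
  have wM: "w t \<le> M t" for t
    unfolding w_def by (rule cSUP_least) auto
  have wi: "integrable lebesgue w"
    by (rule Bochner_Integration.integrable_bound[OF Mi])
       (use wb w0 wM M0 in \<open>auto intro: measurable_completion\<close>)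
  have gw: "AE t in lebesgue. \<forall>q\<in>\<rat>. \<bar>g q t\<bar> \<le> w t"
    using gM
  proof eventually_elim
    case (elim t)
    then show ?case using w_ge[of _ t] by (metis min.absorb1)
  qed
  have Pc: "continuous_on UNIV (\<lambda>x. LINT r:{..x}|lebesgue. M r)"
    by (rule continuous_on_set_integral_Iic[OF Mi])
  have vw: "dist (v s) (v t) \<le> (LINT r:{s..t}|lebesgue. w r)" if st: "s \<le> t" for s t
  proof (rule field_le_epsilon)
    fix e :: real assume "e > 0"
    have "isCont (\<lambda>x. LINT r:{..x}|lebesgue. M r) s"
      using Pc by (simp add: continuous_on_eq_continuous_at)
    then obtain d where d: "d > 0" "\<And>y. y \<noteq> s \<Longrightarrow> dist y s < d \<Longrightarrow>
        dist (LINT r:{..y}|lebesgue. M r) (LINT r:{..s}|lebesgue. M r) < e/2"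
      unfolding isCont_def LIM_def using \<open>e > 0\<close> by (metis half_gt_zero)
    obtain q where q: "q \<in> \<rat>" "s < q" "q < s + d"
      using Rats_dense_in_real[of s "s + d"] d(1) by auto
    have "dist (v s) (v q) \<le> (LINT r:{s..q}|lebesgue. M r)" using q by (intro vM) auto
    also have "\<dots> = (LINT r:{..q}|lebesgue. M r) - (LINT r:{..s}|lebesgue. M r)"
      using q by (intro set_integral_Iic_diff[OF Mi, symmetric]) auto
    also have "\<dots> < e/2"
      using d(2)[of q] q abs_ge_self[of "(LINT r:{..q}|lebesgue. M r) - (LINT r:{..s}|lebesgue. M r)"]
      unfolding dist_real_def by linarith
    finally have sq: "dist (v s) (v q) < e/2" .
    have "\<xi> q t - \<xi> q s \<le> (LINT r:{s..t}|lebesgue. \<bar>g q r\<bar>)"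
      using abs_set_integral_le[of "{s..t}" "g q"] g(3)[OF st, of q] by linarith
    also have "\<dots> \<le> (LINT r:{s..t}|lebesgue. w r)"
      using gw q(1) by (intro set_integral_mono_lebesgue wi) (auto intro: integrable_abs g elim!: AE_mp)
    finally have "\<xi> q t - \<xi> q s \<le> (LINT r:{s..t}|lebesgue. w r)" .
    then show "dist (v s) (v t) \<le> (LINT r:{s..t}|lebesgue. w r) + e"
      using sq dist_triangle[of "v s" "v t" "v q"] by (simp add: \<xi>_def dist_commute)
  qed
  have der_g: "AE t in lebesgue. \<forall>q\<in>\<rat>. ((\<lambda>x. LINT r:{..x}|lebesgue. g q r) has_real_derivative g q t) (at t)"
    using lebesgue_differentiation[OF g(2)] by (subst AE_ball_countable[OF countable_rat]) auto
  have lim: "AE t in lebesgue. ((\<lambda>s. dist (v s) (v t) / \<bar>t - s\<bar>) \<longlongrightarrow> w t) (at t)"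
    using gM der_g lebesgue_differentiation[OF wi]
  proof eventually_elim
    case (elim t)
    let ?P = "\<lambda>f x. LINT r:{..x}|lebesgue. f r"
    have abs_diff: "\<bar>?P f s - ?P f t\<bar> = \<bar>LINT r:{min s t..max s t}|lebesgue. f r\<bar>" if "integrable lebesgue f" for f :: "real \<Rightarrow> real" and s
      using set_integral_Iic_diff[OF that, of s t] set_integral_Iic_diff[OF that, of t s]
      by (cases "s \<le> t") (auto simp: min_def max_def abs_minus_commute)
    have quot: "((\<lambda>s. \<bar>?P f s - ?P f t\<bar> / \<bar>t - s\<bar>) \<longlongrightarrow> \<bar>D\<bar>) (at t)" if "(?P f has_real_derivative D) (at t)" for f :: "real \<Rightarrow> real" and D
      using tendsto_rabs[OF that[unfolded has_field_derivative_iff]] by (simp add: abs_minus_commute)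
    have ub: "dist (v s) (v t) / \<bar>t - s\<bar> \<le> \<bar>?P w s - ?P w t\<bar> / \<bar>t - s\<bar>" for s
    proof -
      have "dist (v s) (v t) \<le> (LINT r:{min s t..max s t}|lebesgue. w r)"
        using vw[of s t] vw[of t s] by (cases "s \<le> t") (auto simp: dist_commute min_def max_def)
      then show ?thesis unfolding abs_diff[OF wi] by (intro divide_right_mono) auto
    qed
    have lb: "\<bar>?P (g q) s - ?P (g q) t\<bar> / \<bar>t - s\<bar> \<le> dist (v s) (v t) / \<bar>t - s\<bar>" for s q
    proof -
      have "\<bar>LINT r:{min s t..max s t}|lebesgue. g q r\<bar> = \<bar>\<xi> q (max s t) - \<xi> q (min s t)\<bar>"
        using g(3)[of "min s t" "max s t" q] by simp
      also have "\<dots> \<le> dist (v s) (v t)"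
        using abs_dist_diff_le[of "v s" "v q" "v t"]
        by (auto simp: \<xi>_def max_def min_def abs_minus_commute dist_commute)
      finally show ?thesis unfolding abs_diff[OF g(2)] by (intro divide_right_mono) auto
    qed
    show ?case
    proof (rule order_tendstoI)
      fix y assume "y < w t"
      then obtain q where q: "q \<in> \<rat>" "y < min \<bar>g q t\<bar> (M t)"
        unfolding w_def by (subst (asm) less_cSUP_iff[OF _ bdd]) auto
      then have "\<forall>\<^sub>F s in at t. y < \<bar>?P (g q) s - ?P (g q) t\<bar> / \<bar>t - s\<bar>"
        using elim(2) by (intro order_tendstoD(1)[OF quot]) auto
      then show "\<forall>\<^sub>F s in at t. y < dist (v s) (v t) / \<bar>t - s\<bar>"
        by eventually_elim (use lb in \<open>meson less_le_trans\<close>)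
    next
      fix y assume "w t < y"
      then have "\<forall>\<^sub>F s in at t. \<bar>?P w s - ?P w t\<bar> / \<bar>t - s\<bar> < y"
        using elim(3) w0[of t] by (intro order_tendstoD(2)[OF quot]) auto
      then show "\<forall>\<^sub>F s in at t. dist (v s) (v t) / \<bar>t - s\<bar> < y"
        by eventually_elim (use ub in \<open>meson le_less_trans\<close>)
    qed
  qed
  show thesis
  proof (rule that[of w])
    show "AE x in lebesgue. w x \<le> m x" using mM by eventually_elim (use wM in auto)
    show "dist (u s) (u t) \<le> (LINT r:{s..t}|lebesgue. w r)" if "s \<in> {a..b}" "t \<in> {a..b}" "s \<le> t" for s t
      using vw[OF that(3)] v_eq that by simp
    show "AE t in lebesgue. a < t \<and> t < b \<longrightarrow> ((\<lambda>s. dist (u s) (u t) / \<bar>t - s\<bar>) \<longlongrightarrow> w t) (at t)"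
      using lim
    proof (eventually_elim, safe)
      fix t assume L: "((\<lambda>s. dist (v s) (v t) / \<bar>t - s\<bar>) \<longlongrightarrow> w t) (at t)" and t: "a < t" "t < b"
      have "\<forall>\<^sub>F s in at t. s \<in> {a<..<b}"
        using t by (intro eventually_at_in_open') auto
      then have "\<forall>\<^sub>F s in at t. dist (v s) (v t) / \<bar>t - s\<bar> = dist (u s) (u t) / \<bar>t - s\<bar>"
        by eventually_elim (use t v_eq in auto)
      then show "((\<lambda>s. dist (u s) (u t) / \<bar>t - s\<bar>) \<longlongrightarrow> w t) (at t)"
        by (rule Lim_transform_eventually[OF L])
    qed
  qed (use wb w0 wi in auto)
qed

lemma integrable_lebesgue_on_iff:
  fixes f :: "real \<Rightarrow> real"
  assumes "S \<in> sets lebesgue"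
  shows "integrable (lebesgue_on S) f \<longleftrightarrow> integrable lebesgue (\<lambda>x. indicator S x * f x)"
  using assms by (simp add: integrable_restrict_space)

lemma AC_integrable_bound:
  assumes u: "AC p I u" and p: "p = 1 \<or> p = 2" and J: "{a..b} \<subseteq> I" and I: "I \<in> sets lebesgue"
  obtains m where "integrable lebesgue m" "\<And>x. m x \<ge> 0"
    "\<And>s t. s \<in> {a..b} \<Longrightarrow> t \<in> {a..b} \<Longrightarrow> s \<le> t \<Longrightarrow> dist (u s) (u t) \<le> (LINT r:{s..t}|lebesgue. m r)"
    "p = 2 \<Longrightarrow> integrable lebesgue (\<lambda>x. (m x)\<^sup>2)"
proof -
  obtain m where m: "in_Lp p (lebesgue_on I) (\<lambda>t. ereal (m t))"
     "\<And>s t. s \<in> I \<Longrightarrow> t \<in> I \<Longrightarrow> s \<le> t \<Longrightarrow> dist (u s) (u t) \<le> (LINT r:{s..t}|lebesgue. m r)"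
    using u unfolding AC_def by blast
  define n where "n x = indicator {a..b} x * \<bar>m x\<bar>" for x
  have pf: "p \<noteq> \<infinity>" "p \<noteq> top" "(p = 1 \<and> enn2real p = 1) \<or> (p = 2 \<and> enn2real p = 2)"
    using p by (auto simp: infinity_ennreal_def)
  have mm: "(\<lambda>t. ereal (m t)) \<in> borel_measurable (lebesgue_on I)" and
    mi: "integrable (lebesgue_on I) (\<lambda>x. \<bar>m x\<bar> powr enn2real p)"
    using m(1) pf unfolding in_Lp_def by auto
  have mb: "m \<in> borel_measurable (lebesgue_on I)"
    using borel_measurable_real_of_ereal[OF mm] by simp
  have mbi: "(\<lambda>x. indicator {a..b} x * m x) \<in> borel_measurable lebesgue"
  proof -
    have "m \<in> borel_measurable (lebesgue_on {a..b})"
      using mb J by (rule measurable_restrict_mono)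
    then show ?thesis
      by (subst (asm) borel_measurable_restrict_space_iff) (auto simp: ac_simps)
  qed
  have nb: "n \<in> borel_measurable lebesgue"
    using borel_measurable_abs[OF mbi] by (simp add: n_def[abs_def] abs_mult)
  have ip: "integrable lebesgue (\<lambda>x. indicator {a..b} x * (\<bar>m x\<bar> powr enn2real p))"
  proof -
    have "integrable lebesgue (\<lambda>x. indicator I x * \<bar>m x\<bar> powr enn2real p)"
      using mi I by (simp add: integrable_lebesgue_on_iff)
    then have "integrable lebesgue (\<lambda>x. indicator {a..b} x *\<^sub>R (indicator I x * \<bar>m x\<bar> powr enn2real p))"
      by (rule integrable_mult_indicator[rotated]) simp
    moreover have "indicator {a..b} x *\<^sub>R (indicator I x * \<bar>m x\<bar> powr enn2real p)
      = indicator {a..b} x * \<bar>m x\<bar> powr enn2real p" for x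
      using J by (auto simp: indicator_def)
    ultimately show ?thesis by (simp only:)
  qed
  have n2: "integrable lebesgue (\<lambda>x. (n x)\<^sup>2)" if "p = 2"
  proof -
    have "indicator {a..b} x * \<bar>m x\<bar> powr enn2real p = (n x)\<^sup>2" for x
      using that by (auto simp: n_def indicator_def)
    then show ?thesis using ip by (simp only:)
  qed
  have ni: "integrable lebesgue n"
  proof (cases "p = 1")
    case True
    have "indicator {a..b} x * \<bar>m x\<bar> powr enn2real p = n x" for x
      using True by (auto simp: n_def indicator_def)
    then show ?thesis using ip by (simp only:)
  next
    case False
    then have "integrable lebesgue (\<lambda>x. (n x)\<^sup>2)" using p n2 by blast
    \<comment> \<open>On a bounded interval \<open>L\<^sup>2\<close> is contained in \<open>L\<^sup>1\<close>, by \<open>\<bar>m\<bar> \<le> m\<^sup>2 + 1\<close>.\<close>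
    moreover have "integrable lebesgue (\<lambda>x. indicator {a..b} x :: real)"
      by (intro integrable_real_indicator) (auto simp: emeasure_lborel_Icc_eq)
    ultimately have "integrable lebesgue (\<lambda>x. (n x)\<^sup>2 + indicator {a..b} x)"
      by (rule Bochner_Integration.integrable_add)
    then show ?thesis
    proof (rule Bochner_Integration.integrable_bound[OF _ nb])
      show "AE x in lebesgue. norm (n x) \<le> norm ((n x)\<^sup>2 + indicator {a..b} x)"
      proof (rule AE_I2)
        fix x
        have "\<bar>m x\<bar> \<le> (m x)\<^sup>2 + 1"
          using sum_squares_bound[of "\<bar>m x\<bar>" 1] by simp
        then show "norm (n x) \<le> norm ((n x)\<^sup>2 + indicator {a..b} x)"
          by (auto simp: n_def indicator_def)
      qed
    qed
  qed
  show thesis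
  proof (rule that[OF ni _ _ n2])
    show "n x \<ge> 0" for x by (simp add: n_def)
    show "dist (u s) (u t) \<le> (LINT r:{s..t}|lebesgue. n r)" if st: "s \<in> {a..b}" "t \<in> {a..b}" "s \<le> t" for s t
    proof -
      have "dist (u s) (u t) \<le> (LINT r:{s..t}|lebesgue. m r)"
        using st J by (intro m(2)) auto
      also have "\<dots> \<le> (LINT r:{s..t}|lebesgue. \<bar>m r\<bar>)"
        using abs_set_integral_le[of "{s..t}" m] by linarith
      also have "\<dots> = (LINT r:{s..t}|lebesgue. n r)"
        unfolding set_lebesgue_integral_def using st
        by (intro Bochner_Integration.integral_cong) (auto simp: n_def indicator_def)
      finally show ?thesis .
    qed
  qed
qed

text \<open>
  A Borel bound for the speed of \<open>u\<close>, not necessarily the metric derivative. Competitors obtained by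
  concatenation, reversal or change of time come with such bounds, which are easier to follow through these
  operations than the metric derivative. Since the metric derivative is the smallest one
  (\<open>metric_deriv_le_speed\<close>), any of them bounds the action from above.
\<close>

definition has_speed :: "real set \<Rightarrow> (real \<Rightarrow> 'a::metric_space) \<Rightarrow> (real \<Rightarrow> real) \<Rightarrow> bool" where
  "has_speed I u w \<longleftrightarrow> w \<in> borel_measurable borel \<and> (\<forall>x. w x \<ge> 0) \<and>
     (\<forall>s\<in>I. \<forall>t\<in>I. s \<le> t \<longrightarrow> set_integrable lebesgue {s..t} w \<and> dist (u s) (u t) \<le> (LINT r:{s..t}|lebesgue. w r))"

lemma metric_deriv_eqI:
  assumes "((\<lambda>s. dist (u s) (u t) / \<bar>t - s\<bar>) \<longlongrightarrow> w) (at t)" "t \<in> interior I"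
  shows "metric_deriv I u t = w"
  unfolding metric_deriv_def at_within_interior[OF assms(2)]
  by (rule tendsto_Lim[OF trivial_limit_at assms(1)])

lemma AC_IccI:
  fixes m :: "real \<Rightarrow> real"
  assumes p: "p = 1 \<or> p = 2" and m: "integrable lebesgue m" "p = 2 \<Longrightarrow> integrable lebesgue (\<lambda>x. (m x)\<^sup>2)"
    and u: "\<And>s t. s \<in> {a..b} \<Longrightarrow> t \<in> {a..b} \<Longrightarrow> s \<le> t \<Longrightarrow> dist (u s) (u t) \<le> (LINT r:{s..t}|lebesgue. m r)"
  shows "AC p {a..b} u"
  unfolding AC_def
proof (intro exI[of _ m] conjI ballI impI)
  have mb: "m \<in> borel_measurable (lebesgue_on {a..b})"
    using borel_measurable_integrable[OF m(1)] by (rule measurable_restrict_space1)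
  have pf: "p \<noteq> \<infinity>" "p \<noteq> top" "(p = 1 \<and> enn2real p = 1) \<or> (p = 2 \<and> enn2real p = 2)"
    using p by (auto simp: infinity_ennreal_def)
  have "integrable lebesgue (\<lambda>x. \<bar>m x\<bar> powr enn2real p)"
    using pf(3) m by auto
  then have "integrable (lebesgue_on {a..b}) (\<lambda>x. \<bar>m x\<bar> powr enn2real p)"
    using integrable_mult_indicator[of "{a..b}" lebesgue "\<lambda>x. \<bar>m x\<bar> powr enn2real p"]
    by (simp add: integrable_lebesgue_on_iff)
  then show "in_Lp p (lebesgue_on {a..b}) (\<lambda>t. ereal (m t))"
    using mb pf unfolding in_Lp_def by simp
qed (use u in auto)

lemma AC_Icc_of_AC:
  assumes "AC p I u" "p = 1 \<or> p = 2" "{a..b} \<subseteq> I" "I \<in> sets lebesgue"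
  shows "AC p {a..b} u"
  using AC_integrable_bound[OF assms] AC_IccI[OF assms(2)] by metis

lemma AC_speed_Icc:
  assumes u: "AC p {a..b} u" and p: "p = 1 \<or> p = 2" and ab: "a \<le> b"
  obtains w where "has_speed {a..b} u w" "integrable lebesgue w"
    "AE t in lebesgue. t \<in> {a<..<b} \<longrightarrow> (\<forall>I. {a..b} \<subseteq> I \<longrightarrow> metric_deriv I u t = w t)"
    "p = 2 \<Longrightarrow> integrable lebesgue (\<lambda>x. (w x)\<^sup>2)"
proof -
  obtain m where m: "integrable lebesgue m" "\<And>x. m x \<ge> 0"
    "\<And>s t. s \<in> {a..b} \<Longrightarrow> t \<in> {a..b} \<Longrightarrow> s \<le> t \<Longrightarrow> dist (u s) (u t) \<le> (LINT r:{s..t}|lebesgue. m r)"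
    "p = 2 \<Longrightarrow> integrable lebesgue (\<lambda>x. (m x)\<^sup>2)"
    using AC_integrable_bound[OF u p order.refl] by (auto simp del: atLeastAtMost_iff)
  obtain w where w: "w \<in> borel_measurable borel" "\<And>x. w x \<ge> 0" "integrable lebesgue w" "AE x in lebesgue. w x \<le> m x"
    "\<And>s t. s \<in> {a..b} \<Longrightarrow> t \<in> {a..b} \<Longrightarrow> s \<le> t \<Longrightarrow> dist (u s) (u t) \<le> (LINT r:{s..t}|lebesgue. w r)"
    "AE t in lebesgue. a < t \<and> t < b \<longrightarrow> ((\<lambda>s. dist (u s) (u t) / \<bar>t - s\<bar>) \<longlongrightarrow> w t) (at t)"
    using metric_derivative_Icc[OF ab m(1,2,3)] by blast
  show thesis
  proof (rule that[of w])
    show "has_speed {a..b} u w"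
      using w set_integrable_of_integrable[OF w(3)] unfolding has_speed_def by auto
    show "AE t in lebesgue. t \<in> {a<..<b} \<longrightarrow> (\<forall>I. {a..b} \<subseteq> I \<longrightarrow> metric_deriv I u t = w t)"
      using w(6)
    proof eventually_elim
      case (elim t)
      show ?case
      proof safe
        fix I assume t: "t \<in> {a<..<b}" and I: "{a..b} \<subseteq> I"
        have "{a<..<b} \<subseteq> interior I"
          using I by (intro interior_maximal) auto
        then show "metric_deriv I u t = w t"
          using elim t by (intro metric_deriv_eqI) auto
      qed
    qed
    show "integrable lebesgue (\<lambda>x. (w x)\<^sup>2)" if "p = 2"
    proof (rule Bochner_Integration.integrable_bound[OF m(4)[OF that]])
      show "AE x in lebesgue. norm ((w x)\<^sup>2) \<le> norm ((m x)\<^sup>2)"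
        using w(4) by eventually_elim (use w(2) in \<open>auto intro: power_mono\<close>)
    qed (use w(1) in \<open>auto intro!: measurable_completion\<close>)
  qed (use w in auto)
qed


text \<open>
  Reduces statements about almost every point of an interval to countably many compact subintervals.
\<close>

lemma interior_rational_interval:
  fixes I :: "real set"
  assumes "t \<in> interior I"
  obtains x y where "x \<in> \<rat>" "y \<in> \<rat>" "x < t" "t < y" "{x..y} \<subseteq> I"
proof -
  obtain e where e: "e > 0" "cball t e \<subseteq> I" using assms by (auto simp: mem_interior_cball)
  obtain x where x: "x \<in> \<rat>" "t - e < x" "x < t" using Rats_dense_in_real[of "t - e" t] e(1) by auto
  obtain y where y: "y \<in> \<rat>" "t < y" "y < t + e" using Rats_dense_in_real[of t "t + e"] e(1) by auto
  have "{x..y} \<subseteq> cball t e" using x y by (auto simp: dist_real_def)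
  then show thesis using that[OF x(1) y(1) x(3) y(2)] e(2) by blast
qed

lemma AE_interior_of_interval:
  fixes I :: "real set"
  assumes "is_interval I"
  shows "AE t in lebesgue. t \<in> I \<longrightarrow> t \<in> interior I"
proof (rule AE_I')
  show "frontier I \<in> null_sets lebesgue"
    using negligible_convex_frontier[of I] is_interval_convex[OF assms] by (simp add: negligible_iff_null_sets)
  show "{t \<in> space lebesgue. \<not> (t \<in> I \<longrightarrow> t \<in> interior I)} \<subseteq> frontier I"
    using closure_subset[of I] by (auto simp: frontier_def)
qed

lemma AE_interval_of_AE_Ioo:
  fixes I :: "real set"
  assumes I: "is_interval I"
    and P: "\<And>a b. {a..b} \<subseteq> I \<Longrightarrow> a \<le> b \<Longrightarrow> AE t in lebesgue. t \<in> {a<..<b} \<longrightarrow> P t"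
  shows "AE t in lebesgue. t \<in> I \<longrightarrow> P t"
proof -
  let ?J = "{(x, y). x \<in> (\<rat>::real set) \<and> y \<in> (\<rat>::real set) \<and> x \<le> y \<and> {x..y} \<subseteq> I}"
  have "AE t in lebesgue. \<forall>z \<in> ?J. t \<in> {fst z<..<snd z} \<longrightarrow> P t"
  proof (subst AE_ball_countable)
    show "countable ?J"
      by (rule countable_subset[of _ "\<rat> \<times> \<rat>"]) (auto intro: countable_rat)
  qed (use P in auto)
  then show ?thesis
    using AE_interior_of_interval[OF I]
  proof eventually_elim
    case (elim t)
    show ?case
    proof
      assume "t \<in> I"
      then have "t \<in> interior I" using elim by blast
      then obtain x y where "x \<in> \<rat>" "y \<in> \<rat>" "x < t" "t < y" "{x..y} \<subseteq> I"
        by (rule interior_rational_interval)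
      then show "P t" using bspec[OF elim(1), of "(x, y)"] by simp
    qed
  qed
qed

text \<open>
  On an interval \<open>I\<close> of any kind the metric derivative has a Borel version that serves as a speed
  bound. It is known to be measurable on compact subintervals, and countably many of those cover the
  interior of \<open>I\<close>.
\<close>

lemma AC_loc_speed:
  assumes I: "is_interval I" and u: "AC_loc p I u" and p: "p = 1 \<or> p = 2"
  obtains w where "has_speed I u w" "AE t in lebesgue. t \<in> I \<longrightarrow> metric_deriv I u t = w t"
    "p = 2 \<Longrightarrow> \<forall>a b. {a..b} \<subseteq> I \<longrightarrow> set_integrable lebesgue {a..b} (\<lambda>x. (w x)\<^sup>2)"
proof -
  have ex: "\<exists>w. has_speed {a..b} u w \<and> integrable lebesgue w \<and>
     (AE t in lebesgue. t \<in> {a<..<b} \<longrightarrow> metric_deriv I u t = w t) \<and>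
     (p = 2 \<longrightarrow> integrable lebesgue (\<lambda>x. (w x)\<^sup>2))" if ab: "{a..b} \<subseteq> I" "a \<le> b" for a b
  proof -
    have "AC p {a..b} u" using u ab unfolding AC_loc_def by blast
    then obtain w where w: "has_speed {a..b} u w" "integrable lebesgue w"
      "AE t in lebesgue. t \<in> {a<..<b} \<longrightarrow> (\<forall>I. {a..b} \<subseteq> I \<longrightarrow> metric_deriv I u t = w t)"
      "p = 2 \<Longrightarrow> integrable lebesgue (\<lambda>x. (w x)\<^sup>2)"
      by (rule AC_speed_Icc[OF _ p ab(2)]) (rule that)
    have "AE t in lebesgue. t \<in> {a<..<b} \<longrightarrow> metric_deriv I u t = w t"
      using w(3) by eventually_elim (use ab in blast)
    then show ?thesis using w by blast
  qed
  \<comment> \<open>Away from the interior of \<open>I\<close> there are at most two points of \<open>I\<close>, a null set.\<close>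
  define W0 where "W0 t = (if t \<in> interior I then metric_deriv I u t else 0)" for t
  define C where "C = (\<lambda>(x, y). {x<..<y}) ` {(x, y). x \<in> \<rat> \<and> y \<in> \<rat> \<and> x \<le> y \<and> {x..y} \<subseteq> I} \<union> {- interior I}"
  have "W0 \<in> borel_measurable lebesgue"
  proof (rule measurable_piecewise_restrict[of C])
    have "countable {(x, y). x \<in> (\<rat>::real set) \<and> y \<in> (\<rat>::real set) \<and> x \<le> y \<and> {x..y} \<subseteq> I}"
      by (rule countable_subset[of _ "\<rat> \<times> \<rat>"]) (auto intro: countable_rat)
    then show "countable C" unfolding C_def by (intro countable_Un countable_image) simp_all
    show "space lebesgue \<subseteq> \<Union> C"
    proof
      fix t :: real
      show "t \<in> \<Union> C"
      proof (cases "t \<in> interior I")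
        case True
        then obtain x y where "x \<in> \<rat>" "y \<in> \<rat>" "x < t" "t < y" "{x..y} \<subseteq> I"
          by (rule interior_rational_interval)
        then show ?thesis unfolding C_def by (intro UnionI[of "{x<..<y}"]) (auto intro!: image_eqI[of _ _ "(x, y)"])
      qed (auto simp: C_def)
    qed
    fix S assume S: "S \<in> C"
    then show "S \<inter> space lebesgue \<in> sets lebesgue" by (auto simp: C_def)
    show "W0 \<in> borel_measurable (restrict_space lebesgue S)"
    proof (cases "S = - interior I")
      case True
      have "(\<lambda>_. 0 :: real) \<in> borel_measurable (lebesgue_on S)" by simp
      then show ?thesis
        by (rule measurable_cong[THEN iffD1, rotated]) (auto simp: W0_def True space_restrict_space)
    next
      case False
      then obtain x y where xy: "S = {x<..<y}" "x \<le> y" "{x..y} \<subseteq> I" using S unfolding C_def by auto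
      obtain w where w: "has_speed {x..y} u w" "AE t in lebesgue. t \<in> {x<..<y} \<longrightarrow> metric_deriv I u t = w t"
        using ex[OF xy(3,2)] by blast
      have int: "{x<..<y} \<subseteq> interior I" using xy(3) by (intro interior_maximal) auto
      have wm: "w \<in> borel_measurable lebesgue"
        using w(1) by (auto simp: has_speed_def intro: measurable_completion)
      have "(\<lambda>t. if t \<in> S then W0 t else 0) \<in> borel_measurable lebesgue"
      proof (rule borel_measurable_AE)
        show "(\<lambda>t. indicator S t * w t) \<in> borel_measurable lebesgue"
          using wm xy(1) by (intro borel_measurable_times borel_measurable_indicator) auto
        show "AE t in lebesgue. indicator S t * w t = (if t \<in> S then W0 t else 0)"
          using w(2)
        proof eventually_elim
          case (elim t)
          then show ?case using int xy(1) by (auto simp: W0_def)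
        qed
      qed
      then have "(\<lambda>t. if t \<in> S then W0 t else 0) \<in> borel_measurable (lebesgue_on S)"
        by (rule measurable_restrict_space1)
      then show ?thesis
        by (rule measurable_cong[THEN iffD1, rotated]) (auto simp: space_restrict_space)
    qed
  qed
  then obtain W1 where W1: "W1 \<in> borel_measurable lborel" "AE x in lborel. W0 x = W1 x"
    using completion_ex_borel_measurable_real by blast
  define W where "W x = \<bar>W1 x\<bar>" for x
  have Wb: "W \<in> borel_measurable borel" using W1(1) by (simp add: W_def[abs_def])
  have W1': "AE x in lebesgue. W0 x = W1 x" by (rule AE_completion[OF W1(2)])
  have Wae: "AE t in lebesgue. t \<in> {a<..<b} \<longrightarrow> W t = w t"
    if "{a..b} \<subseteq> I" "has_speed {a..b} u w" "AE t in lebesgue. t \<in> {a<..<b} \<longrightarrow> metric_deriv I u t = w t" for a b w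
    using W1' that(3)
  proof eventually_elim
    case (elim t)
    have "{a<..<b} \<subseteq> interior I" using that(1) by (intro interior_maximal) auto
    moreover have "w t \<ge> 0" using that(2) by (simp add: has_speed_def)
    ultimately show ?case using elim by (auto simp: W0_def W_def)
  qed
  have key: "set_integrable lebesgue {a..b} W \<and> dist (u a) (u b) \<le> (LINT r:{a..b}|lebesgue. W r) \<and>
      (p = 2 \<longrightarrow> set_integrable lebesgue {a..b} (\<lambda>x. (W x)\<^sup>2))" if ab: "{a..b} \<subseteq> I" "a \<le> b" for a b
  proof -
    obtain w where w: "has_speed {a..b} u w" "integrable lebesgue w"
      "AE t in lebesgue. t \<in> {a<..<b} \<longrightarrow> metric_deriv I u t = w t" "p = 2 \<Longrightarrow> integrable lebesgue (\<lambda>x. (w x)\<^sup>2)"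
      using ex[OF ab] by blast
    have ae: "AE t in lebesgue. t \<in> {a..b} \<longrightarrow> W t = w t"
      using Wae[OF ab(1) w(1,3)] AE_completion[OF AE_lborel_singleton[of a]] AE_completion[OF AE_lborel_singleton[of b]]
      by eventually_elim auto
    have m: "W \<in> borel_measurable lebesgue" "w \<in> borel_measurable lebesgue"
      using Wb w(1) unfolding has_speed_def by (auto intro!: measurable_completion)
    have "set_integrable lebesgue {a..b} W"
      using set_integrable_of_integrable[OF w(2), of "{a..b}"] set_integrable_cong_AE[OF m ae] by simp
    moreover have "(LINT r:{a..b}|lebesgue. W r) = (LINT r:{a..b}|lebesgue. w r)"
      by (rule set_lebesgue_integral_cong_AE[OF _ m ae]) simp
    moreover have "set_integrable lebesgue {a..b} (\<lambda>x. (W x)\<^sup>2)" if "p = 2"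
    proof -
      have "AE x \<in> {a..b} in lebesgue. (W x)\<^sup>2 = (w x)\<^sup>2"
        using ae by eventually_elim simp
      then show ?thesis
        using set_integrable_of_integrable[OF w(4)[OF that], of "{a..b}"]
          set_integrable_cong_AE[of "\<lambda>x. (W x)\<^sup>2" lebesgue "\<lambda>x. (w x)\<^sup>2" "{a..b}"] m by simp
    qed
    ultimately show ?thesis using w(1) ab(2) by (auto simp: has_speed_def)
  qed
  show thesis
  proof (rule that[of W])
    show "has_speed I u W"
      unfolding has_speed_def
    proof (intro conjI ballI allI impI)
      fix s t assume st: "s \<in> I" "t \<in> I" "s \<le> t"
      have "{s..t} \<subseteq> I"
        using mem_is_interval_1_I[OF I st(1,2)] by auto
      from key[OF this st(3)]
      show "set_integrable lebesgue {s..t} W" "dist (u s) (u t) \<le> (LINT r:{s..t}|lebesgue. W r)" by auto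
    qed (use Wb in \<open>auto simp: W_def\<close>)
    show "AE t in lebesgue. t \<in> I \<longrightarrow> metric_deriv I u t = W t"
    proof -
      have "AE t in lebesgue. t \<in> I \<longrightarrow> 0 \<le> metric_deriv I u t"
      proof (rule AE_interval_of_AE_Ioo[OF I])
        fix x y assume "{x..y} \<subseteq> I" "x \<le> y"
        then obtain w where "has_speed {x..y} u w" "AE t in lebesgue. t \<in> {x<..<y} \<longrightarrow> metric_deriv I u t = w t"
          using ex by blast
        then show "AE t in lebesgue. t \<in> {x<..<y} \<longrightarrow> 0 \<le> metric_deriv I u t"
          by (auto simp: has_speed_def elim!: AE_mp)
      qed
      then show ?thesis
        using W1' AE_interior_of_interval[OF I]
        by eventually_elim (auto simp: W0_def W_def)
    qed
    show "\<forall>a b. {a..b} \<subseteq> I \<longrightarrow> set_integrable lebesgue {a..b} (\<lambda>x. (W x)\<^sup>2)" if "p = 2"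
    proof (intro allI impI)
      fix a b assume "{a..b} \<subseteq> I"
      then show "set_integrable lebesgue {a..b} (\<lambda>x. (W x)\<^sup>2)"
        using key[of a b] that by (cases "a \<le> b") (auto simp: set_integrable_def)
    qed
  qed
qed

text \<open>
  On a compact subinterval, the smallest speed constructed in \<open>metric_derivative_Icc\<close> lies below \<open>m\<close>
  and is the limit of the difference quotients of \<open>u\<close>, which is the metric derivative with respect to
  every interval \<open>I\<close> that contains a neighbourhood.
\<close>

lemma metric_deriv_le_speed:
  assumes I: "is_interval I" and m: "has_speed I u m"
  shows "AE t in lebesgue. t \<in> I \<longrightarrow> 0 \<le> metric_deriv I u t \<and> metric_deriv I u t \<le> m t"
proof (rule AE_interval_of_AE_Ioo[OF I])
  fix a b assume ab: "{a..b} \<subseteq> I" "a \<le> b"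
  define n where "n x = indicator {a..b} x * m x" for x
  have abI: "a \<in> I" "b \<in> I" using ab by auto
  have "set_integrable lebesgue {a..b} m" using m abI ab(2) by (simp add: has_speed_def)
  then have ni: "integrable lebesgue n" unfolding n_def set_integrable_def by simp
  have n0: "n x \<ge> 0" for x using m by (simp add: n_def has_speed_def)
  have nu: "dist (u s) (u t) \<le> (LINT r:{s..t}|lebesgue. n r)" if "s \<in> {a..b}" "t \<in> {a..b}" "s \<le> t" for s t
  proof -
    have "dist (u s) (u t) \<le> (LINT r:{s..t}|lebesgue. m r)"
    proof -
      have "s \<in> I" "t \<in> I" using that ab by auto
      then show ?thesis using m that(3) unfolding has_speed_def by blast
    qed
    also have "\<dots> = (LINT r:{s..t}|lebesgue. n r)"
      unfolding set_lebesgue_integral_def using that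
      by (intro Bochner_Integration.integral_cong) (auto simp: n_def indicator_def)
    finally show ?thesis .
  qed
  obtain w where w: "\<And>x. w x \<ge> 0" "AE x in lebesgue. w x \<le> n x"
    "AE t in lebesgue. a < t \<and> t < b \<longrightarrow> ((\<lambda>s. dist (u s) (u t) / \<bar>t - s\<bar>) \<longlongrightarrow> w t) (at t)"
    by (rule metric_derivative_Icc[OF ab(2) ni n0 nu]) (assumption | rule that)+
  have int: "{a<..<b} \<subseteq> interior I" using ab by (intro interior_maximal) auto
  show "AE t in lebesgue. t \<in> {a<..<b} \<longrightarrow> 0 \<le> metric_deriv I u t \<and> metric_deriv I u t \<le> m t"
    using w(2,3)
  proof eventually_elim
    case (elim t)
    show ?case
    proof
      assume t: "t \<in> {a<..<b}"
      then have "metric_deriv I u t = w t" using elim int by (intro metric_deriv_eqI) auto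
      then show "0 \<le> metric_deriv I u t \<and> metric_deriv I u t \<le> m t"
        using w(1)[of t] elim(1) t by (simp add: n_def)
    qed
  qed
qed

lemma has_speed_subset: "has_speed I u w \<Longrightarrow> J \<subseteq> I \<Longrightarrow> has_speed J u w"
  unfolding has_speed_def by blast

lemma has_speed_continuous_Icc:
  assumes "has_speed {a..b} u w"
  shows "continuous_on {a..b} u"
proof (cases "a \<le> b")
  case True
  define n where "n x = indicator {a..b} x * w x" for x
  have "set_integrable lebesgue {a..b} w" using assms True by (auto simp: has_speed_def)
  then have ni: "integrable lebesgue n" unfolding n_def set_integrable_def by simp
  let ?P = "\<lambda>x. LINT r:{..x}|lebesgue. n r"
  have le: "dist (u s) (u t) \<le> ?P t - ?P s" if "s \<in> {a..b}" "t \<in> {a..b}" "s \<le> t" for s t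
  proof -
    have "dist (u s) (u t) \<le> (LINT r:{s..t}|lebesgue. w r)"
      using assms that unfolding has_speed_def by blast
    also have "\<dots> = (LINT r:{s..t}|lebesgue. n r)"
      unfolding set_lebesgue_integral_def using that
      by (intro Bochner_Integration.integral_cong) (auto simp: n_def indicator_def)
    finally show ?thesis using set_integral_Iic_diff[OF ni that(3)] by simp
  qed
  have le': "dist (u s) (u t) \<le> dist (?P s) (?P t)" if "s \<in> {a..b}" "t \<in> {a..b}" for s t
    using le[of s t] le[of t s] that
    by (cases "s \<le> t") (auto simp: dist_real_def dist_commute)
  have cP: "continuous_on {a..b} ?P"
    using continuous_on_set_integral_Iic[OF ni] by (rule continuous_on_subset) simp
  show ?thesis
    unfolding continuous_on_iff
  proof (intro ballI allI impI)
    fix x :: real and e :: real assume x: "x \<in> {a..b}" and "0 < e"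
    then obtain d where d: "d > 0" "\<forall>x'\<in>{a..b}. dist x' x < d \<longrightarrow> dist (?P x') (?P x) < e"
      using cP unfolding continuous_on_iff by blast
    have "dist (u x') (u x) < e" if "x' \<in> {a..b}" "dist x' x < d" for x'
      using le'[OF that(1) x] d(2) that by (meson le_less_trans)
    then show "\<exists>d>0. \<forall>x'\<in>{a..b}. dist x' x < d \<longrightarrow> dist (u x') (u x) < e"
      using d(1) by blast
  qed
qed simp

lemma has_speed_continuous:
  assumes u: "has_speed I u w" and I: "is_interval I" "closed I"
  shows "continuous_on I u"
  unfolding continuous_on_eq_continuous_within
proof
  fix t assume t: "t \<in> I"
  let ?K = "I \<inter> {t - 1..t + 1}"
  have "is_interval ?K \<and> compact ?K"
    using I by (auto intro!: is_interval_Int closed_Int_compact is_interval_cc)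
  then obtain a b where K: "?K = {a..b}"
    unfolding is_interval_compact by auto
  have "continuous_on ?K u"
    unfolding K by (rule has_speed_continuous_Icc[OF has_speed_subset[OF u]]) (use K in blast)
  then have "continuous (at t within ?K) u"
    using t by (auto simp: continuous_on_eq_continuous_within)
  moreover have "at t within ?K = at t within I"
    by (rule at_within_nhd[of t "{t-1<..<t+1}"]) auto
  ultimately show "continuous (at t within I) u" by simp
qed

section \<open>The exponentially weighted half-line\<close>

definition wed_density :: "real \<Rightarrow> real \<Rightarrow> real" where
  "wed_density \<epsilon> t = 1 / \<epsilon> * exp (- t / \<epsilon>)"

lemma wed_density_nonneg: "\<epsilon> > 0 \<Longrightarrow> wed_density \<epsilon> t \<ge> 0"
  by (simp add: wed_density_def)

lemma wed_density_measurable [measurable]: "wed_density \<epsilon> \<in> borel_measurable borel"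
  unfolding wed_density_def[abs_def] by measurable

lemma borel_imp_lebesgue_on:
  "f \<in> borel_measurable borel \<Longrightarrow> f \<in> borel_measurable (lebesgue_on S)"
  by (intro measurable_restrict_space1 measurable_completion) simp

lemma wed_measure_eq: "wed_measure \<epsilon> = density (lebesgue_on {0<..}) (\<lambda>t. ennreal (wed_density \<epsilon> t))"
  by (simp add: wed_measure_def wed_density_def)

lemma borel_imp_wed: "f \<in> borel_measurable borel \<Longrightarrow> f \<in> borel_measurable (wed_measure \<epsilon>)"
  using borel_imp_lebesgue_on[of f "{0<..}"] unfolding wed_measure_eq
  by (subst measurable_cong_sets[OF sets_density refl])

lemma AE_wed_iff:
  assumes "\<epsilon> > 0"
  shows "(AE t in wed_measure \<epsilon>. P t) \<longleftrightarrow> (AE t in lebesgue. t > 0 \<longrightarrow> P t)"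
proof -
  have "ennreal (wed_density \<epsilon> t) > 0" for t using assms by (simp add: wed_density_def)
  then show ?thesis
    unfolding wed_measure_eq
    using borel_imp_lebesgue_on[OF wed_density_measurable]
    by (subst AE_density) (auto simp: AE_restrict_space_iff)
qed

lemma nn_integral_wed:
  fixes f :: "real \<Rightarrow> ennreal"
  assumes f: "f \<in> borel_measurable borel"
  shows "(\<integral>\<^sup>+t. f t \<partial>wed_measure \<epsilon>) = (\<integral>\<^sup>+t\<in>{0<..}. (ennreal (wed_density \<epsilon> t) * f t) \<partial>lborel)"
proof -
  have "(\<integral>\<^sup>+t. f t \<partial>wed_measure \<epsilon>) = (\<integral>\<^sup>+t. ennreal (wed_density \<epsilon> t) * f t \<partial>lebesgue_on {0<..})"
    unfolding wed_measure_eq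
    by (intro nn_integral_density borel_imp_lebesgue_on f) measurable
  also have "\<dots> = (\<integral>\<^sup>+t\<in>{0<..}. (ennreal (wed_density \<epsilon> t) * f t) \<partial>lebesgue)"
    by (simp add: nn_integral_restrict_space)
  also have "\<dots> = (\<integral>\<^sup>+t\<in>{0<..}. (ennreal (wed_density \<epsilon> t) * f t) \<partial>lborel)"
    using f by (intro nn_integral_completion) measurable
  finally show ?thesis .
qed

lemma has_bochner_integral_wed:
  fixes f :: "real \<Rightarrow> real"
  assumes f: "f \<in> borel_measurable borel" and \<epsilon>: "\<epsilon> > 0"
  shows "has_bochner_integral (wed_measure \<epsilon>) f x \<longleftrightarrow>
    has_bochner_integral lebesgue (\<lambda>t. indicator {0<..} t * (wed_density \<epsilon> t * f t)) x"
proof -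
  have nn: "AE t in lebesgue_on {0<..}. 0 \<le> wed_density \<epsilon> t" using \<epsilon> by (auto simp: wed_density_def)
  note m = borel_imp_lebesgue_on[OF f] borel_imp_lebesgue_on[OF wed_density_measurable]
  have "has_bochner_integral (wed_measure \<epsilon>) f x \<longleftrightarrow>
     has_bochner_integral (lebesgue_on {0<..}) (\<lambda>t. wed_density \<epsilon> t * f t) x"
    unfolding wed_measure_eq has_bochner_integral_iff
    using integrable_density[OF m nn] integral_density[OF m nn] by simp
  then show ?thesis
    by (simp add: has_bochner_integral_restrict_space)
qed

lemma exp_weight_tail:
  assumes c: "c > 0"
  shows "(\<integral>\<^sup>+t\<in>{r..}. ennreal (exp (- t / c)) \<partial>lborel) = ennreal (c * exp (- r / c))"
proof -
  have "((\<lambda>t. - c * exp (- t / c)) \<longlongrightarrow> 0) at_top"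
  proof -
    have "filterlim (\<lambda>t. t / c) at_top at_top"
      using filterlim_tendsto_pos_mult_at_top[OF tendsto_const _ filterlim_ident, of "1/c"] c by simp
    then have "((\<lambda>t. exp (- (t / c))) \<longlongrightarrow> 0) at_top"
      by (intro filterlim_compose[OF exp_at_bot]) (simp add: filterlim_uminus_at_bot)
    from tendsto_mult[OF tendsto_const[of "- c"] this] show ?thesis by simp
  qed
  moreover have "((\<lambda>t. - c * exp (- t / c)) has_real_derivative exp (- x / c)) (at x)" for x
    using c by (auto intro!: derivative_eq_intros)
  ultimately have "(\<integral>\<^sup>+t. ennreal (exp (- t / c)) * indicator {r..} t \<partial>lborel) = ennreal (0 - (- c * exp (- r / c)))"
    by (intro nn_integral_FTC_atLeast) auto
  then show ?thesis by simp
qed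

lemma wed_measure_total:
  fixes c :: real
  assumes "\<epsilon> > 0"
  shows "has_bochner_integral (wed_measure \<epsilon>) (\<lambda>_. c) c"
proof -
  have "emeasure (wed_measure \<epsilon>) (space (wed_measure \<epsilon>)) = (\<integral>\<^sup>+t. 1 \<partial>wed_measure \<epsilon>)" by simp
  also have "\<dots> = (\<integral>\<^sup>+t\<in>{0<..}. ennreal (wed_density \<epsilon> t) \<partial>lborel)"
    by (subst nn_integral_wed) auto
  also have "\<dots> = (\<integral>\<^sup>+t. ennreal (1/\<epsilon>) * (ennreal (exp (- t / \<epsilon>)) * indicator {0..} t) \<partial>lborel)"
  proof (rule nn_integral_cong_AE)
    show "AE t in lborel. ennreal (wed_density \<epsilon> t) * indicator {0<..} t = ennreal (1/\<epsilon>) * (ennreal (exp (- t / \<epsilon>)) * indicator {0..} t)"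
      using AE_lborel_singleton[of 0]
      by eventually_elim (use assms in \<open>auto simp: indicator_def wed_density_def simp flip: ennreal_mult\<close>)
  qed
  also have "\<dots> = ennreal (1/\<epsilon>) * ennreal \<epsilon>"
    using exp_weight_tail[OF assms, of 0] by (subst nn_integral_cmult) auto
  also have "\<dots> = 1" using assms by (simp flip: ennreal_mult)
  finally have 1: "emeasure (wed_measure \<epsilon>) (space (wed_measure \<epsilon>)) = 1" .
  interpret finite_measure "wed_measure \<epsilon>" by standard (simp add: 1)
  have "measure (wed_measure \<epsilon>) (space (wed_measure \<epsilon>)) = 1"
    using 1 by (simp add: measure_def)
  then have "(LINT t|wed_measure \<epsilon>. c) = c"
    by (subst lebesgue_integral_const) simp
  then show ?thesis by (simp add: has_bochner_integral_iff)
qed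

text \<open>
  By the Cauchy-Schwarz inequality with the weight \<open>exp (r / (2 \<epsilon>))\<close>,
  \[ D(t)^2 \le \int_0^t e^{r/(2\epsilon)} dr \int_0^t e^{-r/(2\epsilon)} w(r)^2 dr
  \le 2 \epsilon e^{t/(2\epsilon)} \int_0^t e^{-r/(2\epsilon)} w(r)^2 dr. \]
  Multiply by the density, integrate in \<open>t\<close> and exchange the integrals. The exponent \<open>1 / (2 \<epsilon>)\<close> minimises the
  resulting constant among the weights \<open>exp (a r)\<close>, which give \<open>\<epsilon> / (a (1 - a \<epsilon>))\<close>.
\<close>

lemma weighted_hardy:
  fixes w D :: "real \<Rightarrow> real"
  assumes \<epsilon>: "\<epsilon> > 0" and w: "w \<in> borel_measurable borel" "\<And>x. w x \<ge> 0"
    and D: "\<And>t. t > 0 \<Longrightarrow> D t \<ge> 0" "\<And>t. t > 0 \<Longrightarrow> ennreal (D t) \<le> (\<integral>\<^sup>+r\<in>{0..t}. ennreal (w r) \<partial>lborel)"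
  shows "(\<integral>\<^sup>+t\<in>{0<..}. ennreal (wed_density \<epsilon> t * (D t)\<^sup>2) \<partial>lborel)
    \<le> ennreal (4 * \<epsilon>\<^sup>2) * (\<integral>\<^sup>+t\<in>{0<..}. ennreal (wed_density \<epsilon> t * (w t)\<^sup>2) \<partial>lborel)"
proof -
  note [measurable] = w(1)
  have CS: "ennreal ((D t)\<^sup>2) \<le> ennreal (2 * \<epsilon> * exp (t / (2*\<epsilon>))) * (\<integral>\<^sup>+r\<in>{0..t}. ennreal (exp (- r / (2*\<epsilon>)) * (w r)\<^sup>2) \<partial>lborel)"
    if t: "t > 0" for t
  proof -
    have e1: "(\<integral>\<^sup>+r\<in>{0..t}. ennreal (exp (r / (2*\<epsilon>))) \<partial>lborel) \<le> ennreal (2 * \<epsilon> * exp (t / (2*\<epsilon>)))"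
    proof -
      have "(\<integral>\<^sup>+r\<in>{0..t}. ennreal (exp (r / (2*\<epsilon>))) \<partial>lborel) = ennreal (2 * \<epsilon> * exp (t / (2*\<epsilon>)) - 2 * \<epsilon> * exp (0 / (2*\<epsilon>)))"
        using \<epsilon> t by (intro nn_integral_FTC_Icc) (auto intro!: derivative_eq_intros has_real_derivative_iff_has_vector_derivative[THEN iffD1])
      also have "\<dots> \<le> ennreal (2 * \<epsilon> * exp (t / (2*\<epsilon>)))" using \<epsilon> by (intro ennreal_leI) auto
      finally show ?thesis .
    qed
    have "ennreal ((D t)\<^sup>2) = (ennreal (D t))\<^sup>2" using D(1)[OF t] by (simp add: ennreal_power)
    also have "\<dots> \<le> (\<integral>\<^sup>+r\<in>{0..t}. ennreal (w r) \<partial>lborel)\<^sup>2"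
      using D(2)[OF t] by (intro power_mono) auto
    also have "(\<integral>\<^sup>+r\<in>{0..t}. ennreal (w r) \<partial>lborel)
        = (\<integral>\<^sup>+r. (ennreal (exp (r / (4*\<epsilon>))) * indicator {0..t} r) * (ennreal (exp (- r / (4*\<epsilon>)) * w r) * indicator {0..t} r) \<partial>lborel)"
      using w(2) by (intro nn_integral_cong) (auto simp: indicator_def mult.assoc[symmetric] exp_minus_inverse simp flip: ennreal_mult exp_add)
    also have "\<dots>\<^sup>2 \<le> (\<integral>\<^sup>+r. (ennreal (exp (r / (4*\<epsilon>))) * indicator {0..t} r)\<^sup>2 \<partial>lborel)
        * (\<integral>\<^sup>+r. (ennreal (exp (- r / (4*\<epsilon>)) * w r) * indicator {0..t} r)\<^sup>2 \<partial>lborel)"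
      by (rule Cauchy_Schwarz_nn_integral) measurable
    also have "(\<integral>\<^sup>+r. (ennreal (exp (r / (4*\<epsilon>))) * indicator {0..t} r)\<^sup>2 \<partial>lborel)
        = (\<integral>\<^sup>+r\<in>{0..t}. ennreal (exp (r / (2*\<epsilon>))) \<partial>lborel)"
      by (intro nn_integral_cong)
         (auto simp: indicator_def power2_eq_square exp_add[symmetric] simp flip: ennreal_mult)
    also have "(\<integral>\<^sup>+r. (ennreal (exp (- r / (4*\<epsilon>)) * w r) * indicator {0..t} r)\<^sup>2 \<partial>lborel)
        = (\<integral>\<^sup>+r\<in>{0..t}. ennreal (exp (- r / (2*\<epsilon>)) * (w r)\<^sup>2) \<partial>lborel)"
    proof (intro nn_integral_cong)
      fix r
      have "(exp (- r / (4*\<epsilon>)) * w r)\<^sup>2 = exp (- r / (2*\<epsilon>)) * (w r)\<^sup>2"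
        by (simp add: power_mult_distrib power2_eq_square[of "exp _"] exp_add[symmetric])
      then show "(ennreal (exp (- r / (4*\<epsilon>)) * w r) * indicator {0..t} r)\<^sup>2 = ennreal (exp (- r / (2*\<epsilon>)) * (w r)\<^sup>2) * indicator {0..t} r"
        using w(2)[of r] by (auto simp: indicator_def ennreal_power)
    qed
    finally show ?thesis
      using mult_right_mono[OF e1] by (meson order_trans zero_le)
  qed
  have "(\<integral>\<^sup>+t\<in>{0<..}. ennreal (wed_density \<epsilon> t * (D t)\<^sup>2) \<partial>lborel)
     \<le> (\<integral>\<^sup>+t. (\<integral>\<^sup>+r. ennreal (2 * exp (- t / (2*\<epsilon>))) * (ennreal (exp (- r / (2*\<epsilon>)) * (w r)\<^sup>2) * (indicator {0<..} r * indicator {r..} t)) \<partial>lborel) \<partial>lborel)"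
  proof (rule nn_integral_mono)
    fix t :: real
    show "ennreal (wed_density \<epsilon> t * (D t)\<^sup>2) * indicator {0<..} t
      \<le> (\<integral>\<^sup>+r. ennreal (2 * exp (- t / (2*\<epsilon>))) * (ennreal (exp (- r / (2*\<epsilon>)) * (w r)\<^sup>2) * (indicator {0<..} r * indicator {r..} t)) \<partial>lborel)"
    proof (cases "t > 0")
      case True
      have "ennreal (wed_density \<epsilon> t * (D t)\<^sup>2) = ennreal (wed_density \<epsilon> t) * ennreal ((D t)\<^sup>2)"
        by (rule ennreal_mult) (use wed_density_nonneg[OF \<epsilon>] in auto)
      also have "\<dots> \<le> ennreal (wed_density \<epsilon> t) * (ennreal (2 * \<epsilon> * exp (t / (2*\<epsilon>))) * (\<integral>\<^sup>+r\<in>{0..t}. ennreal (exp (- r / (2*\<epsilon>)) * (w r)\<^sup>2) \<partial>lborel))"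
        by (intro mult_left_mono CS True) auto
      also have "\<dots> = ennreal (2 * exp (- t / (2*\<epsilon>))) * (\<integral>\<^sup>+r\<in>{0..t}. ennreal (exp (- r / (2*\<epsilon>)) * (w r)\<^sup>2) \<partial>lborel)"
      proof -
        have "wed_density \<epsilon> t * (2 * \<epsilon> * exp (t / (2*\<epsilon>))) = 2 * (exp (- t / \<epsilon>) * exp (t / (2*\<epsilon>)))"
          using \<epsilon> by (simp add: wed_density_def)
        also have "\<dots> = 2 * exp (- t / (2*\<epsilon>))"
          unfolding exp_add[symmetric] using \<epsilon> by (simp add: field_simps)
        finally have W: "wed_density \<epsilon> t * (2 * \<epsilon> * exp (t / (2*\<epsilon>))) = 2 * exp (- t / (2*\<epsilon>))" .
        have "ennreal (wed_density \<epsilon> t) * ennreal (2 * \<epsilon> * exp (t / (2*\<epsilon>))) = ennreal (2 * exp (- t / (2*\<epsilon>)))"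
          unfolding W[symmetric] by (rule ennreal_mult[symmetric]) (use \<epsilon> wed_density_nonneg in auto)
        then show ?thesis by (simp only: mult.assoc[symmetric])
      qed
      also have "\<dots> = (\<integral>\<^sup>+r. ennreal (2 * exp (- t / (2*\<epsilon>))) * (ennreal (exp (- r / (2*\<epsilon>)) * (w r)\<^sup>2) * indicator {0..t} r) \<partial>lborel)"
        by (subst nn_integral_cmult) measurable
      also have "\<dots> = (\<integral>\<^sup>+r. ennreal (2 * exp (- t / (2*\<epsilon>))) * (ennreal (exp (- r / (2*\<epsilon>)) * (w r)\<^sup>2) * (indicator {0<..} r * indicator {r..} t)) \<partial>lborel)"
      proof (rule nn_integral_cong_AE)
        show "AE r in lborel. ennreal (2 * exp (- t / (2*\<epsilon>))) * (ennreal (exp (- r / (2*\<epsilon>)) * (w r)\<^sup>2) * indicator {0..t} r)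
          = ennreal (2 * exp (- t / (2*\<epsilon>))) * (ennreal (exp (- r / (2*\<epsilon>)) * (w r)\<^sup>2) * (indicator {0<..} r * indicator {r..} t))"
          using AE_lborel_singleton[of 0] by eventually_elim (auto simp: indicator_def)
      qed
      finally show ?thesis using True by simp
    qed simp
  qed
  also have "\<dots> = (\<integral>\<^sup>+r. (\<integral>\<^sup>+t. ennreal (2 * exp (- t / (2*\<epsilon>))) * (ennreal (exp (- r / (2*\<epsilon>)) * (w r)\<^sup>2) * (indicator {0<..} r * indicator {r..} t)) \<partial>lborel) \<partial>lborel)"
  proof (rule lborel_pair.Fubini')
    have "(\<lambda>(r, t). ennreal (2 * exp (- t / (2*\<epsilon>))) * (ennreal (exp (- r / (2*\<epsilon>)) * (w r)\<^sup>2) * (indicator {0<..} r * (if r \<le> t then 1 else 0))))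
        \<in> borel_measurable (lborel \<Otimes>\<^sub>M lborel)"
      by measurable
    then show "(\<lambda>(r, t). ennreal (2 * exp (- t / (2*\<epsilon>))) * (ennreal (exp (- r / (2*\<epsilon>)) * (w r)\<^sup>2) * (indicator {0<..} r * indicator {r..} t)))
        \<in> borel_measurable (lborel \<Otimes>\<^sub>M lborel)"
      by (simp add: indicator_def of_bool_def)
  qed
  also have "\<dots> = (\<integral>\<^sup>+r. ennreal (4 * \<epsilon>\<^sup>2) * (ennreal (wed_density \<epsilon> r * (w r)\<^sup>2) * indicator {0<..} r) \<partial>lborel)"
  proof (rule nn_integral_cong)
    fix r :: real
    have "(\<integral>\<^sup>+t. ennreal (2 * exp (- t / (2*\<epsilon>))) * (ennreal (exp (- r / (2*\<epsilon>)) * (w r)\<^sup>2) * (indicator {0<..} r * indicator {r..} t)) \<partial>lborel)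
      = (\<integral>\<^sup>+t. (2 * (ennreal (exp (- r / (2*\<epsilon>)) * (w r)\<^sup>2) * indicator {0<..} r)) * (ennreal (exp (- t / (2*\<epsilon>))) * indicator {r..} t) \<partial>lborel)"
      by (intro nn_integral_cong) (auto simp: indicator_def ennreal_mult ac_simps)
    also have "\<dots> = (2 * (ennreal (exp (- r / (2*\<epsilon>)) * (w r)\<^sup>2) * indicator {0<..} r)) * ennreal (2 * \<epsilon> * exp (- r / (2*\<epsilon>)))"
      using exp_weight_tail[of "2*\<epsilon>" r] \<epsilon> by (subst nn_integral_cmult) auto
    also have "\<dots> = ennreal (4 * \<epsilon>\<^sup>2) * (ennreal (wed_density \<epsilon> r * (w r)\<^sup>2) * indicator {0<..} r)"
    proof (cases "r > 0")
      case True
      have e: "exp (- r / (2*\<epsilon>)) * exp (- r / (2*\<epsilon>)) = exp (- r / \<epsilon>)"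
        unfolding exp_add[symmetric] using \<epsilon> by (simp add: field_simps)
      have "2 * (exp (- r / (2*\<epsilon>)) * (w r)\<^sup>2) * (2 * \<epsilon> * exp (- r / (2*\<epsilon>))) = 4 * \<epsilon>\<^sup>2 * (wed_density \<epsilon> r * (w r)\<^sup>2)"
        using \<epsilon> e by (simp add: wed_density_def power2_eq_square)
      then have "ennreal (2 * (exp (- r / (2*\<epsilon>)) * (w r)\<^sup>2)) * ennreal (2 * \<epsilon> * exp (- r / (2*\<epsilon>))) = ennreal (4 * \<epsilon>\<^sup>2) * ennreal (wed_density \<epsilon> r * (w r)\<^sup>2)"
        using \<epsilon> by (simp add: wed_density_def flip: ennreal_mult)
      then show ?thesis using True by (simp add: ennreal_mult)
    qed simp
    finally show "(\<integral>\<^sup>+t. ennreal (2 * exp (- t / (2*\<epsilon>))) * (ennreal (exp (- r / (2*\<epsilon>)) * (w r)\<^sup>2) * (indicator {0<..} r * indicator {r..} t)) \<partial>lborel)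
      = ennreal (4 * \<epsilon>\<^sup>2) * (ennreal (wed_density \<epsilon> r * (w r)\<^sup>2) * indicator {0<..} r)" .
  qed
  also have "\<dots> = ennreal (4 * \<epsilon>\<^sup>2) * (\<integral>\<^sup>+t\<in>{0<..}. ennreal (wed_density \<epsilon> t * (w t)\<^sup>2) \<partial>lborel)"
    by (subst nn_integral_cmult) measurable
  finally show ?thesis .
qed

section \<open>The value function is bounded below\<close>

text \<open>
  Holds for arbitrary functions, since \<^const>\<open>nn_integral\<close> is a supremum over simple functions below
  the integrand. So the functional can be estimated by replacing the metric derivative by a speed bound.
\<close>

lemma ext_integral_mono_AE:
  assumes "AE x in M. f x \<le> g x"
  shows "ext_integral M f \<le> ext_integral M g"
  unfolding ext_integral_def
proof (rule ereal_minus_mono)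
  have "(\<integral>\<^sup>+ x. e2ennreal (f x) \<partial>M) \<le> (\<integral>\<^sup>+ x. e2ennreal (g x) \<partial>M)"
    using assms by (intro nn_integral_mono_AE) (auto elim!: AE_mp intro: e2ennreal_mono)
  then show "enn2ereal (\<integral>\<^sup>+ x. e2ennreal (f x) \<partial>M) \<le> enn2ereal (\<integral>\<^sup>+ x. e2ennreal (g x) \<partial>M)"
    by (simp add: less_eq_ennreal.rep_eq)
  have "AE x in M. e2ennreal (- g x) \<le> e2ennreal (- f x)"
    using assms by eventually_elim (simp add: e2ennreal_mono)
  then have "(\<integral>\<^sup>+ x. e2ennreal (- g x) \<partial>M) \<le> (\<integral>\<^sup>+ x. e2ennreal (- f x) \<partial>M)"
    by (rule nn_integral_mono_AE)
  then show "enn2ereal (\<integral>\<^sup>+ x. e2ennreal (- g x) \<partial>M) \<le> enn2ereal (\<integral>\<^sup>+ x. e2ennreal (- f x) \<partial>M)"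
    by (simp add: less_eq_ennreal.rep_eq)
qed

lemma ext_integral_real:
  assumes "integrable M f"
  shows "ext_integral M (\<lambda>x. ereal (f x)) = ereal (\<integral>x. f x \<partial>M)"
proof -
  have "(\<integral>\<^sup>+ x. ennreal (f x) \<partial>M) \<noteq> top" "(\<integral>\<^sup>+ x. ennreal (- f x) \<partial>M) \<noteq> top"
    using assms by (auto simp: real_integrable_def)
  then obtain P N where P: "P \<ge> 0" "(\<integral>\<^sup>+ x. ennreal (f x) \<partial>M) = ennreal P"
    and N: "N \<ge> 0" "(\<integral>\<^sup>+ x. ennreal (- f x) \<partial>M) = ennreal N"
    by (metis ennreal_cases)
  have "ext_integral M (\<lambda>x. ereal (f x)) = ereal P - ereal N"
    using P N by (simp add: ext_integral_def e2ennreal_ereal)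
  then show ?thesis
    using P N by (simp add: real_lebesgue_integral_def[OF assms])
qed

locale wed_problem =
  fixes \<sigma> :: "'a::metric_space topology" and \<phi> :: "'a \<Rightarrow> ereal" and u0 :: 'a and A B \<epsilon> :: real
  assumes compat: "compatible \<sigma>" and proper: "proper \<phi>" and lscc: "LSCC \<sigma> \<phi> u0 A B"
    and eps: "\<epsilon> > 0" and B_small: "1 / (16 * \<epsilon>) > B"
begin

abbreviation "Q y \<equiv> B * (dist y u0)\<^sup>2 + A"
abbreviation "V \<equiv> value_fun \<phi> \<epsilon>"

lemmas AE_wed = AE_wed_iff[OF eps, THEN iffD2]

lemma AB_nonneg: "A \<ge> 0" "B \<ge> 0"
  using lscc by (auto simp: LSCC_def)

lemma phi_lower: "ereal (- B * (dist x y)\<^sup>2 - Q y) \<le> \<phi> x"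
  using lscc by (auto simp: LSCC_def)

lemma phi_not_MInf: "\<phi> x \<noteq> - \<infinity>"
  using proper by (auto simp: proper_def)

text \<open>
  The second compatibility condition says in particular that \<open>\<sigma>\<close>-open sets are open for the metric.
  Metric convergence therefore implies \<open>\<sigma>\<close>-convergence, and a convergent sequence is bounded.
\<close>

lemma phi_lsc:
  assumes "X \<longlonglongrightarrow> x"
  shows "\<phi> x \<le> liminf (\<lambda>n. \<phi> (X n))"
proof -
  have "limitin \<sigma> X x sequentially"
    unfolding limitin_def
  proof (intro conjI allI impI)
    show "x \<in> topspace \<sigma>" using compat by (simp add: compatible_def)
    fix U assume U: "openin \<sigma> U \<and> x \<in> U"
    then obtain W \<delta> where W: "x \<in> W" "\<delta> > 0" "\<And>y. infdist y W < \<delta> \<Longrightarrow> y \<in> U"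
      using compat unfolding compatible_def by meson
    have "\<forall>\<^sub>F n in sequentially. dist (X n) x < \<delta>"
      using assms W(2) by (rule tendstoD)
    then show "\<forall>\<^sub>F n in sequentially. X n \<in> U"
      by eventually_elim (use W infdist_le[OF W(1)] in \<open>meson le_less_trans\<close>)
  qed
  moreover have "bounded (range X)"
    using assms by (rule convergent_imp_bounded)
  ultimately show ?thesis using lscc by (auto simp: LSCC_def)
qed

text \<open>
  The sublevel sets are closed, because \<open>\<phi>\<close> is lower semicontinuous for the metric; the value \<open>\<infinity>\<close>
  off the closed set \<open>S\<close> preserves this.
\<close>

lemma phi_comp_measurable:
  fixes u :: "real \<Rightarrow> 'a"
  assumes S: "closed S" and u: "continuous_on S u"
  shows "(\<lambda>t. if t \<in> S then \<phi> (u t) else \<infinity>) \<in> borel_measurable borel"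
proof (subst borel_measurable_iff_Iic_ereal, rule allI)
  fix c :: ereal
  let ?f = "\<lambda>t. if t \<in> S then \<phi> (u t) else \<infinity>"
  show "?f -` {..c} \<inter> space borel \<in> sets borel"
  proof (cases "c = \<infinity>")
    case False
    have "closed (?f -` {..c})"
      unfolding closed_sequential_limits
    proof (intro allI impI, elim conjE)
      fix X l assume X: "\<forall>n. X n \<in> ?f -` {..c}" and lim: "X \<longlonglongrightarrow> l"
      have XS: "X n \<in> S" "\<phi> (u (X n)) \<le> c" for n
        using X[rule_format, of n] False by (auto split: if_splits simp: top.extremum_unique)
      have l: "l \<in> S" using S XS lim closed_sequentially by blast
      have "(\<lambda>n. u (X n)) \<longlonglongrightarrow> u l"
        using u l XS(1) lim by (auto simp: continuous_on_sequentially comp_def)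
      then have "\<phi> (u l) \<le> liminf (\<lambda>n. \<phi> (u (X n)))" by (rule phi_lsc)
      also have "\<dots> \<le> c"
      proof -
        have "liminf (\<lambda>n. \<phi> (u (X n))) \<le> liminf (\<lambda>n::nat. c)"
          using XS by (intro Liminf_mono) auto
        then show ?thesis by (simp add: Liminf_const)
      qed
      finally show "l \<in> ?f -` {..c}" using l by simp
    qed
    then show ?thesis by auto
  next
    case True
    then have "?f -` {..c} = UNIV" by auto
    then show ?thesis by simp
  qed
qed

lemma wed_curves_speed:
  assumes "u \<in> wed_curves \<epsilon> x"
  obtains w where "has_speed {0..} u w" "AE t in lebesgue. t > 0 \<longrightarrow> metric_deriv {0..} u t = w t"
    "\<forall>a b. {a..b} \<subseteq> {0..} \<longrightarrow> set_integrable lebesgue {a..b} (\<lambda>x. (w x)\<^sup>2)"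
    "integrable (wed_measure \<epsilon>) (\<lambda>t. (w t)\<^sup>2)"
proof -
  have u: "AC_loc 2 {0..} u" "(\<integral>\<^sup>+ t. ennreal ((metric_deriv {0..} u t)\<^sup>2) \<partial>wed_measure \<epsilon>) < \<infinity>"
    using assms by (auto simp: wed_curves_def)
  obtain w where w: "has_speed {0..} u w" "AE t in lebesgue. t \<in> {0..} \<longrightarrow> metric_deriv {0..} u t = w t"
    "(2::ennreal) = 2 \<Longrightarrow> \<forall>a b. {a..b} \<subseteq> {0..} \<longrightarrow> set_integrable lebesgue {a..b} (\<lambda>x. (w x)\<^sup>2)"
    by (rule AC_loc_speed[OF _ u(1)]) auto
  have ae: "AE t in lebesgue. t > 0 \<longrightarrow> metric_deriv {0..} u t = w t"
    using w(2) by eventually_elim auto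
  have wb: "w \<in> borel_measurable borel" using w(1) by (simp add: has_speed_def)
  have "(\<integral>\<^sup>+ t. ennreal ((metric_deriv {0..} u t)\<^sup>2) \<partial>wed_measure \<epsilon>) = (\<integral>\<^sup>+ t. ennreal ((w t)\<^sup>2) \<partial>wed_measure \<epsilon>)"
  proof (rule nn_integral_cong_AE)
    show "AE t in wed_measure \<epsilon>. ennreal ((metric_deriv {0..} u t)\<^sup>2) = ennreal ((w t)\<^sup>2)"
      using ae by (intro AE_wed) (auto elim!: AE_mp)
  qed
  then have "integrable (wed_measure \<epsilon>) (\<lambda>t. (w t)\<^sup>2)"
    unfolding integrable_iff_bounded using u(2) wb by (auto intro: borel_imp_wed)
  then show thesis using that w ae by blast
qed

text \<open>
  The constant \<open>4 \<epsilon>\<^sup>2\<close> is that of \<open>weighted_hardy\<close>. The maximum with 0 only makes the integrand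
  Borel on the whole line.
\<close>

lemma wed_dist_bound:
  assumes u: "has_speed {0..} u w" and w2: "integrable (wed_measure \<epsilon>) (\<lambda>t. (w t)\<^sup>2)"
  shows "integrable (wed_measure \<epsilon>) (\<lambda>t. (dist (u (max 0 t)) (u 0))\<^sup>2)"
    "(\<integral>t. (dist (u (max 0 t)) (u 0))\<^sup>2 \<partial>wed_measure \<epsilon>) \<le> 4 * \<epsilon>\<^sup>2 * (\<integral>t. (w t)\<^sup>2 \<partial>wed_measure \<epsilon>)"
proof -
  let ?D = "\<lambda>t. dist (u (max 0 t)) (u 0)"
  have wb: "w \<in> borel_measurable borel" and w0: "\<And>t. w t \<ge> 0" using u by (auto simp: has_speed_def)
  have uc: "continuous_on {0..} u"
    by (rule has_speed_continuous[OF u]) auto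
  have "continuous_on UNIV (\<lambda>t::real. u (max 0 t))"
    by (rule continuous_on_compose2[OF uc]) (auto intro!: continuous_intros)
  then have Db: "?D \<in> borel_measurable borel"
    by (intro borel_measurable_continuous_onI continuous_intros)
  have D: "ennreal (?D t) \<le> (\<integral>\<^sup>+r\<in>{0..t}. ennreal (w r) \<partial>lborel)" if "t > 0" for t
  proof -
    have *: "set_integrable lebesgue {0..t} w" "dist (u 0) (u t) \<le> (LINT r:{0..t}|lebesgue. w r)"
      using u that by (auto simp: has_speed_def)
    have "ennreal (?D t) \<le> ennreal (LINT r:{0..t}|lebesgue. w r)"
      using *(2) that by (intro ennreal_leI) (simp add: dist_commute)
    also have "\<dots> = (\<integral>\<^sup>+r\<in>{0..t}. ennreal (w r) \<partial>lborel)"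
      by (rule nn_integral_eq_set_integral[OF wb w0 *(1), symmetric]) simp
    finally show ?thesis .
  qed
  have conv: "(\<integral>\<^sup>+t. ennreal ((f t)\<^sup>2) \<partial>wed_measure \<epsilon>) = (\<integral>\<^sup>+t\<in>{0<..}. ennreal (wed_density \<epsilon> t * (f t)\<^sup>2) \<partial>lborel)"
    if "f \<in> borel_measurable borel" for f :: "real \<Rightarrow> real"
    using that by (subst nn_integral_wed) (auto simp: ennreal_mult wed_density_nonneg eps)
  have le: "(\<integral>\<^sup>+t. ennreal ((?D t)\<^sup>2) \<partial>wed_measure \<epsilon>) \<le> ennreal (4 * \<epsilon>\<^sup>2) * (\<integral>\<^sup>+t. ennreal ((w t)\<^sup>2) \<partial>wed_measure \<epsilon>)"
    unfolding conv[OF Db] conv[OF wb] by (rule weighted_hardy[OF eps wb w0 _ D]) auto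
  also have "\<dots> = ennreal (4 * \<epsilon>\<^sup>2 * (\<integral>t. (w t)\<^sup>2 \<partial>wed_measure \<epsilon>))"
    using w2 by (simp add: nn_integral_eq_integral ennreal_mult)
  finally have le: "(\<integral>\<^sup>+t. ennreal ((?D t)\<^sup>2) \<partial>wed_measure \<epsilon>) \<le> ennreal (4 * \<epsilon>\<^sup>2 * (\<integral>t. (w t)\<^sup>2 \<partial>wed_measure \<epsilon>))" .
  show int: "integrable (wed_measure \<epsilon>) (\<lambda>t. (?D t)\<^sup>2)"
    unfolding integrable_iff_bounded
  proof
    show "(\<integral>\<^sup>+t. ennreal (norm ((?D t)\<^sup>2)) \<partial>wed_measure \<epsilon>) < \<infinity>"
      using le by (simp add: le_less_trans)
  qed (use Db in \<open>auto intro!: borel_imp_wed\<close>)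
  show "(\<integral>t. (?D t)\<^sup>2 \<partial>wed_measure \<epsilon>) \<le> 4 * \<epsilon>\<^sup>2 * (\<integral>t. (w t)\<^sup>2 \<partial>wed_measure \<epsilon>)"
    using le int by (subst (asm) nn_integral_eq_integral) (auto simp: integral_nonneg_AE)
qed

text \<open>
  By coercivity the integrand is at least \<open>h = \<epsilon>/2 w\<^sup>2 - B d\<^sup>2(u(t), x) - Q x\<close>, which is integrable, and
  \<open>\<integral> h \<ge> (\<epsilon>/2 - 4 \<epsilon>\<^sup>2 B) \<integral> w\<^sup>2 - Q x \<ge> - Q x\<close>. In particular the negative part of the integrand is always
  integrable; if the functional is finite, so is the positive part, and the functional is an ordinary
  integral.
\<close>

lemma wed_functional_facts:
  assumes u: "u \<in> wed_curves \<epsilon> x"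
  shows "ereal (- Q x) \<le> wed_functional \<phi> \<epsilon> u"
    and "wed_functional \<phi> \<epsilon> u < \<infinity> \<Longrightarrow> \<exists>f. f \<in> borel_measurable borel \<and> integrable (wed_measure \<epsilon>) f \<and>
       wed_functional \<phi> \<epsilon> u = ereal (\<integral>t. f t \<partial>wed_measure \<epsilon>) \<and>
       (AE t in lebesgue. t > 0 \<longrightarrow> ereal (\<epsilon> / 2 * (metric_deriv {0..} u t)\<^sup>2) + \<phi> (u t) = ereal (f t))"
proof -
  obtain w where w: "has_speed {0..} u w" "AE t in lebesgue. t > 0 \<longrightarrow> metric_deriv {0..} u t = w t"
    "integrable (wed_measure \<epsilon>) (\<lambda>t. (w t)\<^sup>2)"
    using wed_curves_speed[OF u] by metis
  have x: "x = u 0" using u by (simp add: wed_curves_def)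
  let ?D = "\<lambda>t. dist (u (max 0 t)) (u 0)"
  let ?F = "\<lambda>t. ereal (\<epsilon> / 2 * (metric_deriv {0..} u t)\<^sup>2) + \<phi> (u t)"
  define F where "F t = ereal (\<epsilon> / 2 * (w t)\<^sup>2) + (if t \<in> {0..} then \<phi> (u t) else \<infinity>)" for t
  define h where "h t = \<epsilon> / 2 * (w t)\<^sup>2 - B * (?D t)\<^sup>2 - Q x" for t
  have wb: "w \<in> borel_measurable borel" using w(1) by (simp add: has_speed_def)
  have uc: "continuous_on {0..} u"
    by (rule has_speed_continuous[OF w(1)]) auto
  have Fb: "F \<in> borel_measurable borel"
    unfolding F_def using wb phi_comp_measurable[OF _ uc] by (intro borel_measurable_ereal_add) auto
  have FF: "AE t in lebesgue. t > 0 \<longrightarrow> ?F t = F t"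
    using w(2) by eventually_elim (auto simp: F_def)
  have eq: "wed_functional \<phi> \<epsilon> u = ext_integral (wed_measure \<epsilon>) F"
    unfolding wed_functional_def
  proof (rule antisym; rule ext_integral_mono_AE)
    show "AE t in wed_measure \<epsilon>. ?F t \<le> F t" "AE t in wed_measure \<epsilon>. F t \<le> ?F t"
      using FF by (auto intro!: AE_wed elim!: AE_mp)
  qed
  note D = wed_dist_bound[OF w(1,3)]
  have "has_bochner_integral (wed_measure \<epsilon>) h
    (\<epsilon> / 2 * (\<integral>t. (w t)\<^sup>2 \<partial>wed_measure \<epsilon>) - B * (\<integral>t. (?D t)\<^sup>2 \<partial>wed_measure \<epsilon>) - Q x)"
    unfolding h_def
    by (intro has_bochner_integral_diff has_bochner_integral_mult_right has_bochner_integral_integrable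
        wed_measure_total[OF eps] w(3) D(1))
  then have hi: "integrable (wed_measure \<epsilon>) h"
    and hv: "(\<integral>t. h t \<partial>wed_measure \<epsilon>) = \<epsilon> / 2 * (\<integral>t. (w t)\<^sup>2 \<partial>wed_measure \<epsilon>) - B * (\<integral>t. (?D t)\<^sup>2 \<partial>wed_measure \<epsilon>) - Q x"
    by (auto simp: has_bochner_integral_iff)
  have hF: "AE t in wed_measure \<epsilon>. ereal (h t) \<le> F t"
  proof (rule AE_wed, rule AE_I2, rule impI)
    fix t :: real assume t: "t > 0"
    have "ereal (h t) = ereal (\<epsilon> / 2 * (w t)\<^sup>2) + ereal (- B * (dist (u t) x)\<^sup>2 - Q x)"
      using t by (simp add: h_def x)
    also have "\<dots> \<le> ereal (\<epsilon> / 2 * (w t)\<^sup>2) + \<phi> (u t)"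
      by (intro add_left_mono phi_lower)
    finally show "ereal (h t) \<le> F t" using t by (simp add: F_def)
  qed
  have E0: "(\<integral>t. (w t)\<^sup>2 \<partial>wed_measure \<epsilon>) \<ge> 0" by (intro integral_nonneg_AE) auto
  have "B * (\<integral>t. (?D t)\<^sup>2 \<partial>wed_measure \<epsilon>) \<le> B * (4 * \<epsilon>\<^sup>2 * (\<integral>t. (w t)\<^sup>2 \<partial>wed_measure \<epsilon>))"
    using D(2) AB_nonneg by (intro mult_left_mono) auto
  \<comment> \<open>The smallness of \<open>B\<close> enters here.\<close>
  also have "\<dots> \<le> 1 / (16 * \<epsilon>) * (4 * \<epsilon>\<^sup>2 * (\<integral>t. (w t)\<^sup>2 \<partial>wed_measure \<epsilon>))"
    using B_small E0 by (intro mult_right_mono) auto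
  also have "\<dots> = \<epsilon> / 4 * (\<integral>t. (w t)\<^sup>2 \<partial>wed_measure \<epsilon>)"
    using eps by (simp add: power2_eq_square field_simps)
  also have "\<dots> \<le> \<epsilon> / 2 * (\<integral>t. (w t)\<^sup>2 \<partial>wed_measure \<epsilon>)"
    using eps E0 by (intro mult_right_mono) auto
  finally have "- Q x \<le> (\<integral>t. h t \<partial>wed_measure \<epsilon>)" unfolding hv by linarith
  then have "ereal (- Q x) \<le> ext_integral (wed_measure \<epsilon>) (\<lambda>t. ereal (h t))"
    by (simp add: ext_integral_real[OF hi])
  also have "\<dots> \<le> wed_functional \<phi> \<epsilon> u"
    unfolding eq by (rule ext_integral_mono_AE[OF hF])
  finally show "ereal (- Q x) \<le> wed_functional \<phi> \<epsilon> u" .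
  assume fin: "wed_functional \<phi> \<epsilon> u < \<infinity>"
  have "(\<integral>\<^sup>+ t. e2ennreal (- F t) \<partial>wed_measure \<epsilon>) \<le> (\<integral>\<^sup>+ t. ennreal (norm (h t)) \<partial>wed_measure \<epsilon>)"
  proof (intro nn_integral_mono_AE)
    show "AE t in wed_measure \<epsilon>. e2ennreal (- F t) \<le> ennreal (norm (h t))"
      using hF
    proof eventually_elim
      case (elim t)
      then have "- F t \<le> ereal (norm (h t))"
        by (cases "F t") auto
      then show ?case using e2ennreal_mono[of "- F t" "ereal (norm (h t))"] by (simp add: e2ennreal_ereal)
    qed
  qed
  also have "\<dots> < \<infinity>" using hi by (simp add: integrable_iff_bounded)
  finally have neg: "(\<integral>\<^sup>+ t. e2ennreal (- F t) \<partial>wed_measure \<epsilon>) < \<infinity>" .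
  have pos: "(\<integral>\<^sup>+ t. e2ennreal (F t) \<partial>wed_measure \<epsilon>) < \<infinity>"
  proof (rule ccontr)
    assume "\<not> ?thesis"
    then have "(\<integral>\<^sup>+ t. e2ennreal (F t) \<partial>wed_measure \<epsilon>) = top"
      by (metis top.not_eq_extremum infinity_ennreal_def)
    then have "ext_integral (wed_measure \<epsilon>) F = \<infinity>"
      by (simp add: ext_integral_def)
    then show False using fin eq by simp
  qed
  define f where "f t = real_of_ereal (F t)" for t
  have fb: "f \<in> borel_measurable borel" unfolding f_def using Fb by measurable
  have Ffin: "AE t in wed_measure \<epsilon>. F t = ereal (f t)"
  proof -
    have "AE t in wed_measure \<epsilon>. e2ennreal (F t) \<noteq> \<infinity>"
      using pos Fb by (intro nn_integral_PInf_AE borel_imp_wed) auto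
    then show ?thesis
      using hF
    proof eventually_elim
      case (elim t)
      then show ?case by (cases "F t") (auto simp: f_def)
    qed
  qed
  have fi: "integrable (wed_measure \<epsilon>) f"
    unfolding real_integrable_def
  proof (intro conjI)
    have "(\<integral>\<^sup>+ t. ennreal (f t) \<partial>wed_measure \<epsilon>) = (\<integral>\<^sup>+ t. e2ennreal (F t) \<partial>wed_measure \<epsilon>)"
      using Ffin by (intro nn_integral_cong_AE) (auto elim!: AE_mp simp: e2ennreal_ereal)
    then show "(\<integral>\<^sup>+ t. ennreal (f t) \<partial>wed_measure \<epsilon>) \<noteq> \<infinity>" using pos by auto
    have "(\<integral>\<^sup>+ t. ennreal (- f t) \<partial>wed_measure \<epsilon>) = (\<integral>\<^sup>+ t. e2ennreal (- F t) \<partial>wed_measure \<epsilon>)"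
      using Ffin by (intro nn_integral_cong_AE) (auto elim!: AE_mp simp: e2ennreal_ereal)
    then show "(\<integral>\<^sup>+ t. ennreal (- f t) \<partial>wed_measure \<epsilon>) \<noteq> \<infinity>" using neg by auto
  qed (use fb in \<open>auto intro: borel_imp_wed\<close>)
  show "\<exists>f. f \<in> borel_measurable borel \<and> integrable (wed_measure \<epsilon>) f \<and>
       wed_functional \<phi> \<epsilon> u = ereal (\<integral>t. f t \<partial>wed_measure \<epsilon>) \<and>
       (AE t in lebesgue. t > 0 \<longrightarrow> ?F t = ereal (f t))"
  proof (intro exI[of _ f] conjI fb fi)
    show "wed_functional \<phi> \<epsilon> u = ereal (\<integral>t. f t \<partial>wed_measure \<epsilon>)"
      unfolding eq ext_integral_real[OF fi, symmetric]
      using Ffin by (intro antisym ext_integral_mono_AE) (auto elim!: AE_mp)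
    show "AE t in lebesgue. t > 0 \<longrightarrow> ?F t = ereal (f t)"
      using Ffin[unfolded AE_wed_iff[OF eps]] FF by eventually_elim auto
  qed
qed

end

section \<open>Dynamic programming\<close>

lemma has_bochner_integral_Ioc_of_Icc:
  fixes f :: "real \<Rightarrow> real"
  assumes "has_bochner_integral lebesgue (\<lambda>r. indicator {a..b} r * f r) x"
  shows "has_bochner_integral lebesgue (\<lambda>r. indicator {a<..b} r * f r) x"
proof -
  have "integrable lebesgue (\<lambda>r. indicator {a<..b} r *\<^sub>R (indicator {a..b} r * f r))"
    using assms by (intro integrable_mult_indicator) (auto simp: has_bochner_integral_iff)
  moreover have "(\<lambda>r. indicator {a<..b} r *\<^sub>R (indicator {a..b} r * f r)) = (\<lambda>r. indicator {a<..b} r * f r)"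
    by (auto simp: indicator_def fun_eq_iff)
  ultimately have i: "integrable lebesgue (\<lambda>r. indicator {a<..b} r * f r)" by simp
  have "(LINT r|lebesgue. indicator {a<..b} r * f r) = (LINT r|lebesgue. indicator {a..b} r * f r)"
  proof (rule integral_cong_AE)
    show "AE r in lebesgue. indicator {a<..b} r * f r = indicator {a..b} r * f r"
      by (rule AE_mp[OF AE_completion[OF AE_lborel_singleton[of a]]], rule AE_I2) (auto simp: indicator_def)
  qed (use i assms in \<open>auto intro: borel_measurable_integrable simp: has_bochner_integral_iff\<close>)
  then show ?thesis using i assms by (simp add: has_bochner_integral_iff)
qed

lemma has_bochner_integral_shift:
  fixes f :: "real \<Rightarrow> real"
  assumes "has_bochner_integral lebesgue f x"
  shows "has_bochner_integral lebesgue (\<lambda>r. f (r - h)) x"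
  using has_bochner_integral_lebesgue_real_affine_iff[of 1 f x "- h"] assms by simp

text \<open>
  The two pieces share the junction point \<open>h\<close>; half-open intervals make them disjoint.
\<close>

lemma set_integral_concat:
  fixes f1 f2 :: "real \<Rightarrow> real"
  assumes f1: "set_integrable lebesgue {s..h} f1" and f2: "set_integrable lebesgue {0..t - h} f2" and h: "s \<le> h" "h \<le> t"
  shows "set_integrable lebesgue {s..t} (\<lambda>r. if r \<le> h then f1 r else f2 (r - h))"
    and "(LINT r:{s..t}|lebesgue. if r \<le> h then f1 r else f2 (r - h))
       = (LINT r:{s..h}|lebesgue. f1 r) + (LINT r:{0..t-h}|lebesgue. f2 r)"
proof -
  have 1: "has_bochner_integral lebesgue (\<lambda>r. indicator {s..h} r * f1 r) (LINT r:{s..h}|lebesgue. f1 r)"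
    using f1 by (simp add: set_integrable_def set_lebesgue_integral_def has_bochner_integral_iff)
  have "has_bochner_integral lebesgue (\<lambda>r. indicator {0..t-h} r * f2 r) (LINT r:{0..t-h}|lebesgue. f2 r)"
    using f2 by (simp add: set_integrable_def set_lebesgue_integral_def has_bochner_integral_iff)
  from has_bochner_integral_shift[OF has_bochner_integral_Ioc_of_Icc[OF this], of h]
  have 2: "has_bochner_integral lebesgue (\<lambda>r. indicator {0<..t-h} (r - h) * f2 (r - h)) (LINT r:{0..t-h}|lebesgue. f2 r)" .
  have eq: "indicator {s..h} r * f1 r + indicator {0<..t-h} (r - h) * f2 (r - h) = indicator {s..t} r *\<^sub>R (if r \<le> h then f1 r else f2 (r - h))" for r
    using h by (auto simp: indicator_def)
  have "has_bochner_integral lebesgue (\<lambda>r. indicator {s..t} r *\<^sub>R (if r \<le> h then f1 r else f2 (r - h)))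
     ((LINT r:{s..h}|lebesgue. f1 r) + (LINT r:{0..t-h}|lebesgue. f2 r))"
    using has_bochner_integral_add[OF 1 2] unfolding eq .
  then show "set_integrable lebesgue {s..t} (\<lambda>r. if r \<le> h then f1 r else f2 (r - h))"
    "(LINT r:{s..t}|lebesgue. if r \<le> h then f1 r else f2 (r - h))
       = (LINT r:{s..h}|lebesgue. f1 r) + (LINT r:{0..t-h}|lebesgue. f2 r)"
    by (simp_all add: set_integrable_def set_lebesgue_integral_def has_bochner_integral_iff)
qed

lemma set_integral_shift:
  fixes f :: "real \<Rightarrow> real"
  assumes f: "set_integrable lebesgue {a..b} f"
  shows "set_integrable lebesgue {a+h..b+h} (\<lambda>r. f (r - h))"
    and "(LINT r:{a+h..b+h}|lebesgue. f (r - h)) = (LINT r:{a..b}|lebesgue. f r)"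
proof -
  have "has_bochner_integral lebesgue (\<lambda>r. indicator {a..b} r * f r) (LINT r:{a..b}|lebesgue. f r)"
    using f by (simp add: set_integrable_def set_lebesgue_integral_def has_bochner_integral_iff)
  from has_bochner_integral_shift[OF this, of h]
  have "has_bochner_integral lebesgue (\<lambda>r. indicator {a+h..b+h} r *\<^sub>R f (r - h)) (LINT r:{a..b}|lebesgue. f r)"
    by (rule has_bochner_integral_cong[THEN iffD1, rotated -1]) (auto simp: indicator_def)
  then show "set_integrable lebesgue {a+h..b+h} (\<lambda>r. f (r - h))"
    "(LINT r:{a+h..b+h}|lebesgue. f (r - h)) = (LINT r:{a..b}|lebesgue. f r)"
    by (simp_all add: set_integrable_def set_lebesgue_integral_def has_bochner_integral_iff)
qed

lemma has_speed_concat: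
  assumes u: "has_speed {0..h} u m" and v: "has_speed {0..} v w" and vu: "v 0 = u h" and h: "h \<ge> 0"
  shows "has_speed {0..} (\<lambda>r. if r \<le> h then u r else v (r - h)) (\<lambda>r. if r \<le> h then m r else w (r - h))"
  unfolding has_speed_def
proof (intro conjI ballI allI impI)
  let ?z = "\<lambda>r. if r \<le> h then u r else v (r - h)" and ?w = "\<lambda>r. if r \<le> h then m r else w (r - h)"
  have b: "m \<in> borel_measurable borel" "w \<in> borel_measurable borel" using u v by (auto simp: has_speed_def)
  then show "?w \<in> borel_measurable borel" by measurable
  show "0 \<le> ?w x" for x using u v by (auto simp: has_speed_def)
  fix s t :: real assume st: "s \<in> {0..}" "t \<in> {0..}" "s \<le> t"
  consider "t \<le> h" | "h < s" | "s \<le> h" "h < t" by linarith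
  then have "set_integrable lebesgue {s..t} ?w \<and> dist (?z s) (?z t) \<le> (LINT r:{s..t}|lebesgue. ?w r)"
  proof cases
    case 1
    have "set_integrable lebesgue {s..t} m" "dist (u s) (u t) \<le> (LINT r:{s..t}|lebesgue. m r)"
      using u st 1 by (auto simp: has_speed_def)
    moreover have "set_integrable lebesgue {s..t} ?w = set_integrable lebesgue {s..t} m"
      unfolding set_integrable_def by (rule Bochner_Integration.integrable_cong) (use 1 in \<open>auto simp: indicator_def\<close>)
    moreover have "(LINT r:{s..t}|lebesgue. ?w r) = (LINT r:{s..t}|lebesgue. m r)"
      by (rule set_lebesgue_integral_cong) (use 1 in auto)
    ultimately show ?thesis using 1 st by simp
  next
    case 2
    have vw: "set_integrable lebesgue {s - h..t - h} w" "dist (v (s - h)) (v (t - h)) \<le> (LINT r:{s - h..t - h}|lebesgue. w r)"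
      using v st 2 h by (auto simp: has_speed_def)
    have sh: "set_integrable lebesgue {s..t} (\<lambda>r. w (r - h))" "(LINT r:{s..t}|lebesgue. w (r - h)) = (LINT r:{s - h..t - h}|lebesgue. w r)"
      using set_integral_shift[OF vw(1), of h] by simp_all
    moreover have "set_integrable lebesgue {s..t} ?w = set_integrable lebesgue {s..t} (\<lambda>r. w (r - h))"
      unfolding set_integrable_def by (rule Bochner_Integration.integrable_cong) (use 2 in \<open>auto simp: indicator_def\<close>)
    moreover have "(LINT r:{s..t}|lebesgue. ?w r) = (LINT r:{s..t}|lebesgue. w (r - h))"
      by (rule set_lebesgue_integral_cong) (use 2 in auto)
    ultimately show ?thesis using 2 st vw(2) by simp
  next
    case 3
    have i1: "set_integrable lebesgue {s..h} m" "dist (u s) (u h) \<le> (LINT r:{s..h}|lebesgue. m r)"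
      using u st 3 h by (auto simp: has_speed_def)
    have i2: "set_integrable lebesgue {0..t - h} w" "dist (v 0) (v (t - h)) \<le> (LINT r:{0..t - h}|lebesgue. w r)"
      using v st 3 h by (auto simp: has_speed_def)
    have "dist (?z s) (?z t) \<le> dist (u s) (u h) + dist (v 0) (v (t - h))"
      using 3 vu dist_triangle[of "u s" "v (t - h)" "u h"] by simp
    also have "\<dots> \<le> (LINT r:{s..t}|lebesgue. ?w r)"
      using i1(2) i2(2) set_integral_concat(2)[OF i1(1) i2(1)] 3 by simp
    finally show ?thesis
      using set_integral_concat(1)[OF i1(1) i2(1)] 3 by simp
  qed
  then show "set_integrable lebesgue {s..t} ?w" "dist (?z s) (?z t) \<le> (LINT r:{s..t}|lebesgue. ?w r)" by auto
qed

lemma set_integrable_bounded_mult: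
  fixes f k :: "real \<Rightarrow> real"
  assumes f: "set_integrable lebesgue S f" and k: "k \<in> borel_measurable borel" "\<And>t. t \<in> S \<Longrightarrow> \<bar>k t\<bar> \<le> K"
  shows "set_integrable lebesgue S (\<lambda>t. k t * f t)"
  unfolding set_integrable_def
proof (rule Bochner_Integration.integrable_bound)
  show "integrable lebesgue (\<lambda>t. K * (indicator S t *\<^sub>R f t))"
    using f unfolding set_integrable_def by simp
  have "k \<in> borel_measurable lebesgue" using k(1) by (intro measurable_completion) simp
  then have "(\<lambda>t. k t * (indicator S t *\<^sub>R f t)) \<in> borel_measurable lebesgue"
    by (rule borel_measurable_times[OF _ borel_measurable_integrable[OF f[unfolded set_integrable_def]]])
  then show "(\<lambda>t. indicator S t *\<^sub>R (k t * f t)) \<in> borel_measurable lebesgue"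
    by (simp add: ac_simps)
  show "AE t in lebesgue. norm (indicator S t *\<^sub>R (k t * f t)) \<le> norm (K * (indicator S t *\<^sub>R f t))"
  proof (rule AE_I2)
    fix t
    have "\<bar>k t * f t\<bar> \<le> \<bar>K\<bar> * \<bar>f t\<bar>" if "t \<in> S"
      unfolding abs_mult using k(2)[OF that] by (intro mult_right_mono) auto
    then show "norm (indicator S t *\<^sub>R (k t * f t)) \<le> norm (K * (indicator S t *\<^sub>R f t))"
      by (auto simp: indicator_def abs_mult)
  qed
qed

lemma set_integrable_wed_density_mult:
  fixes f :: "real \<Rightarrow> real"
  assumes f: "set_integrable lebesgue {0..h} f" and \<epsilon>: "\<epsilon> > 0"
  shows "set_integrable lebesgue {0..h} (\<lambda>t. wed_density \<epsilon> t * f t)"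
proof (rule set_integrable_bounded_mult[OF f wed_density_measurable])
  fix t :: real assume "t \<in> {0..h}"
  then have "exp (- t / \<epsilon>) \<le> 1" using \<epsilon> by simp
  then show "\<bar>wed_density \<epsilon> t\<bar> \<le> 1 / \<epsilon>" using \<epsilon> by (simp add: wed_density_def divide_right_mono)
qed

text \<open>
  The second piece starts at time \<open>h\<close>, which multiplies the exponential weight by \<open>exp (- h / \<epsilon>)\<close>.
\<close>

lemma has_bochner_integral_wed_concat:
  fixes f1 f2 :: "real \<Rightarrow> real"
  assumes b: "f1 \<in> borel_measurable borel" "f2 \<in> borel_measurable borel" and \<epsilon>: "\<epsilon> > 0" and h: "h \<ge> 0"
    and f1: "set_integrable lebesgue {0..h} f1" and f2: "has_bochner_integral (wed_measure \<epsilon>) f2 x"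
  shows "has_bochner_integral (wed_measure \<epsilon>) (\<lambda>t. if t \<le> h then f1 t else f2 (t - h))
    ((LINT r:{0..h}|lebesgue. wed_density \<epsilon> r * f1 r) + exp (- h / \<epsilon>) * x)"
proof -
  have "has_bochner_integral lebesgue (\<lambda>r. indicator {0..h} r * (wed_density \<epsilon> r * f1 r)) (LINT r:{0..h}|lebesgue. wed_density \<epsilon> r * f1 r)"
    using set_integrable_wed_density_mult[OF f1 \<epsilon>]
    by (simp add: set_integrable_def set_lebesgue_integral_def has_bochner_integral_iff)
  from has_bochner_integral_Ioc_of_Icc[OF this]
  have 1: "has_bochner_integral lebesgue (\<lambda>r. indicator {0<..h} r * (wed_density \<epsilon> r * f1 r)) (LINT r:{0..h}|lebesgue. wed_density \<epsilon> r * f1 r)" .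
  have "has_bochner_integral lebesgue (\<lambda>t. indicator {0<..} t * (wed_density \<epsilon> t * f2 t)) x"
    using f2 by (simp add: has_bochner_integral_wed[OF b(2) \<epsilon>])
  from has_bochner_integral_mult_right[OF has_bochner_integral_shift[OF this, of h], of "exp (- h / \<epsilon>)"]
  have 2: "has_bochner_integral lebesgue (\<lambda>t. exp (- h / \<epsilon>) * (indicator {0<..} (t - h) * (wed_density \<epsilon> (t - h) * f2 (t - h)))) (exp (- h / \<epsilon>) * x)"
    by simp
  have e: "exp (- h / \<epsilon>) * wed_density \<epsilon> (t - h) = wed_density \<epsilon> t" for t
    unfolding wed_density_def by (simp add: diff_divide_distrib exp_add[symmetric] exp_diff field_simps exp_minus)
  have eq: "indicator {0<..h} t * (wed_density \<epsilon> t * f1 t) + exp (- h / \<epsilon>) * (indicator {0<..} (t - h) * (wed_density \<epsilon> (t - h) * f2 (t - h)))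
     = indicator {0<..} t * (wed_density \<epsilon> t * (if t \<le> h then f1 t else f2 (t - h)))" for t
    using h by (auto simp: indicator_def e[of t, symmetric])
  have "(\<lambda>t. if t \<le> h then f1 t else f2 (t - h)) \<in> borel_measurable borel"
    using b by measurable
  then show ?thesis
    using has_bochner_integral_add[OF 1 2] unfolding eq by (simp add: has_bochner_integral_wed[OF _ \<epsilon>])
qed

lemma AC2_of_has_speed:
  assumes u: "has_speed I u w" and sq: "\<And>a b. {a..b} \<subseteq> I \<Longrightarrow> set_integrable lebesgue {a..b} (\<lambda>x. (w x)\<^sup>2)"
    and ab: "{a..b} \<subseteq> I"
  shows "AC 2 {a..b} u"
proof (rule AC_IccI)
  let ?m = "\<lambda>x. indicator {a..b} x * w x"
  have "set_integrable lebesgue {a..b} w"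
  proof (cases "a \<le> b")
    case True
    then have "a \<in> I" "b \<in> I" using ab by auto
    then show ?thesis using u True unfolding has_speed_def by blast
  qed (simp add: set_integrable_def)
  then show "integrable lebesgue ?m" by (simp add: set_integrable_def)
  have "?m x ^ 2 = indicator {a..b} x *\<^sub>R (w x)\<^sup>2" for x by (auto simp: indicator_def)
  then show "integrable lebesgue (\<lambda>x. (?m x)\<^sup>2)" using sq[OF ab] by (simp add: set_integrable_def)
  fix s t assume st: "s \<in> {a..b}" "t \<in> {a..b}" "s \<le> t"
  have "dist (u s) (u t) \<le> (LINT r:{s..t}|lebesgue. w r)"
    using u st ab unfolding has_speed_def by blast
  also have "\<dots> = (LINT r:{s..t}|lebesgue. ?m r)"
    by (rule set_lebesgue_integral_cong) (use st in auto)
  finally show "dist (u s) (u t) \<le> (LINT r:{s..t}|lebesgue. ?m r)" .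
qed simp

context wed_problem begin

lemma wed_curvesI:
  assumes u: "has_speed {0..} u w" and sq: "\<And>a b. {a..b} \<subseteq> {0..} \<Longrightarrow> set_integrable lebesgue {a..b} (\<lambda>x. (w x)\<^sup>2)"
    and i: "integrable (wed_measure \<epsilon>) (\<lambda>t. (w t)\<^sup>2)"
  shows "u \<in> wed_curves \<epsilon> (u 0)"
proof -
  have "(\<integral>\<^sup>+ t. ennreal ((metric_deriv {0..} u t)\<^sup>2) \<partial>wed_measure \<epsilon>) \<le> (\<integral>\<^sup>+ t. ennreal (norm ((w t)\<^sup>2)) \<partial>wed_measure \<epsilon>)"
  proof (rule nn_integral_mono_AE, rule AE_wed)
    have "AE t in lebesgue. t \<in> {0..} \<longrightarrow> 0 \<le> metric_deriv {0..} u t \<and> metric_deriv {0..} u t \<le> w t"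
      by (rule metric_deriv_le_speed[OF _ u]) auto
    then show "AE t in lebesgue. t > 0 \<longrightarrow> ennreal ((metric_deriv {0..} u t)\<^sup>2) \<le> ennreal (norm ((w t)\<^sup>2))"
      by eventually_elim (auto intro!: ennreal_leI power_mono)
  qed
  also have "\<dots> < \<infinity>" using i by (simp add: integrable_iff_bounded)
  finally show ?thesis
    using AC2_of_has_speed[OF u sq] by (auto simp: wed_curves_def AC_loc_def)
qed

text \<open>
  The form in which competitors are inserted into the infimum: with a speed bound \<open>w\<close> and an integrable
  majorant \<open>f\<close> of the cost.
\<close>

lemma V_le_integral:
  assumes u: "has_speed {0..} u w" and sq: "\<And>a b. {a..b} \<subseteq> {0..} \<Longrightarrow> set_integrable lebesgue {a..b} (\<lambda>x. (w x)\<^sup>2)"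
    and i: "integrable (wed_measure \<epsilon>) (\<lambda>t. (w t)\<^sup>2)"
    and f: "has_bochner_integral (wed_measure \<epsilon>) f x"
    and le: "AE t in lebesgue. t > 0 \<longrightarrow> ereal (\<epsilon> / 2 * (w t)\<^sup>2) + \<phi> (u t) \<le> ereal (f t)"
  shows "V (u 0) \<le> ereal x"
proof -
  have "V (u 0) \<le> wed_functional \<phi> \<epsilon> u"
    unfolding value_fun_def by (rule INF_lower[OF wed_curvesI[OF u sq i]])
  also have "\<dots> \<le> ext_integral (wed_measure \<epsilon>) (\<lambda>t. ereal (f t))"
    unfolding wed_functional_def
  proof (rule ext_integral_mono_AE, rule AE_wed)
    have "AE t in lebesgue. t \<in> {0..} \<longrightarrow> 0 \<le> metric_deriv {0..} u t \<and> metric_deriv {0..} u t \<le> w t"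
      by (rule metric_deriv_le_speed[OF _ u]) auto
    then show "AE t in lebesgue. t > 0 \<longrightarrow> ereal (\<epsilon> / 2 * (metric_deriv {0..} u t)\<^sup>2) + \<phi> (u t) \<le> ereal (f t)"
      using le
    proof eventually_elim
      case (elim t)
      show ?case
      proof
        assume t: "t > 0"
        have "ereal (\<epsilon> / 2 * (metric_deriv {0..} u t)\<^sup>2) + \<phi> (u t) \<le> ereal (\<epsilon> / 2 * (w t)\<^sup>2) + \<phi> (u t)"
          using elim(1) t eps by (intro add_right_mono) (auto intro!: mult_left_mono power_mono divide_right_mono)
        also have "\<dots> \<le> ereal (f t)" using elim t by blast
        finally show "ereal (\<epsilon> / 2 * (metric_deriv {0..} u t)\<^sup>2) + \<phi> (u t) \<le> ereal (f t)" .
      qed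
    qed
  qed
  also have "\<dots> = ereal x"
    using f by (simp add: ext_integral_real has_bochner_integral_iff)
  finally show ?thesis .
qed

lemma V_le_phi: "V x \<le> \<phi> x"
proof (cases "\<phi> x")
  case (real c)
  have "has_speed {0..} (\<lambda>_. x) (\<lambda>_. 0)" by (auto simp: has_speed_def set_integrable_def set_lebesgue_integral_def)
  from V_le_integral[OF this _ _ wed_measure_total[OF eps, of c]]
  show ?thesis using real by (auto simp: set_integrable_def)
qed (use phi_not_MInf in auto)

lemma V_lower: "ereal (- Q x) \<le> V x"
  unfolding value_fun_def by (rule INF_greatest) (rule wed_functional_facts(1))

lemma V_not_MInf: "V x \<noteq> - \<infinity>"
  using V_lower[of x] by auto

text \<open>
  The competitor follows \<open>u\<close> up to time \<open>h\<close> and then an almost optimal curve that starts at \<open>u h\<close>.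
\<close>

lemma dynamic_programming:
  assumes h: "h \<ge> 0" and u: "has_speed {0..h} u m"
    and m2: "set_integrable lebesgue {0..h} (\<lambda>t. (m t)\<^sup>2)"
    and p: "p \<in> borel_measurable borel" "set_integrable lebesgue {0..h} p"
    and ae: "AE t in lebesgue. t \<in> {0..h} \<longrightarrow> \<phi> (u t) = ereal (p t)"
  shows "V (u 0) \<le> ereal (LINT r:{0..h}|lebesgue. ((m r)\<^sup>2 / 2 + p r / \<epsilon>) * exp (- r / \<epsilon>)) + ereal (exp (- h / \<epsilon>)) * V (u h)"
    (is "_ \<le> ereal ?c + ereal ?e * _")
proof (cases "V (u h)")
  case PInf
  then show ?thesis by simp
next
  case MInf
  then show ?thesis using V_not_MInf by simp
next
  case (real y)
  have "V (u 0) \<le> ereal (?c + ?e * y) + ereal \<delta>" if \<delta>: "\<delta> > 0" for \<delta>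
  proof -
    have "V (u h) < ereal (y + \<delta>)" using real \<delta> by simp
    then obtain v where v: "v \<in> wed_curves \<epsilon> (u h)" "wed_functional \<phi> \<epsilon> v < ereal (y + \<delta>)"
      unfolding value_fun_def INF_less_iff by blast
    obtain w where w: "has_speed {0..} v w" "AE t in lebesgue. t > 0 \<longrightarrow> metric_deriv {0..} v t = w t"
      "\<forall>a b. {a..b} \<subseteq> {0..} \<longrightarrow> set_integrable lebesgue {a..b} (\<lambda>x. (w x)\<^sup>2)"
      "integrable (wed_measure \<epsilon>) (\<lambda>t. (w t)\<^sup>2)"
      by (rule wed_curves_speed[OF v(1)]) (rule that)
    have "wed_functional \<phi> \<epsilon> v < \<infinity>" using v(2) by auto
    from wed_functional_facts(2)[OF v(1) this] obtain f where f: "f \<in> borel_measurable borel" "integrable (wed_measure \<epsilon>) f"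
       "wed_functional \<phi> \<epsilon> v = ereal (\<integral>t. f t \<partial>wed_measure \<epsilon>)"
       "AE t in lebesgue. t > 0 \<longrightarrow> ereal (\<epsilon> / 2 * (metric_deriv {0..} v t)\<^sup>2) + \<phi> (v t) = ereal (f t)"
      by blast
    have v0: "v 0 = u h" using v(1) by (simp add: wed_curves_def)
    let ?z = "\<lambda>r. if r \<le> h then u r else v (r - h)"
    let ?w = "\<lambda>r. if r \<le> h then m r else w (r - h)"
    let ?f1 = "\<lambda>r. \<epsilon> / 2 * (m r)\<^sup>2 + p r"
    have z: "has_speed {0..} ?z ?w" by (rule has_speed_concat[OF u w(1) v0 h])
    have mb: "m \<in> borel_measurable borel" "w \<in> borel_measurable borel" using u w by (auto simp: has_speed_def)
    have w2: "(\<lambda>r. (?w r)\<^sup>2) = (\<lambda>r. if r \<le> h then (m r)\<^sup>2 else (w (r - h))\<^sup>2)" by auto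
    have sq: "set_integrable lebesgue {a..b} (\<lambda>r. (?w r)\<^sup>2)" if ab: "{a..b} \<subseteq> {0..}" for a b
    proof (cases "a \<le> b")
      case True
      have "set_integrable lebesgue {0..b + h} (\<lambda>r. (?w r)\<^sup>2)"
        unfolding w2 using h True ab w(3) by (intro set_integral_concat(1) m2) auto
      then show ?thesis by (rule set_integrable_subset) (use True ab h in auto)
    qed (simp add: set_integrable_def)
    have zi: "integrable (wed_measure \<epsilon>) (\<lambda>r. (?w r)\<^sup>2)"
      unfolding w2 using has_bochner_integral_wed_concat[OF _ _ eps h m2 has_bochner_integral_integrable[OF w(4)]] mb
      by (auto simp: has_bochner_integral_iff)
    have f1: "set_integrable lebesgue {0..h} ?f1"
      using m2 p(2) by (intro set_integral_add set_integrable_mult_right) auto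
    have F: "has_bochner_integral (wed_measure \<epsilon>) (\<lambda>t. if t \<le> h then ?f1 t else f (t - h))
       ((LINT r:{0..h}|lebesgue. wed_density \<epsilon> r * ?f1 r) + ?e * (\<integral>t. f t \<partial>wed_measure \<epsilon>))"
      using mb p f by (intro has_bochner_integral_wed_concat eps h f1 has_bochner_integral_integrable) measurable
    have "V (?z 0) \<le> ereal ((LINT r:{0..h}|lebesgue. wed_density \<epsilon> r * ?f1 r) + ?e * (\<integral>t. f t \<partial>wed_measure \<epsilon>))"
    proof (rule V_le_integral[OF z sq zi F])
      have "AE t in lebesgue. t > 0 \<longrightarrow> ereal (\<epsilon> / 2 * (w t)\<^sup>2) + \<phi> (v t) = ereal (f t)"
        using f(4) w(2) by eventually_elim simp
      from AE_lebesgue_real_affine[OF this, of 1 "- h"]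
      have "AE t in lebesgue. t - h > 0 \<longrightarrow> ereal (\<epsilon> / 2 * (w (t - h))\<^sup>2) + \<phi> (v (t - h)) = ereal (f (t - h))"
        by simp
      then show "AE t in lebesgue. t > 0 \<longrightarrow> ereal (\<epsilon> / 2 * (?w t)\<^sup>2) + \<phi> (?z t) \<le> ereal (if t \<le> h then ?f1 t else f (t - h))"
        using ae by eventually_elim auto
    qed
    also have "?z 0 = u 0" using h by simp
    also have "(LINT r:{0..h}|lebesgue. wed_density \<epsilon> r * ?f1 r) = ?c"
      by (rule set_lebesgue_integral_cong) (use eps in \<open>auto simp: wed_density_def field_simps\<close>)
    finally have "V (u 0) \<le> ereal (?c + ?e * (\<integral>t. f t \<partial>wed_measure \<epsilon>))" .
    also have "?c + ?e * (\<integral>t. f t \<partial>wed_measure \<epsilon>) \<le> ?c + ?e * (y + \<delta>)"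
      using v(2) f(3) by (intro add_left_mono mult_left_mono) auto
    also have "\<dots> \<le> (?c + ?e * y) + \<delta>"
    proof -
      \<comment> \<open>The error made in the choice of \<open>v\<close> is only discounted.\<close>
      have "?e * \<delta> \<le> 1 * \<delta>" using h eps \<delta> by (intro mult_right_mono) auto
      then show ?thesis by (simp add: algebra_simps)
    qed
    finally show ?thesis by simp
  qed
  then have "V (u 0) \<le> ereal (?c + ?e * y)"
    by (rule ereal_le_epsilon2)
  then show ?thesis using real by simp
qed

end

lemma has_speed_shift:
  assumes u: "has_speed {a..b} u m"
  shows "has_speed {a - c..b - c} (\<lambda>r. u (r + c)) (\<lambda>r. m (r + c))"
  unfolding has_speed_def
proof (intro conjI ballI allI impI)
  have "m \<in> borel_measurable borel" using u by (simp add: has_speed_def)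
  then show "(\<lambda>r. m (r + c)) \<in> borel_measurable borel" by measurable
  show "0 \<le> m (x + c)" for x using u by (simp add: has_speed_def)
  fix s t assume st: "s \<in> {a - c..b - c}" "t \<in> {a - c..b - c}" "s \<le> t"
  have m: "set_integrable lebesgue {s + c..t + c} m" "dist (u (s + c)) (u (t + c)) \<le> (LINT r:{s + c..t + c}|lebesgue. m r)"
    using u st by (auto simp: has_speed_def)
  show "set_integrable lebesgue {s..t} (\<lambda>r. m (r + c))" "dist (u (s + c)) (u (t + c)) \<le> (LINT r:{s..t}|lebesgue. m (r + c))"
    using set_integral_shift[OF m(1), of "- c"] m(2) by simp_all
qed

lemma set_integrable_reflect:
  fixes f :: "real \<Rightarrow> real"
  assumes "set_integrable lebesgue {a..b} f"
  shows "set_integrable lebesgue {- b..- a} (\<lambda>r. f (- r))"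
proof -
  have "integrable lebesgue (\<lambda>r. indicator {a..b} (- r) *\<^sub>R f (- r))"
    using integrable_lebesgue_reflect[OF assms[unfolded set_integrable_def]] .
  moreover have "indicator {a..b} (- r) = (indicator {- b..- a} r :: real)" for r
    by (auto simp: indicator_def)
  ultimately show ?thesis by (simp add: set_integrable_def)
qed

lemma has_speed_reflect:
  assumes u: "has_speed {a..b} u m"
  shows "has_speed {- b..- a} (\<lambda>r. u (- r)) (\<lambda>r. m (- r))"
  unfolding has_speed_def
proof (intro conjI ballI allI impI)
  have "m \<in> borel_measurable borel" using u by (simp add: has_speed_def)
  then show "(\<lambda>r. m (- r)) \<in> borel_measurable borel" by measurable
  show "0 \<le> m (- x)" for x using u by (simp add: has_speed_def)
  fix s t assume st: "s \<in> {- b..- a}" "t \<in> {- b..- a}" "s \<le> t"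
  have m: "set_integrable lebesgue {- t..- s} m" "dist (u (- t)) (u (- s)) \<le> (LINT r:{- t..- s}|lebesgue. m r)"
    using u st by (auto simp: has_speed_def)
  show "set_integrable lebesgue {s..t} (\<lambda>r. m (- r))" using set_integrable_reflect[OF m(1)] by simp
  show "dist (u (- s)) (u (- t)) \<le> (LINT r:{s..t}|lebesgue. m (- r))"
    using m(2) set_integral_reflect_Icc[of s t m] by (simp add: dist_commute)
qed

context wed_problem begin

lemma dp_forward:
  assumes ab: "a \<le> b" and u: "has_speed {a..b} u m"
    and m2: "set_integrable lebesgue {a..b} (\<lambda>t. (m t)\<^sup>2)"
    and p: "p \<in> borel_measurable borel" "set_integrable lebesgue {a..b} p"
    and ae: "AE t in lebesgue. t \<in> {a..b} \<longrightarrow> \<phi> (u t) = ereal (p t)"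
  shows "V (u a) \<le> ereal (LINT r:{a..b}|lebesgue. ((m r)\<^sup>2 / 2 + p r / \<epsilon>) * exp (- (r - a) / \<epsilon>))
    + ereal (exp (- (b - a) / \<epsilon>)) * V (u b)"
proof -
  have m2s: "set_integrable lebesgue {0..b - a} (\<lambda>t. (m (t + a))\<^sup>2)"
    using set_integral_shift(1)[OF m2, of "- a"] by simp
  have ps: "set_integrable lebesgue {0..b - a} (\<lambda>t. p (t + a))"
    using set_integral_shift(1)[OF p(2), of "- a"] by simp
  have us: "has_speed {0..b - a} (\<lambda>r. u (r + a)) (\<lambda>r. m (r + a))"
    using has_speed_shift[OF u, of a] by simp
  have aes: "AE t in lebesgue. t \<in> {0..b - a} \<longrightarrow> \<phi> (u (t + a)) = ereal (p (t + a))"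
  proof -
    have "AE t in lebesgue. a + 1 * t \<in> {a..b} \<longrightarrow> \<phi> (u (a + 1 * t)) = ereal (p (a + 1 * t))"
      by (rule AE_lebesgue_real_affine[OF ae]) simp
    then show ?thesis by eventually_elim (auto simp: add.commute)
  qed
  let ?f = "\<lambda>r. ((m r)\<^sup>2 / 2 + p r / \<epsilon>) * exp (- (r - a) / \<epsilon>)"
  have g: "set_integrable lebesgue {a..b} (\<lambda>r. (m r)\<^sup>2 / 2 + p r / \<epsilon>)"
    using m2 p(2) by (intro set_integral_add(1) set_integrable_divide) auto
  have "set_integrable lebesgue {a..b} (\<lambda>r. exp (- (r - a) / \<epsilon>) * ((m r)\<^sup>2 / 2 + p r / \<epsilon>))"
    by (rule set_integrable_bounded_mult[OF g, of _ 1]) (use eps in \<open>auto simp: field_simps\<close>)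
  then have "set_integrable lebesgue {a..b} ?f" by (simp only: mult.commute)
  from set_integral_shift(2)[OF this, of "- a"]
  have "(LINT r:{0..b - a}|lebesgue. ((m (r + a))\<^sup>2 / 2 + p (r + a) / \<epsilon>) * exp (- r / \<epsilon>)) = (LINT r:{a..b}|lebesgue. ?f r)"
    by simp
  moreover have "(\<lambda>t. p (t + a)) \<in> borel_measurable borel" using p(1) by measurable
  ultimately show ?thesis
    using dynamic_programming[OF _ us m2s _ ps aes] ab by simp
qed

text \<open>
  This is \<open>dp_forward\<close> for the reversed curve: the functional only sees the speed and the position, so
  \<open>u\<close> may be traversed in both directions at the same cost.
\<close>

lemma dp_backward:
  assumes ab: "a \<le> b" and u: "has_speed {a..b} u m"
    and m2: "set_integrable lebesgue {a..b} (\<lambda>t. (m t)\<^sup>2)"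
    and p: "p \<in> borel_measurable borel" "set_integrable lebesgue {a..b} p"
    and ae: "AE t in lebesgue. t \<in> {a..b} \<longrightarrow> \<phi> (u t) = ereal (p t)"
  shows "V (u b) \<le> ereal (LINT r:{a..b}|lebesgue. ((m r)\<^sup>2 / 2 + p r / \<epsilon>) * exp (- (b - r) / \<epsilon>))
    + ereal (exp (- (b - a) / \<epsilon>)) * V (u a)"
proof -
  have aes: "AE t in lebesgue. t \<in> {- b..- a} \<longrightarrow> \<phi> (u (- t)) = ereal (p (- t))"
  proof -
    have "AE t in lebesgue. 0 + - 1 * t \<in> {a..b} \<longrightarrow> \<phi> (u (0 + - 1 * t)) = ereal (p (0 + - 1 * t))"
      by (rule AE_lebesgue_real_affine[OF ae]) simp
    then show ?thesis by eventually_elim auto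
  qed
  have pb: "(\<lambda>t. p (- t)) \<in> borel_measurable borel" using p(1) by measurable
  have "(LINT r:{- b..- a}|lebesgue. ((m (- r))\<^sup>2 / 2 + p (- r) / \<epsilon>) * exp (- (r + b) / \<epsilon>))
     = (LINT r:{a..b}|lebesgue. ((m r)\<^sup>2 / 2 + p r / \<epsilon>) * exp (- (b - r) / \<epsilon>))"
    using set_integral_reflect_Icc[of "- b" "- a" "\<lambda>r. ((m r)\<^sup>2 / 2 + p r / \<epsilon>) * exp (- (b - r) / \<epsilon>)"] by (simp add: add.commute)
  then show ?thesis
    using dp_forward[OF _ has_speed_reflect[OF u] set_integrable_reflect[OF m2] pb set_integrable_reflect[OF p(2)] aes] ab
    by simp
qed

text \<open>
  The curve is compact, hence bounded, so that \<open>\<phi> \<circ> u\<close> is bounded below by coercivity; only its positive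
  part needs to be controlled.
\<close>

lemma phi_along_curve:
  assumes T: "a \<le> b" and u: "has_speed {a..b} u m"
    and phi: "(\<integral>\<^sup>+t\<in>{a..b}. e2ennreal (\<phi> (u t)) \<partial>lebesgue) < \<infinity>"
  obtains p where "p \<in> borel_measurable borel" "set_integrable lebesgue {a..b} p"
    "AE t in lebesgue. t \<in> {a..b} \<longrightarrow> \<phi> (u t) = ereal (p t)"
proof -
  have uc: "continuous_on {a..b} u" by (rule has_speed_continuous_Icc[OF u])
  define F where "F t = (if t \<in> {a..b} then \<phi> (u t) else \<infinity>)" for t
  have Fb: "F \<in> borel_measurable borel"
    unfolding F_def by (rule phi_comp_measurable[OF _ uc]) simp
  define p where "p t = real_of_ereal (F t)" for t
  have pb: "p \<in> borel_measurable borel" unfolding p_def using Fb by measurable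
  have "compact (u ` {a..b})" using uc by (intro compact_continuous_image) auto
  then have "bounded (u ` {a..b})" by (rule compact_imp_bounded)
  then obtain e where e: "\<And>t. t \<in> {a..b} \<Longrightarrow> dist (u a) (u t) \<le> e"
    unfolding bounded_any_center[where a="u a"] by blast
  define K where "K = B * e\<^sup>2 + Q (u a)"
  have lower: "ereal (- K) \<le> \<phi> (u t)" if "t \<in> {a..b}" for t
  proof -
    have "B * (dist (u t) (u a))\<^sup>2 \<le> B * e\<^sup>2"
      using e[OF that] AB_nonneg by (intro mult_left_mono power_mono) (auto simp: dist_commute)
    then have "ereal (- K) \<le> ereal (- B * (dist (u t) (u a))\<^sup>2 - Q (u a))" by (simp add: K_def)
    also have "\<dots> \<le> \<phi> (u t)" by (rule phi_lower)
    finally show ?thesis .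
  qed
  have Fl: "F \<in> borel_measurable lebesgue" using Fb by (intro measurable_completion) simp
  have nnF: "(\<integral>\<^sup>+t. e2ennreal (F t) * indicator {a..b} t \<partial>lebesgue) < \<infinity>"
  proof -
    have "(\<integral>\<^sup>+t. e2ennreal (F t) * indicator {a..b} t \<partial>lebesgue) = (\<integral>\<^sup>+t\<in>{a..b}. e2ennreal (\<phi> (u t)) \<partial>lebesgue)"
      by (intro nn_integral_cong) (auto simp: F_def indicator_def)
    then show ?thesis using phi by simp
  qed
  have "AE t in lebesgue. e2ennreal (F t) * indicator {a..b} t \<noteq> \<infinity>"
    using nnF Fl by (intro nn_integral_PInf_AE borel_measurable_times_ennreal) (auto intro: measurable_compose[OF _ measurable_e2ennreal] borel_measurable_indicator)
  then have ae: "AE t in lebesgue. t \<in> {a..b} \<longrightarrow> \<phi> (u t) = ereal (p t)"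
  proof eventually_elim
    case (elim t)
    show ?case
    proof
      assume t: "t \<in> {a..b}"
      then have "\<phi> (u t) \<noteq> \<infinity>" using elim by (auto simp: F_def)
      then show "\<phi> (u t) = ereal (p t)" using phi_not_MInf[of "u t"] t by (cases "\<phi> (u t)") (auto simp: p_def F_def)
    qed
  qed
  have "integrable lebesgue (\<lambda>t. indicator {a..b} t *\<^sub>R p t)"
    unfolding real_integrable_def
  proof (intro conjI)
    show "(\<lambda>t. indicator {a..b} t *\<^sub>R p t) \<in> borel_measurable lebesgue"
      using pb by (intro measurable_completion) measurable
    have "(\<integral>\<^sup>+t. ennreal (indicator {a..b} t *\<^sub>R p t) \<partial>lebesgue) \<le> (\<integral>\<^sup>+t. e2ennreal (F t) * indicator {a..b} t \<partial>lebesgue)"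
    proof (intro nn_integral_mono_AE)
      show "AE t in lebesgue. ennreal (indicator {a..b} t *\<^sub>R p t) \<le> e2ennreal (F t) * indicator {a..b} t"
        using ae by eventually_elim (auto simp: F_def indicator_def e2ennreal_ereal)
    qed
    then show "(\<integral>\<^sup>+t. ennreal (indicator {a..b} t *\<^sub>R p t) \<partial>lebesgue) \<noteq> \<infinity>" using nnF by auto
    have "(\<integral>\<^sup>+t. ennreal (- (indicator {a..b} t *\<^sub>R p t)) \<partial>lebesgue) \<le> (\<integral>\<^sup>+t. ennreal K * indicator {a..b} t \<partial>lebesgue)"
    proof (intro nn_integral_mono_AE)
      show "AE t in lebesgue. ennreal (- (indicator {a..b} t *\<^sub>R p t)) \<le> ennreal K * indicator {a..b} t"
        using ae
      proof eventually_elim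
        case (elim t)
        then show ?case using lower[of t] by (auto simp: indicator_def intro!: ennreal_leI)
      qed
    qed
    also have "\<dots> = ennreal K * emeasure lborel {a..b}"
      by (subst nn_integral_cmult_indicator) auto
    also have "\<dots> < \<infinity>" by (simp add: emeasure_lborel_Icc_eq ennreal_mult_less_top)
    finally show "(\<integral>\<^sup>+t. ennreal (- (indicator {a..b} t *\<^sub>R p t)) \<partial>lebesgue) \<noteq> \<infinity>" by auto
  qed
  then show thesis using that pb ae by (simp add: set_integrable_def)
qed

end

section \<open>The value function along curves of finite energy\<close>

lemma deriv_nonneg_of_mono_Icc:
  fixes F :: "real \<Rightarrow> real"
  assumes "\<And>s t. a \<le> s \<Longrightarrow> s \<le> t \<Longrightarrow> t \<le> b \<Longrightarrow> F s \<le> F t" "(F has_real_derivative D) (at t)" "t \<in> {a<..<b}"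
  shows "D \<ge> 0"
proof (rule mono_on_imp_deriv_nonneg[OF _ assms(2)])
  show "mono_on {a..b} F" using assms(1) by (auto intro!: mono_onI)
  show "t \<in> interior {a..b}" using assms(3) by simp
qed

lemma indicator_integral:
  fixes g :: "real \<Rightarrow> real"
  assumes "set_integrable lebesgue {a..b} g" "a \<le> s" "s \<le> t" "t \<le> b"
  shows "integrable lebesgue (\<lambda>r. indicator {a..b} r * g r)"
    "(LINT r:{s..t}|lebesgue. g r) = (LINT r:{..t}|lebesgue. indicator {a..b} r * g r) - (LINT r:{..s}|lebesgue. indicator {a..b} r * g r)"
proof -
  show i: "integrable lebesgue (\<lambda>r. indicator {a..b} r * g r)" using assms(1) by (simp add: set_integrable_def)
  have "(LINT r:{s..t}|lebesgue. g r) = (LINT r:{s..t}|lebesgue. indicator {a..b} r * g r)"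
    by (rule set_lebesgue_integral_cong) (use assms in auto)
  then show "(LINT r:{s..t}|lebesgue. g r) = (LINT r:{..t}|lebesgue. indicator {a..b} r * g r) - (LINT r:{..s}|lebesgue. indicator {a..b} r * g r)"
    using set_integral_Iic_diff[OF i assms(3)] by simp
qed

text \<open>
  Local form of \<open>ac_real_representation\<close>, together with the identification of the density as the
  derivative.
\<close>

lemma ac_real_Icc:
  fixes f :: "real \<Rightarrow> real"
  assumes T: "a \<le> b" and m: "integrable lebesgue m" "\<And>x. m x \<ge> 0"
    and f: "\<And>s t. a \<le> s \<Longrightarrow> s \<le> t \<Longrightarrow> t \<le> b \<Longrightarrow> \<bar>f t - f s\<bar> \<le> (LINT r:{s..t}|lebesgue. m r)"
  obtains g where "g \<in> borel_measurable borel" "integrable lebesgue g"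
    "\<And>s t. a \<le> s \<Longrightarrow> s \<le> t \<Longrightarrow> t \<le> b \<Longrightarrow> f t - f s = (LINT r:{s..t}|lebesgue. g r)"
    "AE t in lebesgue. t \<in> {a<..<b} \<longrightarrow> (f has_real_derivative g t) (at t)"
proof -
  define c where "c t = max a (min b t)" for t
  have "\<bar>f (c t) - f (c s)\<bar> \<le> (LINT r:{s..t}|lebesgue. m r)" if st: "s \<le> t" for s t
    using dist_clamp_le_set_integral[OF T m, of f, OF _ st] f
    by (simp add: dist_real_def abs_minus_commute c_def)
  then obtain g where g: "g \<in> borel_measurable borel" "integrable lebesgue g"
    "\<And>s t. s \<le> t \<Longrightarrow> f (c t) - f (c s) = (LINT r:{s..t}|lebesgue. g r)"
    by (rule ac_real_representation[OF m, of "\<lambda>t. f (c t)"]) (assumption | rule that)+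
  have fg: "f t - f s = (LINT r:{s..t}|lebesgue. g r)" if "a \<le> s" "s \<le> t" "t \<le> b" for s t
  proof -
    have "c s = s" "c t = t" using that by (auto simp: c_def)
    then show ?thesis using g(3)[OF that(2)] by simp
  qed
  show thesis
  proof (rule that[OF g(1,2) fg])
    show "AE t in lebesgue. t \<in> {a<..<b} \<longrightarrow> (f has_real_derivative g t) (at t)"
      using lebesgue_differentiation[OF g(2)]
    proof (eventually_elim, intro impI)
      fix t assume D: "((\<lambda>x. LINT r:{..x}|lebesgue. g r) has_real_derivative g t) (at t)" and t: "t \<in> {a<..<b}"
      let ?P = "\<lambda>x. LINT r:{..x}|lebesgue. g r"
      have "((\<lambda>x. f a - ?P a + ?P x) has_real_derivative g t) (at t)"
        using D by (auto intro!: derivative_eq_intros)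
      then show "(f has_real_derivative g t) (at t)"
      proof (rule DERIV_cong_ev[OF refl _ refl, THEN iffD1, rotated])
        have "\<forall>\<^sub>F x in nhds t. x \<in> {a<..<b}"
          using t by (intro eventually_nhds_in_open) auto
        then show "\<forall>\<^sub>F x in nhds t. f a - ?P a + ?P x = f x"
        proof eventually_elim
          case (elim x)
          then show ?case
            using fg[of a x] set_integral_Iic_diff[OF g(2), of a x] by simp
        qed
      qed
    qed
  qed auto
qed

text \<open>
  Up to a discount factor and the integral of \<open>\<bar>g\<bar>\<close>, \<open>f s\<close> is bounded by \<open>f t\<close> and \<open>f t\<close> by \<open>f s\<close>. With
  \<open>s = 0\<close> this shows that \<open>f\<close> is bounded, say \<open>\<bar>f\<bar> \<le> C\<close>. As the discount factor differs from 1 by at most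
  \<open>(t - s) / \<epsilon>\<close>, the increments of \<open>f\<close> are then bounded by \<open>\<integral> (\<bar>g\<bar> + C / \<epsilon>)\<close>. Once \<open>f\<close> is known to be absolutely
  continuous, each of the two inequalities yields one half of the bound for its derivative.
\<close>

lemma ac_of_discounted_increments:
  fixes f g :: "real \<Rightarrow> real"
  assumes T: "0 < T" and eps: "\<epsilon> > 0" and gi: "set_integrable lebesgue {0..T} g"
    and fw: "\<And>s t. 0 \<le> s \<Longrightarrow> s \<le> t \<Longrightarrow> t \<le> T \<Longrightarrow>
      f s \<le> (LINT r:{s..t}|lebesgue. g r * exp (- (r - s) / \<epsilon>)) + exp (- (t - s) / \<epsilon>) * f t"
    and bw: "\<And>s t. 0 \<le> s \<Longrightarrow> s \<le> t \<Longrightarrow> t \<le> T \<Longrightarrow>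
      f t \<le> (LINT r:{s..t}|lebesgue. g r * exp (- (t - r) / \<epsilon>)) + exp (- (t - s) / \<epsilon>) * f s"
  obtains d where "d \<in> borel_measurable borel" "integrable lebesgue d"
    "\<And>s t. 0 \<le> s \<Longrightarrow> s \<le> t \<Longrightarrow> t \<le> T \<Longrightarrow> f t - f s = (LINT r:{s..t}|lebesgue. d r)"
    "AE t in lebesgue. t \<in> {0<..<T} \<longrightarrow> (f has_real_derivative d t) (at t)"
    "AE t in lebesgue. t \<in> {0<..<T} \<longrightarrow> \<bar>d t\<bar> \<le> g t - f t / \<epsilon>"
proof -
  let ?G = "LINT r:{0..T}|lebesgue. \<bar>g r\<bar>"
  have gst: "set_integrable lebesgue {s..t} g" if "0 \<le> s" "t \<le> T" for s t
    by (rule set_integrable_subset[OF gi]) (use that in auto)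
  have discount: "(LINT r:{s..t}|lebesgue. g r * k r) \<le> (LINT r:{s..t}|lebesgue. \<bar>g r\<bar>)"
    if st: "0 \<le> s" "t \<le> T" and k: "k \<in> borel_measurable borel" "\<And>r. r \<in> {s..t} \<Longrightarrow> 0 \<le> k r \<and> k r \<le> 1" for s t k
  proof -
    have "set_integrable lebesgue {s..t} (\<lambda>r. k r * g r)"
      by (rule set_integrable_bounded_mult[OF gst[OF st] k(1), of 1]) (use k(2) in auto)
    then have "integrable lebesgue (\<lambda>r. indicator {s..t} r *\<^sub>R (g r * k r))"
      by (simp add: set_integrable_def mult.commute)
    then show ?thesis
      using set_integrable_abs[OF gst[OF st]] unfolding set_integrable_def set_lebesgue_integral_def
    proof (rule integral_mono)
      fix r
      have "g r * k r \<le> \<bar>g r\<bar>" if "r \<in> {s..t}"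
        using mult_mono[of "g r" "\<bar>g r\<bar>" "k r" 1] k(2)[OF that] by auto
      then show "indicator {s..t} r *\<^sub>R (g r * k r) \<le> indicator {s..t} r *\<^sub>R \<bar>g r\<bar>"
        by (simp add: indicator_def)
    qed
  qed
  have Ifw: "(LINT r:{s..t}|lebesgue. g r * exp (- (r - s) / \<epsilon>)) \<le> (LINT r:{s..t}|lebesgue. \<bar>g r\<bar>)"
    and Ibw: "(LINT r:{s..t}|lebesgue. g r * exp (- (t - r) / \<epsilon>)) \<le> (LINT r:{s..t}|lebesgue. \<bar>g r\<bar>)"
    if "0 \<le> s" "t \<le> T" for s t
    by (rule discount[OF that]; use eps in \<open>auto simp: divide_nonpos_pos\<close>)+
  have Gle: "(LINT r:{0..t}|lebesgue. \<bar>g r\<bar>) \<le> ?G" if t: "t \<le> T" for t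
    unfolding set_lebesgue_integral_def
    by (rule integral_mono)
       (use set_integrable_abs[OF gst, of 0] t in \<open>auto simp: set_integrable_def indicator_def\<close>)
  have G0: "?G \<ge> 0" unfolding set_lebesgue_integral_def by (intro integral_nonneg_AE) (auto simp: indicator_def)
  define C where "C = exp (T / \<epsilon>) * (?G + \<bar>f 0\<bar>)"
  have C0: "C \<ge> 0" using G0 by (simp add: C_def)
  have C: "\<bar>f t\<bar> \<le> C" if t: "t \<in> {0..T}" for t
  proof -
    have e1: "exp (- t / \<epsilon>) \<le> 1" "1 \<le> exp (T / \<epsilon>)" "exp (t / \<epsilon>) \<le> exp (T / \<epsilon>)"
      using t T eps by (auto simp: divide_right_mono)
    have "exp (- t / \<epsilon>) * f 0 \<le> exp (- t / \<epsilon>) * \<bar>f 0\<bar>" by (intro mult_left_mono) auto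
    also have "\<dots> \<le> 1 * \<bar>f 0\<bar>" using e1(1) by (intro mult_right_mono) auto
    finally have "exp (- t / \<epsilon>) * f 0 \<le> \<bar>f 0\<bar>" by simp
    then have "f t \<le> 1 * (?G + \<bar>f 0\<bar>)"
      using bw[of 0 t] Ibw[of 0 t] Gle[of t] t by auto
    also have "\<dots> \<le> C" unfolding C_def using e1(2) G0 by (intro mult_right_mono) auto
    finally have 1: "f t \<le> C" .
    have "- f t = exp (t / \<epsilon>) * (- (exp (- t / \<epsilon>) * f t))"
      by (simp add: mult.assoc[symmetric] exp_add[symmetric])
    also have "\<dots> \<le> exp (t / \<epsilon>) * (?G + \<bar>f 0\<bar>)"
      using fw[of 0 t] Ifw[of 0 t] Gle[of t] t by (intro mult_left_mono) auto
    also have "\<dots> \<le> C" unfolding C_def using e1(3) G0 by (intro mult_right_mono) auto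
    finally show ?thesis using 1 by linarith
  qed
  define M where "M r = indicator {0..T} r * (\<bar>g r\<bar> + C / \<epsilon>)" for r
  have Mi: "integrable lebesgue M"
  proof -
    have "set_integrable lebesgue {0..T} (\<lambda>r. \<bar>g r\<bar> + C / \<epsilon>)"
      using gi by (intro set_integral_add(1) set_integrable_abs) (auto simp: set_integrable_def emeasure_lborel_Icc_eq)
    then show ?thesis by (simp add: M_def[abs_def] set_integrable_def)
  qed
  have M0: "M x \<ge> 0" for x using C0 eps by (simp add: M_def)
  have fM: "\<bar>f t - f s\<bar> \<le> (LINT r:{s..t}|lebesgue. M r)" if st: "0 \<le> s" "s \<le> t" "t \<le> T" for s t
  proof -
    have "(LINT r:{s..t}|lebesgue. M r) = (LINT r:{s..t}|lebesgue. \<bar>g r\<bar> + C / \<epsilon>)"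
      by (rule set_lebesgue_integral_cong) (use st in \<open>auto simp: M_def\<close>)
    also have "\<dots> = (LINT r:{s..t}|lebesgue. \<bar>g r\<bar>) + C / \<epsilon> * (t - s)"
      using set_integrable_abs[OF gst[OF st(1,3)]] st by (subst set_integral_add(2)) (auto simp: set_integrable_def emeasure_lborel_Icc_eq set_lebesgue_integral_def)
    finally have M_eq: "(LINT r:{s..t}|lebesgue. M r) = (LINT r:{s..t}|lebesgue. \<bar>g r\<bar>) + C / \<epsilon> * (t - s)" .
    have e: "(exp (- (t - s) / \<epsilon>) - 1) * f r \<le> C / \<epsilon> * (t - s)" if r: "r \<in> {0..T}" for r
    proof -
      have "1 + - (t - s) / \<epsilon> \<le> exp (- (t - s) / \<epsilon>)" by (rule exp_ge_add_one_self)
      then have 1: "1 - exp (- (t - s) / \<epsilon>) \<le> (t - s) / \<epsilon>" by (simp only: minus_divide_left[symmetric])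
      have 2: "1 - exp (- (t - s) / \<epsilon>) \<ge> 0" using st eps by (simp add: divide_nonpos_pos)
      have "(exp (- (t - s) / \<epsilon>) - 1) * f r = (1 - exp (- (t - s) / \<epsilon>)) * (- f r)" by (simp add: algebra_simps)
      also have "\<dots> \<le> (1 - exp (- (t - s) / \<epsilon>)) * C"
        using C[OF r] 2 by (intro mult_left_mono) auto
      also have "\<dots> \<le> (t - s) / \<epsilon> * C" using 1 C0 by (intro mult_right_mono)
      finally show ?thesis by (simp add: field_simps)
    qed
    have "f s - f t \<le> (LINT r:{s..t}|lebesgue. \<bar>g r\<bar>) + (exp (- (t - s) / \<epsilon>) - 1) * f t"
      using fw[OF st] Ifw[OF st(1,3)] by (simp add: algebra_simps)
    moreover have "f t - f s \<le> (LINT r:{s..t}|lebesgue. \<bar>g r\<bar>) + (exp (- (t - s) / \<epsilon>) - 1) * f s"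
      using bw[OF st] Ibw[OF st(1,3)] by (simp add: algebra_simps)
    ultimately show ?thesis
      using e[of s] e[of t] st unfolding M_eq abs_le_iff by auto
  qed
  obtain d where d: "d \<in> borel_measurable borel" "integrable lebesgue d"
    "\<And>s t. 0 \<le> s \<Longrightarrow> s \<le> t \<Longrightarrow> t \<le> T \<Longrightarrow> f t - f s = (LINT r:{s..t}|lebesgue. d r)"
    "AE t in lebesgue. t \<in> {0<..<T} \<longrightarrow> (f has_real_derivative d t) (at t)"
    by (rule ac_real_Icc[OF less_imp_le[OF T] Mi M0 fM]) (assumption | rule that)+
  have gE: "set_integrable lebesgue {0..T} (\<lambda>r. g r * exp (- r / \<epsilon>))"
    and gE': "set_integrable lebesgue {0..T} (\<lambda>r. g r * exp (r / \<epsilon>))"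
  proof -
    have "set_integrable lebesgue {0..T} (\<lambda>r. exp (- r / \<epsilon>) * g r)"
      by (rule set_integrable_bounded_mult[OF gi, of _ 1]) (use eps in auto)
    then show "set_integrable lebesgue {0..T} (\<lambda>r. g r * exp (- r / \<epsilon>))" by (simp only: mult.commute)
    have "set_integrable lebesgue {0..T} (\<lambda>r. exp (r / \<epsilon>) * g r)"
      by (rule set_integrable_bounded_mult[OF gi, of _ "exp (T / \<epsilon>)"]) (use eps in \<open>auto intro: divide_right_mono\<close>)
    then show "set_integrable lebesgue {0..T} (\<lambda>r. g r * exp (r / \<epsilon>))" by (simp only: mult.commute)
  qed
  define g1 where "g1 r = indicator {0..T} r * (g r * exp (- r / \<epsilon>))" for r
  define g2 where "g2 r = indicator {0..T} r * (g r * exp (r / \<epsilon>))" for r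
  define P1 where "P1 t = (LINT r:{..t}|lebesgue. g1 r)" for t
  define P2 where "P2 t = (LINT r:{..t}|lebesgue. g2 r)" for t
  have P1: "(LINT r:{s..t}|lebesgue. g r * exp (- r / \<epsilon>)) = P1 t - P1 s"
    and P2: "(LINT r:{s..t}|lebesgue. g r * exp (r / \<epsilon>)) = P2 t - P2 s" if st: "0 \<le> s" "s \<le> t" "t \<le> T" for s t
    unfolding P1_def P2_def g1_def g2_def
    using indicator_integral(2)[OF gE st] indicator_integral(2)[OF gE' st] by auto
  have g12: "integrable lebesgue g1" "integrable lebesgue g2"
    using gE gE' by (simp_all add: g1_def[abs_def] g2_def[abs_def] set_integrable_def)
  \<comment> \<open>Multiplied by \<open>exp (- s / \<epsilon>)\<close> and \<open>exp (t / \<epsilon>)\<close>, the two inequalities say that \<open>exp (- t / \<epsilon>) f + \<integral> exp (- r / \<epsilon>) g\<close>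
    and \<open>\<integral> exp (r / \<epsilon>) g - exp (t / \<epsilon>) f\<close> are nondecreasing.\<close>
  have mono1: "exp (- s / \<epsilon>) * f s + P1 s \<le> exp (- t / \<epsilon>) * f t + P1 t" if st: "0 \<le> s" "s \<le> t" "t \<le> T" for s t
  proof -
    have "(LINT r:{s..t}|lebesgue. g r * exp (- (r - s) / \<epsilon>)) = (LINT r:{s..t}|lebesgue. exp (s / \<epsilon>) * (g r * exp (- r / \<epsilon>)))"
      by (rule set_lebesgue_integral_cong) (auto simp: diff_divide_distrib exp_diff exp_minus field_simps)
    then have I: "(LINT r:{s..t}|lebesgue. g r * exp (- (r - s) / \<epsilon>)) = exp (s / \<epsilon>) * (P1 t - P1 s)"
      using P1[OF st] by simp
    have "exp (- s / \<epsilon>) * f s \<le> exp (- s / \<epsilon>) * (exp (s / \<epsilon>) * (P1 t - P1 s) + exp (- (t - s) / \<epsilon>) * f t)"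
      using fw[OF st] unfolding I by (intro mult_left_mono) auto
    also have "\<dots> = exp (- s / \<epsilon>) * exp (s / \<epsilon>) * (P1 t - P1 s) + exp (- s / \<epsilon>) * exp (- (t - s) / \<epsilon>) * f t"
      by (simp add: algebra_simps)
    also have "\<dots> = (P1 t - P1 s) + exp (- t / \<epsilon>) * f t"
      unfolding exp_add[symmetric] by (simp add: diff_divide_distrib)
    finally show ?thesis by simp
  qed
  have mono2: "P2 s - exp (s / \<epsilon>) * f s \<le> P2 t - exp (t / \<epsilon>) * f t" if st: "0 \<le> s" "s \<le> t" "t \<le> T" for s t
  proof -
    have "(LINT r:{s..t}|lebesgue. g r * exp (- (t - r) / \<epsilon>)) = (LINT r:{s..t}|lebesgue. exp (- t / \<epsilon>) * (g r * exp (r / \<epsilon>)))"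
      by (rule set_lebesgue_integral_cong) (auto simp: diff_divide_distrib exp_diff exp_minus field_simps)
    then have I: "(LINT r:{s..t}|lebesgue. g r * exp (- (t - r) / \<epsilon>)) = exp (- t / \<epsilon>) * (P2 t - P2 s)"
      using P2[OF st] by simp
    have "exp (t / \<epsilon>) * f t \<le> exp (t / \<epsilon>) * (exp (- t / \<epsilon>) * (P2 t - P2 s) + exp (- (t - s) / \<epsilon>) * f s)"
      using bw[OF st] unfolding I by (intro mult_left_mono) auto
    also have "\<dots> = exp (t / \<epsilon>) * exp (- t / \<epsilon>) * (P2 t - P2 s) + exp (t / \<epsilon>) * exp (- (t - s) / \<epsilon>) * f s"
      by (simp add: algebra_simps)
    also have "\<dots> = (P2 t - P2 s) + exp (s / \<epsilon>) * f s"
      unfolding exp_add[symmetric] by (simp add: diff_divide_distrib)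
    finally show ?thesis by simp
  qed
  have bound: "AE t in lebesgue. t \<in> {0<..<T} \<longrightarrow> \<bar>d t\<bar> \<le> g t - f t / \<epsilon>"
    using d(4) lebesgue_differentiation[OF g12(1)] lebesgue_differentiation[OF g12(2)]
  proof (eventually_elim, intro impI)
    fix t assume D: "t \<in> {0<..<T} \<longrightarrow> (f has_real_derivative d t) (at t)"
      "((\<lambda>x. LINT r:{..x}|lebesgue. g1 r) has_real_derivative g1 t) (at t)"
      "((\<lambda>x. LINT r:{..x}|lebesgue. g2 r) has_real_derivative g2 t) (at t)" and t: "t \<in> {0<..<T}"
    note D' = D(1)[rule_format, OF t] D(2)[folded P1_def] D(3)[folded P2_def]
    have g12t: "g1 t = g t * exp (- t / \<epsilon>)" "g2 t = g t * exp (t / \<epsilon>)" using t by (auto simp: g1_def g2_def)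
    have dA: "((\<lambda>x. exp (- x / \<epsilon>) * f x + P1 x) has_real_derivative exp (- t / \<epsilon>) * (d t - f t / \<epsilon> + g t)) (at t)"
      using D' eps by (auto intro!: derivative_eq_intros simp: g12t field_simps)
    have "exp (- t / \<epsilon>) * (d t - f t / \<epsilon> + g t) \<ge> 0"
      by (rule deriv_nonneg_of_mono_Icc[OF mono1 dA t])
    then have 1: "d t - f t / \<epsilon> + g t \<ge> 0" by (simp add: zero_le_mult_iff)
    have dB: "((\<lambda>x. P2 x - exp (x / \<epsilon>) * f x) has_real_derivative exp (t / \<epsilon>) * (g t - f t / \<epsilon> - d t)) (at t)"
      using D' eps by (auto intro!: derivative_eq_intros simp: g12t field_simps)
    have "exp (t / \<epsilon>) * (g t - f t / \<epsilon> - d t) \<ge> 0"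
      by (rule deriv_nonneg_of_mono_Icc[OF mono2 dB t])
    then have 2: "g t - f t / \<epsilon> - d t \<ge> 0" by (simp add: zero_le_mult_iff)
    show "\<bar>d t\<bar> \<le> g t - f t / \<epsilon>"
      using 1 2 by linarith
  qed
  show thesis by (rule that[OF d bound])
qed

context wed_problem begin

text \<open>
  Dynamic programming forwards and backwards gives the two inequalities of \<open>ac_of_discounted_increments\<close>
  for \<open>f = V \<circ> u\<close> and \<open>g = m\<^sup>2 / 2 + p / \<epsilon>\<close>. They also carry finiteness of \<open>V\<close> from \<open>t0\<close> to all of \<open>{0..T}\<close>:
  forwards in time by the reversed curve, backwards by the curve itself. Continuity of \<open>V \<circ> u\<close>, and with it
  measurability, is part of the conclusion.
\<close>

lemma V_AC_along_curve:
  assumes T: "0 < T" and u: "has_speed {0..T} u m"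
    and m2: "set_integrable lebesgue {0..T} (\<lambda>t. (m t)\<^sup>2)"
    and p: "p \<in> borel_measurable borel" "set_integrable lebesgue {0..T} p"
    and ae: "AE t in lebesgue. t \<in> {0..T} \<longrightarrow> \<phi> (u t) = ereal (p t)"
    and t0: "t0 \<in> {0..T}" "V (u t0) < \<infinity>"
  obtains f g where "f = (\<lambda>t. real_of_ereal (V (u t)))" "\<And>t. t \<in> {0..T} \<Longrightarrow> V (u t) = ereal (f t)"
    "g \<in> borel_measurable borel" "integrable lebesgue g"
    "\<And>s t. 0 \<le> s \<Longrightarrow> s \<le> t \<Longrightarrow> t \<le> T \<Longrightarrow> f t - f s = (LINT r:{s..t}|lebesgue. g r)"
    "AE t in lebesgue. t \<in> {0<..<T} \<longrightarrow> (f has_real_derivative g t) (at t)"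
    "AE t in lebesgue. t \<in> {0<..<T} \<longrightarrow> \<bar>g t\<bar> \<le> (m t)\<^sup>2 / 2 + (p t - f t) / \<epsilon>"
proof -
  define g where "g r = (m r)\<^sup>2 / 2 + p r / \<epsilon>" for r
  have gi: "set_integrable lebesgue {0..T} g"
    unfolding g_def using m2 p(2) by (intro set_integral_add(1) set_integrable_divide) auto
  have sub: "has_speed {s..t} u m" "set_integrable lebesgue {s..t} (\<lambda>t. (m t)\<^sup>2)" "set_integrable lebesgue {s..t} p"
     "AE r in lebesgue. r \<in> {s..t} \<longrightarrow> \<phi> (u r) = ereal (p r)" if "0 \<le> s" "t \<le> T" for s t
  proof -
    have st: "{s..t} \<subseteq> {0..T}" using that by auto
    show "has_speed {s..t} u m" by (rule has_speed_subset[OF u st])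
    show "set_integrable lebesgue {s..t} (\<lambda>t. (m t)\<^sup>2)" by (rule set_integrable_subset[OF m2 _ st]) simp
    show "set_integrable lebesgue {s..t} p" by (rule set_integrable_subset[OF p(2) _ st]) simp
    show "AE r in lebesgue. r \<in> {s..t} \<longrightarrow> \<phi> (u r) = ereal (p r)"
      using ae by eventually_elim (use st in auto)
  qed
  have FW: "V (u s) \<le> ereal (LINT r:{s..t}|lebesgue. g r * exp (- (r - s) / \<epsilon>)) + ereal (exp (- (t - s) / \<epsilon>)) * V (u t)"
    and BW: "V (u t) \<le> ereal (LINT r:{s..t}|lebesgue. g r * exp (- (t - r) / \<epsilon>)) + ereal (exp (- (t - s) / \<epsilon>)) * V (u s)"
    if "0 \<le> s" "s \<le> t" "t \<le> T" for s t
    unfolding g_def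
    using dp_forward[OF that(2) sub(1,2)[OF that(1,3)] p(1) sub(3,4)[OF that(1,3)]]
      dp_backward[OF that(2) sub(1,2)[OF that(1,3)] p(1) sub(3,4)[OF that(1,3)]] by auto
  define f where "f t = real_of_ereal (V (u t))" for t
  have Vf: "V (u t) = ereal (f t)" if t: "t \<in> {0..T}" for t
  proof -
    obtain c where c: "V (u t0) = ereal c" using t0(2) V_not_MInf[of "u t0"] by (cases "V (u t0)") auto
    have "V (u t) < \<infinity>"
    proof (cases "t \<le> t0")
      case True
      then show ?thesis using FW[of t t0] t t0(1) c by auto
    next
      case False
      then show ?thesis using BW[of t0 t] t t0(1) c by auto
    qed
    then show ?thesis using V_not_MInf[of "u t"] by (cases "V (u t)") (auto simp: f_def)
  qed
  have fw: "f s \<le> (LINT r:{s..t}|lebesgue. g r * exp (- (r - s) / \<epsilon>)) + exp (- (t - s) / \<epsilon>) * f t"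
    and bw: "f t \<le> (LINT r:{s..t}|lebesgue. g r * exp (- (t - r) / \<epsilon>)) + exp (- (t - s) / \<epsilon>) * f s"
    if "0 \<le> s" "s \<le> t" "t \<le> T" for s t
    using FW[OF that] BW[OF that] Vf[of s] Vf[of t] that by auto
  obtain d where d: "d \<in> borel_measurable borel" "integrable lebesgue d"
    "\<And>s t. 0 \<le> s \<Longrightarrow> s \<le> t \<Longrightarrow> t \<le> T \<Longrightarrow> f t - f s = (LINT r:{s..t}|lebesgue. d r)"
    "AE t in lebesgue. t \<in> {0<..<T} \<longrightarrow> (f has_real_derivative d t) (at t)"
    "AE t in lebesgue. t \<in> {0<..<T} \<longrightarrow> \<bar>d t\<bar> \<le> g t - f t / \<epsilon>"
    by (rule ac_of_discounted_increments[OF T eps gi fw bw]) (assumption | rule that)+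
  have "AE t in lebesgue. t \<in> {0<..<T} \<longrightarrow> \<bar>d t\<bar> \<le> (m t)\<^sup>2 / 2 + (p t - f t) / \<epsilon>"
    using d(5) by eventually_elim (simp add: g_def diff_divide_distrib add_diff_eq)
  then show thesis by (intro that[OF _ Vf d(1-4)]) (auto simp: f_def)
qed

end

lemma AE_Ioo_witness:
  assumes "a < b" "AE t in lebesgue. t \<in> {a<..<b} \<longrightarrow> P t"
  shows "\<exists>t\<in>{a<..<b::real}. P t"
proof (rule ccontr)
  assume "\<not> ?thesis"
  then have "AE t in lebesgue. t \<notin> {a<..<b}" using assms(2) by (auto elim!: AE_mp)
  then have "{a<..<b} \<in> null_sets lebesgue" by (simp add: AE_iff_null_sets)
  then show False using assms(1) by (auto simp: null_sets_def)
qed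

context wed_problem begin

lemma slope_real:
  assumes "V x = ereal v" "\<phi> x = ereal c"
  shows "value_slope \<phi> \<epsilon> x = ereal (sqrt (2 * ((c - v) / \<epsilon>)))" "v \<le> c"
  using V_le_phi[of x] assms eps by (auto simp: value_slope_def ext_sqrt_def)

lemma slope_infinite:
  assumes "V x = \<infinity> \<or> \<phi> x = \<infinity>"
  shows "value_slope \<phi> \<epsilon> x = \<infinity>"
proof (cases "V x = \<infinity>")
  case False
  then obtain v where v: "V x = ereal v" using V_not_MInf[of x] by (cases "V x") auto
  have "\<phi> x = \<infinity>" using assms False by blast
  then show ?thesis using v eps by (simp add: value_slope_def ext_sqrt_def)
qed (simp add: value_slope_def)

lemma slope_nonneg: "0 \<le> value_slope \<phi> \<epsilon> x"
proof (cases "V x = \<infinity> \<or> \<phi> x = \<infinity>")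
  case False
  then obtain v c where "V x = ereal v" "\<phi> x = ereal c"
    using V_not_MInf[of x] phi_not_MInf[of x] by (cases "V x"; cases "\<phi> x") auto
  then show ?thesis using slope_real[of x v c] eps by simp
qed (use slope_infinite in auto)

text \<open>
  The value function and the slope together determine \<open>\<phi>\<close> where they are finite; integrability of \<open>\<phi>\<close>
  along a curve is obtained from this formula.
\<close>

lemma phi_of_slope:
  assumes "\<bar>V x\<bar> \<noteq> \<infinity>" "value_slope \<phi> \<epsilon> x = ereal r"
  shows "\<phi> x = ereal (real_of_ereal (V x) + \<epsilon> / 2 * r\<^sup>2)" "r \<ge> 0"
proof -
  obtain v where v: "V x = ereal v" using assms by (cases "V x") auto
  have "\<phi> x \<noteq> \<infinity>" using slope_infinite[of x] assms(2) by auto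
  then obtain c where c: "\<phi> x = ereal c" using phi_not_MInf[of x] by (cases "\<phi> x") auto
  note s = slope_real[OF v c]
  show "r \<ge> 0" using s assms(2) eps by simp
  have "r\<^sup>2 = 2 * ((c - v) / \<epsilon>)" using s assms(2) eps by auto
  then show "\<phi> x = ereal (real_of_ereal (V x) + \<epsilon> / 2 * r\<^sup>2)" using v c eps by (simp add: field_simps)
qed

lemma slope_square:
  assumes "V x = ereal v" "\<phi> x = ereal c"
  shows "(value_slope \<phi> \<epsilon> x)\<^sup>2 = ereal (2 * ((c - v) / \<epsilon>))"
  using slope_real[OF assms] eps by simp

text \<open>
  The hypotheses make \<open>\<phi> \<circ> u = V \<circ> u + \<epsilon>/2 G\<^sup>2 \<circ> u\<close> integrable, and \<open>V \<circ> u\<close> finite almost everywhere, hence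
  at some point. So \<open>V_AC_along_curve\<close> applies with the metric derivative as speed.
\<close>

lemma V_along_AC2_curve:
  assumes T: "T > 0" and u: "AC 2 {0..T} u"
    and V1: "in_Lp 1 (lebesgue_on {0<..<T}) (\<lambda>t. V (u t))"
    and G2: "in_Lp 2 (lebesgue_on {0<..<T}) (\<lambda>t. value_slope \<phi> \<epsilon> (u t))"
  shows "(\<forall>t\<in>{0..T}. \<bar>V (u t)\<bar> \<noteq> \<infinity>) \<and>
    AC 1 {0..T} (\<lambda>t. real_of_ereal (V (u t))) \<and>
    (AE t in lebesgue_on {0<..<T}.
               \<exists>D. ((\<lambda>s. real_of_ereal (V (u s))) has_real_derivative D) (at t) \<and>
                   ereal \<bar>D\<bar> \<le> ereal (1/2) * (value_slope \<phi> \<epsilon> (u t))\<^sup>2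
                              + ereal (1/2 * (metric_deriv {0..T} u t)\<^sup>2))"
proof -
  have loc: "AC_loc 2 {0..T} u"
    unfolding AC_loc_def using AC_Icc_of_AC[OF u] by auto
  obtain w where w: "has_speed {0..T} u w" "AE t in lebesgue. t \<in> {0..T} \<longrightarrow> metric_deriv {0..T} u t = w t"
    "(2::ennreal) = 2 \<Longrightarrow> \<forall>a b. {a..b} \<subseteq> {0..T} \<longrightarrow> set_integrable lebesgue {a..b} (\<lambda>x. (w x)\<^sup>2)"
    by (rule AC_loc_speed[OF _ loc]) (auto intro: is_interval_cc)
  have w2: "set_integrable lebesgue {0..T} (\<lambda>x. (w x)\<^sup>2)" using w(3) by blast
  define v where "v t = real_of_ereal (V (u t))" for t
  define r where "r t = real_of_ereal (value_slope \<phi> \<epsilon> (u t))" for t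
  have 1: "(1::ennreal) \<noteq> \<infinity>" "(2::ennreal) \<noteq> \<infinity>" by (auto simp: infinity_ennreal_def)
  have Vf: "AE t in lebesgue. t \<in> {0<..<T} \<longrightarrow> \<bar>V (u t)\<bar> \<noteq> \<infinity>"
    using V1 1 by (simp add: in_Lp_def AE_restrict_space_iff)
  have Gf: "AE t in lebesgue. t \<in> {0<..<T} \<longrightarrow> \<bar>value_slope \<phi> \<epsilon> (u t)\<bar> \<noteq> \<infinity>"
    using G2 1 by (simp add: in_Lp_def AE_restrict_space_iff)
  have vi: "integrable (lebesgue_on {0<..<T}) (\<lambda>t. \<bar>v t\<bar>)"
    using V1 1 by (simp add: in_Lp_def v_def)
  have ri: "integrable (lebesgue_on {0<..<T}) (\<lambda>t. (r t)\<^sup>2)"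
  proof -
    have sq: "\<bar>x\<bar> powr enn2real 2 = x\<^sup>2" for x :: real by simp
    show ?thesis using G2 unfolding in_Lp_def r_def if_not_P[OF 1(2)] sq by blast
  qed
  have "integrable (lebesgue_on {0<..<T}) (\<lambda>t. \<bar>v t\<bar> + \<epsilon> / 2 * (r t)\<^sup>2)"
    using vi ri by simp
  then have hi: "integrable lebesgue (\<lambda>t. indicator {0<..<T} t * (\<bar>v t\<bar> + \<epsilon> / 2 * (r t)\<^sup>2))"
    by (simp add: integrable_lebesgue_on_iff)
  have "(\<integral>\<^sup>+t\<in>{0..T}. e2ennreal (\<phi> (u t)) \<partial>lebesgue)
     \<le> (\<integral>\<^sup>+t. ennreal (norm (indicator {0<..<T} t * (\<bar>v t\<bar> + \<epsilon> / 2 * (r t)\<^sup>2))) \<partial>lebesgue)"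
  proof (rule nn_integral_mono_AE)
    show "AE t in lebesgue. e2ennreal (\<phi> (u t)) * indicator {0..T} t \<le> ennreal (norm (indicator {0<..<T} t * (\<bar>v t\<bar> + \<epsilon> / 2 * (r t)\<^sup>2)))"
      using Vf Gf AE_completion[OF AE_lborel_singleton[of 0]] AE_completion[OF AE_lborel_singleton[of T]]
    proof eventually_elim
      case (elim t)
      show ?case
      proof (cases "t \<in> {0<..<T}")
        case True
        then have fin: "\<bar>V (u t)\<bar> \<noteq> \<infinity>" "value_slope \<phi> \<epsilon> (u t) = ereal (r t)"
          using elim by (auto simp: r_def ereal_real)
        have "e2ennreal (\<phi> (u t)) = ennreal (v t + \<epsilon> / 2 * (r t)\<^sup>2)"
          using phi_of_slope(1)[OF fin] by (simp add: v_def e2ennreal_ereal)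
        also have "\<dots> \<le> ennreal (\<bar>v t\<bar> + \<epsilon> / 2 * (r t)\<^sup>2)" by (intro ennreal_leI) auto
        finally show ?thesis using True eps by simp
      qed (use elim in auto)
    qed
  qed
  also have "\<dots> < \<infinity>" using hi by (simp add: integrable_iff_bounded)
  finally have phi: "(\<integral>\<^sup>+t\<in>{0..T}. e2ennreal (\<phi> (u t)) \<partial>lebesgue) < \<infinity>" .
  obtain p where p: "p \<in> borel_measurable borel" "set_integrable lebesgue {0..T} p"
    "AE t in lebesgue. t \<in> {0..T} \<longrightarrow> \<phi> (u t) = ereal (p t)"
    using phi_along_curve[OF less_imp_le[OF T] w(1) phi] by blast
  obtain t0 where t0: "t0 \<in> {0..T}" "V (u t0) < \<infinity>"
  proof -
    obtain t where t: "t \<in> {0<..<T}" "\<bar>V (u t)\<bar> \<noteq> \<infinity>" by (rule bexE[OF AE_Ioo_witness[OF T Vf]]) (rule that)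
    have "t \<in> {0..T}" using t(1) by simp
    moreover have "V (u t) < \<infinity>" using t(2) by (metis abs_ereal.simps(3) ereal_infty_less(1))
    ultimately show ?thesis by (rule that)
  qed
  obtain f g where fg: "f = (\<lambda>t. real_of_ereal (V (u t)))" "\<And>t. t \<in> {0..T} \<Longrightarrow> V (u t) = ereal (f t)"
    "g \<in> borel_measurable borel" "integrable lebesgue g"
    "\<And>s t. 0 \<le> s \<Longrightarrow> s \<le> t \<Longrightarrow> t \<le> T \<Longrightarrow> f t - f s = (LINT r:{s..t}|lebesgue. g r)"
    "AE t in lebesgue. t \<in> {0<..<T} \<longrightarrow> (f has_real_derivative g t) (at t)"
    "AE t in lebesgue. t \<in> {0<..<T} \<longrightarrow> \<bar>g t\<bar> \<le> (w t)\<^sup>2 / 2 + (p t - f t) / \<epsilon>"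
    by (rule V_AC_along_curve[OF T w(1) w2 p t0]) (rule that)
  show ?thesis
    unfolding fg(1)[symmetric]
  proof (intro conjI ballI)
    show "\<bar>V (u t)\<bar> \<noteq> \<infinity>" if "t \<in> {0..T}" for t using fg(2)[OF that] by simp
    show "AC 1 {0..T} f"
    proof (rule AC_IccI[where m="\<lambda>x. \<bar>g x\<bar>"])
      fix s t assume "s \<in> {0..T}" "t \<in> {0..T}" "s \<le> t"
      then show "dist (f s) (f t) \<le> (LINT r:{s..t}|lebesgue. \<bar>g r\<bar>)"
        using fg(5)[of s t] abs_set_integral_le[of "{s..t}" g] by (simp add: dist_real_def abs_minus_commute)
    qed (use fg(4) in auto)
    have "AE t in lebesgue. t \<in> {0<..<T} \<longrightarrow> (\<exists>D. (f has_real_derivative D) (at t) \<and>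
        ereal \<bar>D\<bar> \<le> ereal (1/2) * (value_slope \<phi> \<epsilon> (u t))\<^sup>2 + ereal (1/2 * (metric_deriv {0..T} u t)\<^sup>2))"
      using fg(6,7) p(3) w(2)
    proof (eventually_elim, intro impI)
      fix t assume e: "t \<in> {0<..<T} \<longrightarrow> (f has_real_derivative g t) (at t)"
        "t \<in> {0<..<T} \<longrightarrow> \<bar>g t\<bar> \<le> (w t)\<^sup>2 / 2 + (p t - f t) / \<epsilon>"
        "t \<in> {0..T} \<longrightarrow> \<phi> (u t) = ereal (p t)" "t \<in> {0..T} \<longrightarrow> metric_deriv {0..T} u t = w t" and t: "t \<in> {0<..<T}"
      have t': "t \<in> {0..T}" using t by auto
      obtain q where q: "(p t - f t) / \<epsilon> = q" by simp
      have "(value_slope \<phi> \<epsilon> (u t))\<^sup>2 = ereal (2 * q)"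
        unfolding q[symmetric] using slope_square[OF fg(2)[OF t']] e(3) t' by blast
      moreover have "\<bar>g t\<bar> \<le> (w t)\<^sup>2 / 2 + q" using e(2) t q by simp
      ultimately show "\<exists>D. (f has_real_derivative D) (at t) \<and>
        ereal \<bar>D\<bar> \<le> ereal (1/2) * (value_slope \<phi> \<epsilon> (u t))\<^sup>2 + ereal (1/2 * (metric_deriv {0..T} u t)\<^sup>2)"
        using e t t' by (intro exI[of _ "g t"]) simp
    qed
    then show "AE t in lebesgue_on {0<..<T}. \<exists>D. (f has_real_derivative D) (at t) \<and>
        ereal \<bar>D\<bar> \<le> ereal (1/2) * (value_slope \<phi> \<epsilon> (u t))\<^sup>2 + ereal (1/2 * (metric_deriv {0..T} u t)\<^sup>2)"
      by (simp add: AE_restrict_space_iff)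
  qed
qed

end

section \<open>Change of time and the upper gradient\<close>

text \<open>
  Here \<open>k\<close> is the time that is spent per unit of the old parameter, \<open>\<tau>\<close> the new time as a function of the
  old one, and \<open>\<rho>\<close> the generalised inverse of \<open>\<tau>\<close>, which jumps over the intervals where \<open>\<tau>\<close> is constant. By
  the equivalence of \<open>\<rho> \<theta> \<le> r\<close> and \<open>\<theta> \<le> \<tau> r\<close>, the image of Lebesgue measure on \<open>{0..L}\<close> under \<open>\<rho>\<close> gives mass
  \<open>\<tau> r\<close> to \<open>{..r}\<close>. This is also the mass under the measure with density \<open>k\<close>, so the two measures are
  equal: this is the substitution rule, valid although \<open>k\<close> may vanish on large sets.
\<close>

lemma time_change:
  fixes k :: "real \<Rightarrow> real"
  assumes ab: "a \<le> b" and k: "k \<in> borel_measurable borel" "\<And>x. k x \<ge> 0" "integrable lebesgue k" "\<And>x. x \<notin> {a..b} \<Longrightarrow> k x = 0"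
  obtains \<rho> \<tau> :: "real \<Rightarrow> real" and L :: real where "L \<ge> 0" "\<tau> a = 0" "\<tau> b = L" "continuous_on UNIV \<tau>" "\<And>r. \<tau> r \<in> {0..L}"
    "\<rho> \<in> borel_measurable borel"
    "\<And>\<theta>. \<theta> \<in> {0..L} \<Longrightarrow> \<rho> \<theta> \<in> {a..b} \<and> \<tau> (\<rho> \<theta>) = \<theta>"
    "\<And>\<theta> r. \<theta> \<in> {0..L} \<Longrightarrow> r \<in> {a..b} \<Longrightarrow> \<rho> \<theta> \<le> r \<longleftrightarrow> \<theta> \<le> \<tau> r"
    "\<And>F. F \<in> borel_measurable borel \<Longrightarrow>
       (\<integral>\<^sup>+\<theta>\<in>{0..L}. F (\<rho> \<theta>) \<partial>lborel) = (\<integral>\<^sup>+r. ennreal (k r) * F r \<partial>lborel)"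
proof -
  define \<tau> where "\<tau> r = (LINT x:{..r}|lebesgue. k x)" for r
  have mono: "\<tau> r \<le> \<tau> s" if "r \<le> s" for r s
    unfolding \<tau>_def using that by (intro set_integral_mono_subset k) auto
  have cont: "continuous_on UNIV \<tau>"
    unfolding \<tau>_def by (rule continuous_on_set_integral_Iic[OF k(3)])
  have \<tau>0: "\<tau> r = 0" if "r \<le> a" for r
  proof -
    have "\<tau> r = (LINT x:{..r}|lebesgue. k x)" by (simp add: \<tau>_def)
    also have "\<dots> = (LINT x:{a..a}|lebesgue. k x)"
      unfolding set_lebesgue_integral_def
    proof (rule integral_cong_AE)
      show "AE x in lebesgue. indicator {..r} x *\<^sub>R k x = indicator {a..a} x *\<^sub>R k x"
        using AE_completion[OF AE_lborel_singleton[of a]]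
        by eventually_elim (use that k(4) in \<open>auto simp: indicator_def\<close>)
    qed (use integrable_mult_indicator[OF _ k(3)] in \<open>auto intro!: borel_measurable_integrable\<close>)
    also have "\<dots> = 0" using set_integral_Iic_diff[OF k(3), of a a] by simp
    finally show ?thesis .
  qed
  define L where "L = \<tau> b"
  have \<tau>L: "\<tau> r = L" if "r \<ge> b" for r
    unfolding \<tau>_def L_def set_lebesgue_integral_def
    by (rule Bochner_Integration.integral_cong) (use that k(4) in \<open>auto simp: indicator_def\<close>)
  have L0: "L \<ge> 0" using mono[OF ab] \<tau>0[of a] by (simp add: L_def)
  have range: "\<tau> r \<in> {0..L}" for r
    using mono[of a r] mono[of r b] \<tau>0[of a] \<tau>0[of r] \<tau>L[of r] L0 by (cases "r \<le> a"; cases "r \<ge> b") (auto simp: L_def)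
  define R where "R \<theta> = {a..b} \<inter> \<tau> -` {\<theta>..}" for \<theta>
  define \<rho> where "\<rho> \<theta> = Inf (R (max 0 (min L \<theta>)))" for \<theta>
  have Inf_R: "Inf (R \<theta>) \<in> R \<theta>" "\<And>r. r \<in> R \<theta> \<Longrightarrow> Inf (R \<theta>) \<le> r" if "\<theta> \<in> {0..L}" for \<theta>
  proof -
    have ne: "b \<in> R \<theta>" using that ab by (simp add: R_def L_def)
    have bdd: "bdd_below (R \<theta>)" by (rule bdd_belowI[of _ a]) (auto simp: R_def)
    have "closed (\<tau> -` {\<theta>..})" using cont by (intro closed_vimage) (auto simp: continuous_on_eq_continuous_at)
    then have "closed (R \<theta>)" unfolding R_def by auto
    then show "Inf (R \<theta>) \<in> R \<theta>" using ne bdd by (intro closed_contains_Inf) auto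
    show "\<And>r. r \<in> R \<theta> \<Longrightarrow> Inf (R \<theta>) \<le> r" using bdd by (intro cInf_lower)
  qed
  have \<rho>R: "\<rho> \<theta> \<in> R \<theta>" "\<And>r. r \<in> R \<theta> \<Longrightarrow> \<rho> \<theta> \<le> r" if "\<theta> \<in> {0..L}" for \<theta>
    using Inf_R[OF that] that by (auto simp: \<rho>_def)
  have gal: "\<rho> \<theta> \<le> r \<longleftrightarrow> \<theta> \<le> \<tau> r" if "\<theta> \<in> {0..L}" "r \<in> {a..b}" for \<theta> r
  proof
    assume "\<rho> \<theta> \<le> r"
    then show "\<theta> \<le> \<tau> r" using \<rho>R(1)[OF that(1)] mono[of "\<rho> \<theta>" r] by (auto simp: R_def)
  next
    assume "\<theta> \<le> \<tau> r"
    then show "\<rho> \<theta> \<le> r" using \<rho>R(2)[OF that(1), of r] that by (auto simp: R_def)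
  qed
  have inv: "\<rho> \<theta> \<in> {a..b} \<and> \<tau> (\<rho> \<theta>) = \<theta>" if \<theta>: "\<theta> \<in> {0..L}" for \<theta>
  proof -
    have 1: "\<rho> \<theta> \<in> {a..b}" "\<theta> \<le> \<tau> (\<rho> \<theta>)" using \<rho>R(1)[OF \<theta>] by (auto simp: R_def)
    have "\<exists>x\<ge>a. x \<le> \<rho> \<theta> \<and> \<tau> x = \<theta>"
      using 1 \<theta> \<tau>0[of a] by (intro IVT') (auto intro: continuous_on_subset[OF cont])
    then obtain x where x: "a \<le> x" "x \<le> \<rho> \<theta>" "\<tau> x = \<theta>" by blast
    then have "\<rho> \<theta> \<le> x" using gal[OF \<theta>, of x] 1 by auto
    then show ?thesis using x 1 by auto
  qed
  have \<rho>mono: "mono \<rho>"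
  proof (rule monoI)
    fix x y :: real assume "x \<le> y"
    let ?x = "max 0 (min L x)" and ?y = "max 0 (min L y)"
    have xy: "?x \<in> {0..L}" "?y \<in> {0..L}" "?x \<le> ?y" using L0 \<open>x \<le> y\<close> by auto
    have "R ?y \<subseteq> R ?x"
      unfolding R_def by (intro Int_mono vimage_mono order.refl) (simp only: atLeast_subset_iff xy(3))
    then have "Inf (R ?x) \<le> Inf (R ?y)"
      using Inf_R(1)[OF xy(2)] by (intro Inf_R(2)[OF xy(1)]) blast
    then show "\<rho> x \<le> \<rho> y" by (simp add: \<rho>_def)
  qed
  then have \<rho>b: "\<rho> \<in> borel_measurable borel" by (rule borel_measurable_mono)
  define M where "M = distr (density lborel (indicator {0..L})) borel \<rho>"
  define N where "N = density lborel (\<lambda>r. ennreal (k r))"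
  have \<rho>m: "\<rho> \<in> measurable (density lborel (indicator {0..L})) borel" using \<rho>b by simp
  have M: "emeasure M {..x} = ennreal (\<tau> x)" for x
  proof -
    have "emeasure M {..x} = emeasure (density lborel (indicator {0..L})) (\<rho> -` {..x})"
      unfolding M_def using \<rho>m by (subst emeasure_distr) auto
    also have "\<dots> = (\<integral>\<^sup>+\<theta>. indicator {0..L} \<theta> * indicator (\<rho> -` {..x}) \<theta> \<partial>lborel)"
      using measurable_sets[OF \<rho>b, of "{..x}"] by (subst emeasure_density) auto
    also have "\<dots> = (\<integral>\<^sup>+\<theta>. indicator {0..\<tau> x} \<theta> \<partial>lborel)"
    proof (rule nn_integral_cong_AE)
      show "AE \<theta> in lborel. indicator {0..L} \<theta> * indicator (\<rho> -` {..x}) \<theta> = (indicator {0..\<tau> x} \<theta> :: ennreal)"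
        using AE_lborel_singleton[of 0]
      proof eventually_elim
        case (elim \<theta>)
        consider "x < a" | "x \<in> {a..b}" | "x > b" by fastforce
        then show ?case
        proof cases
          case 1
          then have "\<tau> x = 0" using \<tau>0 by simp
          moreover have "\<not> \<rho> \<theta> \<le> x" if "\<theta> \<in> {0..L}" using inv[OF that] 1 by auto
          ultimately show ?thesis using elim by (auto simp: indicator_def)
        next
          case 2
          then show ?thesis using gal[of \<theta> x] range[of x] by (auto simp: indicator_def)
        next
          case 3
          then have "\<tau> x = L" using \<tau>L by simp
          moreover have "\<rho> \<theta> \<le> x" if "\<theta> \<in> {0..L}" using inv[OF that] 3 by auto
          ultimately show ?thesis by (auto simp: indicator_def)
        qed
      qed
    qed
    also have "\<dots> = ennreal (\<tau> x)" using range[of x] by (simp add: emeasure_lborel_Icc_eq)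
    finally show ?thesis .
  qed
  have N: "emeasure N {..x} = ennreal (\<tau> x)" for x
  proof -
    have "emeasure N {..x} = (\<integral>\<^sup>+r\<in>{..x}. ennreal (k r) \<partial>lborel)"
      unfolding N_def using k(1) by (subst emeasure_density) auto
    also have "\<dots> = ennreal (\<tau> x)"
      unfolding \<tau>_def by (intro nn_integral_eq_set_integral k set_integrable_of_integrable[OF k(3)]) auto
    finally show ?thesis .
  qed
  have "M = N"
  proof (rule measure_eqI_generator_eq[where E="range atMost" and \<Omega>=UNIV and A="\<lambda>n::nat. {..real n}"])
    show "Int_stable (range (atMost :: real \<Rightarrow> real set))"
      by (auto simp: Int_stable_def)
    show "sets M = sigma_sets UNIV (range atMost)" "sets N = sigma_sets UNIV (range atMost)"
      by (simp_all add: M_def N_def borel_eq_atMost)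
    show "(\<Union>n::nat. {..real n}) = UNIV"
      using reals_Archimedean2 by (auto intro: less_imp_le)
    show "emeasure M X = emeasure N X" if "X \<in> range atMost" for X
      using that M N by auto
    show "emeasure M {..real n} \<noteq> \<infinity>" for n by (simp add: M)
  qed auto
  then have push: "(\<integral>\<^sup>+\<theta>\<in>{0..L}. F (\<rho> \<theta>) \<partial>lborel) = (\<integral>\<^sup>+r. ennreal (k r) * F r \<partial>lborel)"
    if F: "F \<in> borel_measurable borel" for F
  proof -
    have Fr: "(\<lambda>\<theta>. F (\<rho> \<theta>)) \<in> borel_measurable borel" by (rule measurable_compose[OF \<rho>b F])
    have "(\<integral>\<^sup>+\<theta>\<in>{0..L}. F (\<rho> \<theta>) \<partial>lborel) = (\<integral>\<^sup>+\<theta>. F (\<rho> \<theta>) \<partial>density lborel (indicator {0..L}))"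
      using Fr by (subst nn_integral_density) (auto simp: mult.commute)
    also have "\<dots> = (\<integral>\<^sup>+r. F r \<partial>M)"
      unfolding M_def by (rule nn_integral_distr[symmetric, OF \<rho>m]) (use F in simp)
    also have "\<dots> = (\<integral>\<^sup>+r. F r \<partial>N)" by (simp add: \<open>M = N\<close>)
    also have "\<dots> = (\<integral>\<^sup>+r. ennreal (k r) * F r \<partial>lborel)"
      unfolding N_def using k(1) F by (intro nn_integral_density) auto
    finally show ?thesis .
  qed
  show thesis
  proof (rule that)
    show "\<tau> a = 0" by (simp add: \<tau>0)
    show "\<tau> b = L" by (simp add: L_def)
    show "\<rho> \<theta> \<in> {a..b} \<and> \<tau> (\<rho> \<theta>) = \<theta>" if "\<theta> \<in> {0..L}" for \<theta> by (rule inv[OF that])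
    show "\<rho> \<theta> \<le> r \<longleftrightarrow> \<theta> \<le> \<tau> r" if "\<theta> \<in> {0..L}" "r \<in> {a..b}" for \<theta> r by (rule gal[OF that])
    show "(\<integral>\<^sup>+\<theta>\<in>{0..L}. F (\<rho> \<theta>) \<partial>lborel) = (\<integral>\<^sup>+r. ennreal (k r) * F r \<partial>lborel)"
      if "F \<in> borel_measurable borel" for F by (rule push[OF that])
  qed (fact L0 cont range \<rho>b)+
qed

lemma dist_le_nn_integral_speed:
  assumes u: "has_speed {a..b} u w" and st: "a \<le> s" "s \<le> t" "t \<le> b"
  shows "ennreal (dist (u s) (u t)) \<le> (\<integral>\<^sup>+r. ennreal (w r) * indicator {s<..t} r \<partial>lborel)"
proof -
  have b: "w \<in> borel_measurable borel" "\<And>x. w x \<ge> 0" "set_integrable lebesgue {s..t} w" "dist (u s) (u t) \<le> (LINT r:{s..t}|lebesgue. w r)"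
    using u st by (auto simp: has_speed_def)
  have "ennreal (dist (u s) (u t)) \<le> ennreal (LINT r:{s..t}|lebesgue. w r)"
    using b(4) by (rule ennreal_leI)
  also have "\<dots> = (\<integral>\<^sup>+r\<in>{s..t}. ennreal (w r) \<partial>lborel)"
    by (rule nn_integral_eq_set_integral[OF b(1,2,3), symmetric]) simp
  also have "\<dots> = (\<integral>\<^sup>+r. ennreal (w r) * indicator {s<..t} r \<partial>lborel)"
  proof (rule nn_integral_cong_AE)
    show "AE r in lborel. ennreal (w r) * indicator {s..t} r = ennreal (w r) * indicator {s<..t} r"
      using AE_lborel_singleton[of s] by eventually_elim (auto simp: indicator_def)
  qed
  finally show ?thesis .
qed

lemma set_integrable_of_nn_integral_finite:
  fixes h :: "real \<Rightarrow> real"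
  assumes "h \<in> borel_measurable borel" "\<And>x. h x \<ge> 0" "(\<integral>\<^sup>+x\<in>{a..b}. ennreal (h x) \<partial>lborel) < \<infinity>"
  shows "set_integrable lebesgue {a..b} h"
proof -
  have eq: "(\<integral>\<^sup>+x. ennreal (indicator {a..b} x *\<^sub>R h x) \<partial>lborel) = (\<integral>\<^sup>+x\<in>{a..b}. ennreal (h x) \<partial>lborel)"
    by (intro nn_integral_cong) (auto simp: indicator_def)
  have m: "(\<lambda>x. indicator {a..b} x *\<^sub>R h x) \<in> borel_measurable lborel" using assms(1) by measurable
  have "integrable lborel (\<lambda>x. indicator {a..b} x *\<^sub>R h x)"
    using m assms(2,3) eq by (intro integrableI_nonneg) auto
  then show ?thesis using m by (simp add: set_integrable_def integrable_completion)
qed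

text \<open>
  The curve is run through with prescribed speed \<open>H\<close>, that is, with \<open>k = w / H\<close>. The distance between two
  points is bounded by the integral of \<open>w = k H\<close>, which the substitution rule turns into the integral of \<open>H\<close> in the
  new time. The same estimate shows that \<open>u\<close> is constant where \<open>\<tau>\<close> is, so no point of the curve is lost
  at the jumps of \<open>\<rho>\<close>.
\<close>

lemma has_speed_time_change:
  assumes ab: "a \<le> b" and u: "has_speed {a..b} u w"
    and H: "H \<in> borel_measurable borel" "\<delta> > 0" "\<And>x. H x \<ge> \<delta>"
    and wH: "(\<integral>\<^sup>+r\<in>{a..b}. ennreal (w r * H r) \<partial>lborel) < \<infinity>"
  obtains \<rho> \<tau> :: "real \<Rightarrow> real" and L :: real where "L \<ge> 0" "\<tau> a = 0" "\<tau> b = L" "continuous_on UNIV \<tau>" "\<And>r. \<tau> r \<in> {0..L}"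
    "\<rho> \<in> borel_measurable borel"
    "\<And>\<theta>. \<theta> \<in> {0..L} \<Longrightarrow> \<rho> \<theta> \<in> {a..b} \<and> \<tau> (\<rho> \<theta>) = \<theta>"
    "\<And>r. r \<in> {a..b} \<Longrightarrow> u (\<rho> (\<tau> r)) = u r"
    "has_speed {0..L} (\<lambda>\<theta>. u (\<rho> \<theta>)) (\<lambda>\<theta>. H (\<rho> \<theta>))"
    "set_integrable lebesgue {0..L} (\<lambda>\<theta>. (H (\<rho> \<theta>))\<^sup>2)"
    "\<And>F. F \<in> borel_measurable borel \<Longrightarrow>
       (\<integral>\<^sup>+\<theta>\<in>{0..L}. F (\<rho> \<theta>) \<partial>lborel) = (\<integral>\<^sup>+r\<in>{a..b}. (ennreal (w r / H r) * F r) \<partial>lborel)"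
proof -
  have w: "w \<in> borel_measurable borel" "\<And>x. w x \<ge> 0" "set_integrable lebesgue {a..b} w"
    using u ab by (auto simp: has_speed_def)
  have Hpos: "H x > 0" for x using H(2) H(3)[of x] by linarith
  define k where "k x = indicator {a..b} x * (w x / H x)" for x
  have kb: "k \<in> borel_measurable borel" unfolding k_def using w(1) H(1) by measurable
  have k0: "k x \<ge> 0" for x using w(2) Hpos by (simp add: k_def less_imp_le)
  have ki: "integrable lebesgue k"
  proof (rule Bochner_Integration.integrable_bound)
    show "integrable lebesgue (\<lambda>x. 1 / \<delta> * (indicator {a..b} x *\<^sub>R w x))"
      using w(3) unfolding set_integrable_def by simp
    show "k \<in> borel_measurable lebesgue" using kb by (intro measurable_completion) simp
    show "AE x in lebesgue. norm (k x) \<le> norm (1 / \<delta> * (indicator {a..b} x *\<^sub>R w x))"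
    proof (rule AE_I2)
      fix x
      have "w x / H x \<le> w x / \<delta>" using w(2) H by (intro divide_left_mono mult_pos_pos Hpos) auto
      then show "norm (k x) \<le> norm (1 / \<delta> * (indicator {a..b} x *\<^sub>R w x))"
        using k0[of x] w(2)[of x] H(2) by (auto simp: k_def indicator_def)
    qed
  qed
  have kout: "k x = 0" if "x \<notin> {a..b}" for x using that by (simp add: k_def)
  obtain \<rho> \<tau> :: "real \<Rightarrow> real" and L :: real where tc: "L \<ge> 0" "\<tau> a = 0" "\<tau> b = L" "continuous_on UNIV \<tau>" "\<And>r. \<tau> r \<in> {0..L}"
    "\<rho> \<in> borel_measurable borel"
    "\<And>\<theta>. \<theta> \<in> {0..L} \<Longrightarrow> \<rho> \<theta> \<in> {a..b} \<and> \<tau> (\<rho> \<theta>) = \<theta>"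
    "\<And>\<theta> r. \<theta> \<in> {0..L} \<Longrightarrow> r \<in> {a..b} \<Longrightarrow> \<rho> \<theta> \<le> r \<longleftrightarrow> \<theta> \<le> \<tau> r"
    "\<And>F. F \<in> borel_measurable borel \<Longrightarrow>
       (\<integral>\<^sup>+\<theta>\<in>{0..L}. F (\<rho> \<theta>) \<partial>lborel) = (\<integral>\<^sup>+r. ennreal (k r) * F r \<partial>lborel)"
    by (rule time_change[OF ab kb k0 ki kout]) (assumption | rule that)+
  have push: "(\<integral>\<^sup>+\<theta>\<in>{0..L}. F (\<rho> \<theta>) \<partial>lborel) = (\<integral>\<^sup>+r\<in>{a..b}. (ennreal (w r / H r) * F r) \<partial>lborel)"
    if "F \<in> borel_measurable borel" for F
    unfolding tc(9)[OF that] by (intro nn_integral_cong) (auto simp: k_def indicator_def)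
  have dist_le: "ennreal (dist (u r) (u s)) \<le> (\<integral>\<^sup>+\<theta>\<in>{0..L}. (ennreal (H (\<rho> \<theta>)) * indicator {\<tau> r<..\<tau> s} \<theta>) \<partial>lborel)"
    if rs: "a \<le> r" "r \<le> s" "s \<le> b" for r s
  proof -
    have "ennreal (dist (u r) (u s)) \<le> (\<integral>\<^sup>+x. ennreal (w x) * indicator {r<..s} x \<partial>lborel)"
      by (rule dist_le_nn_integral_speed[OF u rs])
    also have "\<dots> = (\<integral>\<^sup>+x\<in>{a..b}. (ennreal (w x / H x) * (ennreal (H x) * indicator {r<..s} x)) \<partial>lborel)"
    proof (intro nn_integral_cong)
      fix x
      have "ennreal (w x) = ennreal (w x / H x) * ennreal (H x)"
        using Hpos[of x] w(2)[of x] by (simp flip: ennreal_mult)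
      then show "ennreal (w x) * indicator {r<..s} x = ennreal (w x / H x) * (ennreal (H x) * indicator {r<..s} x) * indicator {a..b} x"
        using rs by (auto simp: indicator_def)
    qed
    also have "\<dots> = (\<integral>\<^sup>+\<theta>\<in>{0..L}. (ennreal (H (\<rho> \<theta>)) * indicator {r<..s} (\<rho> \<theta>)) \<partial>lborel)"
      using H(1) by (intro push[symmetric] borel_measurable_times_ennreal borel_measurable_indicator) auto
    also have "\<dots> = (\<integral>\<^sup>+\<theta>\<in>{0..L}. (ennreal (H (\<rho> \<theta>)) * indicator {\<tau> r<..\<tau> s} \<theta>) \<partial>lborel)"
    proof (intro nn_integral_cong)
      fix \<theta>
      have "\<rho> \<theta> \<in> {r<..s} \<longleftrightarrow> \<theta> \<in> {\<tau> r<..\<tau> s}" if "\<theta> \<in> {0..L}"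
        using tc(8)[OF that, of r] tc(8)[OF that, of s] rs
        by (simp only: greaterThanAtMost_iff not_le[symmetric] atLeastAtMost_iff) auto
      then show "ennreal (H (\<rho> \<theta>)) * indicator {r<..s} (\<rho> \<theta>) * indicator {0..L} \<theta>
         = ennreal (H (\<rho> \<theta>)) * indicator {\<tau> r<..\<tau> s} \<theta> * indicator {0..L} \<theta>"
        by (auto simp: indicator_def)
    qed
    finally show ?thesis .
  qed
  have same: "u (\<rho> (\<tau> r)) = u r" if r: "r \<in> {a..b}" for r
  proof -
    have p: "\<rho> (\<tau> r) \<in> {a..b}" "\<tau> (\<rho> (\<tau> r)) = \<tau> r" "\<rho> (\<tau> r) \<le> r"
      using tc(7)[OF tc(5), of r] tc(8)[OF tc(5) r, of r] by auto
    have "ennreal (dist (u (\<rho> (\<tau> r))) (u r)) \<le> 0"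
      using dist_le[of "\<rho> (\<tau> r)" r] p r by simp
    then show ?thesis by (simp add: ennreal_eq_0_iff)
  qed
  have Hrb: "(\<lambda>\<theta>. H (\<rho> \<theta>)) \<in> borel_measurable borel" by (rule measurable_compose[OF tc(6) H(1)])
  have Hint: "(\<integral>\<^sup>+\<theta>\<in>{0..L}. ennreal (H (\<rho> \<theta>)) \<partial>lborel) < \<infinity>"
  proof -
    have "(\<integral>\<^sup>+\<theta>\<in>{0..L}. ennreal (H (\<rho> \<theta>)) \<partial>lborel) = (\<integral>\<^sup>+r\<in>{a..b}. (ennreal (w r / H r) * ennreal (H r)) \<partial>lborel)"
      using H(1) by (intro push) measurable
    also have "\<dots> = (\<integral>\<^sup>+r\<in>{a..b}. ennreal (w r) \<partial>lborel)"
      using Hpos w(2) by (intro nn_integral_cong) (auto simp: indicator_def less_imp_le less_imp_neq[symmetric] simp flip: ennreal_mult)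
    also have "\<dots> < \<infinity>" by (subst nn_integral_eq_set_integral[OF w]) auto
    finally show ?thesis .
  qed
  have H2int: "(\<integral>\<^sup>+\<theta>\<in>{0..L}. ennreal ((H (\<rho> \<theta>))\<^sup>2) \<partial>lborel) < \<infinity>"
  proof -
    have "(\<integral>\<^sup>+\<theta>\<in>{0..L}. ennreal ((H (\<rho> \<theta>))\<^sup>2) \<partial>lborel) = (\<integral>\<^sup>+r\<in>{a..b}. (ennreal (w r / H r) * ennreal ((H r)\<^sup>2)) \<partial>lborel)"
      using H(1) by (intro push) measurable
    also have "\<dots> = (\<integral>\<^sup>+r\<in>{a..b}. ennreal (w r * H r) \<partial>lborel)"
    proof (intro nn_integral_cong)
      fix r
      have "w r / H r * (H r)\<^sup>2 = w r * H r" using Hpos[of r] by (simp add: power2_eq_square)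
      then have "ennreal (w r / H r) * ennreal ((H r)\<^sup>2) = ennreal (w r * H r)"
        using Hpos[of r] w(2)[of r] by (simp flip: ennreal_mult)
      then show "ennreal (w r / H r) * ennreal ((H r)\<^sup>2) * indicator {a..b} r = ennreal (w r * H r) * indicator {a..b} r" by simp
    qed
    finally show ?thesis using wH by simp
  qed
  have speed: "has_speed {0..L} (\<lambda>\<theta>. u (\<rho> \<theta>)) (\<lambda>\<theta>. H (\<rho> \<theta>))"
    unfolding has_speed_def
  proof (intro conjI ballI allI impI Hrb)
    show "0 \<le> H (\<rho> x)" for x using Hpos less_imp_le by blast
    fix \<theta> \<eta> assume st: "\<theta> \<in> {0..L}" "\<eta> \<in> {0..L}" "\<theta> \<le> \<eta>"
    have "(\<integral>\<^sup>+x\<in>{\<theta>..\<eta>}. ennreal (H (\<rho> x)) \<partial>lborel) \<le> (\<integral>\<^sup>+\<theta>\<in>{0..L}. ennreal (H (\<rho> \<theta>)) \<partial>lborel)"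
      using st by (intro nn_integral_mono) (auto simp: indicator_def)
    then have fin: "(\<integral>\<^sup>+x\<in>{\<theta>..\<eta>}. ennreal (H (\<rho> x)) \<partial>lborel) < \<infinity>" using Hint by (rule le_less_trans)
    show si: "set_integrable lebesgue {\<theta>..\<eta>} (\<lambda>\<theta>. H (\<rho> \<theta>))"
      by (rule set_integrable_of_nn_integral_finite[OF Hrb _ fin, OF less_imp_le[OF Hpos]])
    have \<rho>s: "\<rho> \<theta> \<in> {a..b}" "\<rho> \<eta> \<in> {a..b}" "\<rho> \<theta> \<le> \<rho> \<eta>" "\<tau> (\<rho> \<theta>) = \<theta>" "\<tau> (\<rho> \<eta>) = \<eta>"
      using tc(7)[OF st(1)] tc(7)[OF st(2)] tc(8)[OF st(1), of "\<rho> \<eta>"] st(3) by auto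
    have "ennreal (dist (u (\<rho> \<theta>)) (u (\<rho> \<eta>))) \<le> (\<integral>\<^sup>+x\<in>{0..L}. (ennreal (H (\<rho> x)) * indicator {\<theta><..\<eta>} x) \<partial>lborel)"
      using dist_le[of "\<rho> \<theta>" "\<rho> \<eta>"] \<rho>s by simp
    also have "\<dots> \<le> (\<integral>\<^sup>+x\<in>{\<theta>..\<eta>}. ennreal (H (\<rho> x)) \<partial>lborel)"
      by (intro nn_integral_mono) (auto simp: indicator_def)
    also have "\<dots> = ennreal (LINT x:{\<theta>..\<eta>}|lebesgue. H (\<rho> x))" 
      by (rule nn_integral_eq_set_integral[OF Hrb _ si, OF less_imp_le[OF Hpos]]) simp
    finally show "dist (u (\<rho> \<theta>)) (u (\<rho> \<eta>)) \<le> (LINT x:{\<theta>..\<eta>}|lebesgue. H (\<rho> x))"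
      using less_imp_le[OF Hpos] by (subst (asm) ennreal_le_iff) (auto simp: set_lebesgue_integral_def intro!: integral_nonneg_AE)
  qed
  have "set_integrable lebesgue {0..L} (\<lambda>\<theta>. (H (\<rho> \<theta>))\<^sup>2)"
    by (rule set_integrable_of_nn_integral_finite[OF _ _ H2int]) (use Hrb in \<open>auto intro: borel_measurable_power\<close>)
  note sq = this
  show thesis
  proof (rule that)
    show "\<rho> \<theta> \<in> {a..b} \<and> \<tau> (\<rho> \<theta>) = \<theta>" if "\<theta> \<in> {0..L}" for \<theta> by (rule tc(7)[OF that])
    show "u (\<rho> (\<tau> r)) = u r" if "r \<in> {a..b}" for r by (rule same[OF that])
    show "(\<integral>\<^sup>+\<theta>\<in>{0..L}. F (\<rho> \<theta>) \<partial>lborel) = (\<integral>\<^sup>+r\<in>{a..b}. (ennreal (w r / H r) * F r) \<partial>lborel)"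
      if "F \<in> borel_measurable borel" for F by (rule push[OF that])
  qed (fact tc(1) tc(2) tc(3) tc(4) tc(5) tc(6) speed sq)+
qed

lemma is_interval_sets_lebesgue: "is_interval (I :: real set) \<Longrightarrow> I \<in> sets lebesgue"
  using real_interval_borel_measurable[of I] by (simp add: sets_completionI_sets)

text \<open>
  The metric derivative is measurable on \<open>I\<close>, because it agrees with \<open>w\<close> up to a null set and Lebesgue
  measure is complete.
\<close>

lemma speed_measure_eq_density:
  assumes I: "is_interval I" and w: "has_speed I u w" "AE t in lebesgue. t \<in> I \<longrightarrow> metric_deriv I u t = w t"
  shows "speed_measure I u = completion (density (lebesgue_on I) (\<lambda>t. ennreal (w t)))"
proof -
  have Is: "I \<in> sets lebesgue" by (rule is_interval_sets_lebesgue[OF I])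
  have wb: "w \<in> borel_measurable borel" using w(1) by (simp add: has_speed_def)
  have "(\<lambda>t. if t \<in> I then metric_deriv I u t else 0) \<in> borel_measurable lebesgue"
  proof (rule borel_measurable_AE)
    show "(\<lambda>t. indicator I t * w t) \<in> borel_measurable lebesgue"
      using wb Is by (intro borel_measurable_times borel_measurable_indicator measurable_completion) auto
    show "AE t in lebesgue. indicator I t * w t = (if t \<in> I then metric_deriv I u t else 0)"
      using w(2) by eventually_elim auto
  qed
  then have "(\<lambda>t. if t \<in> I then metric_deriv I u t else 0) \<in> borel_measurable (lebesgue_on I)"
    by (rule measurable_restrict_space1)
  then have md: "metric_deriv I u \<in> borel_measurable (lebesgue_on I)"
    by (rule measurable_cong[THEN iffD1, rotated]) (auto simp: space_restrict_space)
  have "density (lebesgue_on I) (\<lambda>t. ennreal (metric_deriv I u t)) = density (lebesgue_on I) (\<lambda>t. ennreal (w t))"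
  proof (rule density_cong)
    show "(\<lambda>t. ennreal (metric_deriv I u t)) \<in> borel_measurable (lebesgue_on I)" using md by measurable
    show "(\<lambda>t. ennreal (w t)) \<in> borel_measurable (lebesgue_on I)" using borel_imp_lebesgue_on[OF wb] by measurable
    show "AE t in lebesgue_on I. ennreal (metric_deriv I u t) = ennreal (w t)"
      using w(2) Is by (simp add: AE_restrict_space_iff) (auto elim!: AE_mp)
  qed
  then show ?thesis by (simp add: speed_measure_def)
qed

text \<open>
  Functions in \<open>L\<^sup>1\<close> of the speed measure are only determined, and only known to be measurable, where the
  speed is positive; there they have a Borel version.
\<close>

lemma in_L1_speed_representative:
  assumes I: "is_interval I" and w: "has_speed I u w" "AE t in lebesgue. t \<in> I \<longrightarrow> metric_deriv I u t = w t"
    and f: "in_Lp 1 (speed_measure I u) f"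
  obtains h :: "real \<Rightarrow> real" where "h \<in> borel_measurable borel"
    "AE t in lebesgue. t \<in> I \<longrightarrow> w t > 0 \<longrightarrow> f t = ereal (h t)"
    "(\<integral>\<^sup>+t. ennreal (w t) * ennreal \<bar>h t\<bar> * indicator I t \<partial>lebesgue) < \<infinity>"
proof -
  let ?D = "density (lebesgue_on I) (\<lambda>t. ennreal (w t))"
  have Is: "I \<in> sets lebesgue" by (rule is_interval_sets_lebesgue[OF I])
  have wb: "w \<in> borel_measurable borel" using w(1) by (simp add: has_speed_def)
  have S: "speed_measure I u = completion ?D" by (rule speed_measure_eq_density[OF I w])
  have wm: "(\<lambda>t. ennreal (w t)) \<in> borel_measurable (lebesgue_on I)" using borel_imp_lebesgue_on[OF wb] by measurable
  have AE_D: "(AE t in ?D. P t) \<longleftrightarrow> (AE t in lebesgue. t \<in> I \<longrightarrow> w t > 0 \<longrightarrow> P t)" for P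
    using Is wm by (subst AE_density) (auto simp: AE_restrict_space_iff)
  have 1: "(1::ennreal) \<noteq> \<infinity>" by (auto simp: infinity_ennreal_def)
  have fm: "f \<in> borel_measurable (completion ?D)" and ffin: "AE t in completion ?D. \<bar>f t\<bar> \<noteq> \<infinity>"
    and fi: "integrable (completion ?D) (\<lambda>t. \<bar>real_of_ereal (f t)\<bar> powr enn2real 1)"
    using f unfolding in_Lp_def S if_not_P[OF 1] by blast+
  have fi: "integrable (completion ?D) (\<lambda>t. real_of_ereal (f t))"
  proof (rule Bochner_Integration.integrable_bound[OF fi])
    show "(\<lambda>t. real_of_ereal (f t)) \<in> borel_measurable (completion ?D)" using fm by measurable
  qed simp
  obtain g where g: "g \<in> borel_measurable ?D" "AE t in ?D. real_of_ereal (f t) = g t"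
    using completion_ex_borel_measurable_real[OF borel_measurable_integrable[OF fi]] by blast
  have gi: "(\<integral>\<^sup>+t. ennreal (norm (g t)) \<partial>?D) < \<infinity>"
  proof -
    have "(\<integral>\<^sup>+t. ennreal (norm (g t)) \<partial>?D) = (\<integral>\<^sup>+t. ennreal (norm (g t)) \<partial>completion ?D)"
      using g(1) by (intro nn_integral_completion[symmetric]) measurable
    also have "\<dots> = (\<integral>\<^sup>+t. ennreal (norm (real_of_ereal (f t))) \<partial>completion ?D)"
    proof (rule nn_integral_cong_AE)
      show "AE t in completion ?D. ennreal (norm (g t)) = ennreal (norm (real_of_ereal (f t)))"
        using AE_completion[OF g(2)] by eventually_elim simp
    qed
    also have "\<dots> < \<infinity>" using fi by (simp add: integrable_iff_bounded)
    finally show ?thesis .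
  qed
  have gm: "g \<in> borel_measurable (lebesgue_on I)"
    using g(1) by (subst (asm) measurable_cong_sets[OF sets_density refl])
  then have "(\<lambda>t. if t \<in> I then g t else 0) \<in> borel_measurable lebesgue"
    using Is by (simp add: borel_measurable_if_I)
  then obtain h where h: "h \<in> borel_measurable lborel" "AE t in lborel. (if t \<in> I then g t else 0) = h t"
    using completion_ex_borel_measurable_real by blast
  have hg: "AE t in lebesgue. t \<in> I \<longrightarrow> g t = h t"
    using AE_completion[OF h(2)] by eventually_elim auto
  show thesis
  proof (rule that[of h])
    show "h \<in> borel_measurable borel" using h(1) by simp
    have "AE t in ?D. \<bar>f t\<bar> \<noteq> \<infinity>" using ffin by (simp add: AE_completion_iff)
    then have "AE t in ?D. f t = ereal (g t)"
      using g(2)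
    proof eventually_elim
      case (elim t)
      then show ?case by (cases "f t") auto
    qed
    then have "AE t in lebesgue. t \<in> I \<longrightarrow> w t > 0 \<longrightarrow> f t = ereal (g t)" by (simp add: AE_D)
    then show "AE t in lebesgue. t \<in> I \<longrightarrow> w t > 0 \<longrightarrow> f t = ereal (h t)"
      using hg by eventually_elim auto
    have "(\<integral>\<^sup>+t. ennreal (w t) * ennreal \<bar>h t\<bar> * indicator I t \<partial>lebesgue)
       = (\<integral>\<^sup>+t. ennreal (w t) * ennreal (norm (g t)) * indicator I t \<partial>lebesgue)"
    proof (rule nn_integral_cong_AE)
      show "AE t in lebesgue. ennreal (w t) * ennreal \<bar>h t\<bar> * indicator I t = ennreal (w t) * ennreal (norm (g t)) * indicator I t"
        using hg by eventually_elim (auto simp: indicator_def)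
    qed
    also have "\<dots> = (\<integral>\<^sup>+t. ennreal (w t) * ennreal (norm (g t)) \<partial>lebesgue_on I)"
      using Is by (simp add: nn_integral_restrict_space)
    also have "\<dots> = (\<integral>\<^sup>+t. ennreal (norm (g t)) \<partial>?D)"
      by (rule nn_integral_density[symmetric, OF wm measurable_compose[OF measurable_compose[OF gm borel_measurable_norm] measurable_ennreal]])
    finally show "(\<integral>\<^sup>+t. ennreal (w t) * ennreal \<bar>h t\<bar> * indicator I t \<partial>lebesgue) < \<infinity>" using gi by simp
  qed
qed

context wed_problem begin

text \<open>
  Here \<open>h\<close> is a Borel version of the slope along \<open>u\<close>, and the curve is run through with speed \<open>H = h + \<delta>\<close>.
  Then \<open>\<integral> H\<^sup>2\<close> in the new time is \<open>\<integral> H w\<close> in the old one, and the positive part of \<open>\<phi> = V + \<epsilon>/2 h\<^sup>2\<close> is integrable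
  because \<open>w / H \<le> w / \<delta>\<close> and \<open>h\<^sup>2 / H \<le> h\<close>. So \<open>V_AC_along_curve\<close> applies in the new time, and its bound
  \<open>H\<^sup>2 / 2 + h\<^sup>2 / 2 \<le> H\<^sup>2\<close> integrates to \<open>\<integral> H w\<close> in the old time. The first alternative of the
  conclusion covers curves of length 0, on which \<open>V\<close> may be infinite.
\<close>

lemma upper_gradient_core:
  assumes ab: "a < b" and u: "has_speed {a..b} u w" and \<delta>: "\<delta> > 0"
    and h: "h \<in> borel_measurable borel" "\<And>x. h x \<ge> 0"
      "AE t in lborel. t \<in> {a..b} \<longrightarrow> w t > 0 \<longrightarrow> value_slope \<phi> \<epsilon> (u t) = ereal (h t)"
      "(\<integral>\<^sup>+t\<in>{a..b}. ennreal (w t * h t) \<partial>lborel) < \<infinity>"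
    and v: "v \<in> borel_measurable borel"
      "AE t in lborel. t \<in> {a..b} \<longrightarrow> w t > 0 \<longrightarrow> V (u t) = ereal (v t)"
      "(\<integral>\<^sup>+t\<in>{a..b}. ennreal (w t * \<bar>v t\<bar>) \<partial>lborel) < \<infinity>"
  shows "V (u b) = V (u a) \<or> (\<exists>x y. V (u a) = ereal x \<and> V (u b) = ereal y \<and>
     ennreal \<bar>y - x\<bar> \<le> (\<integral>\<^sup>+t\<in>{a..b}. ennreal (w t * h t) \<partial>lborel) + ennreal (\<delta> * (LINT t:{a..b}|lebesgue. w t)))"
proof -
  have wb: "w \<in> borel_measurable borel" "\<And>x. w x \<ge> 0" "set_integrable lebesgue {a..b} w"
    using u ab by (auto simp: has_speed_def)
  note [measurable] = wb(1) h(1) v(1)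
  define H where "H t = h t + \<delta>" for t
  have Hb: "H \<in> borel_measurable borel" unfolding H_def by measurable
  have Hd: "H t \<ge> \<delta>" and Hpos: "H t > 0" for t using h(2)[of t] \<delta> by (auto simp: H_def add_nonneg_pos)
  note [measurable] = Hb
  have wH: "(\<integral>\<^sup>+t\<in>{a..b}. ennreal (w t * H t) \<partial>lborel)
      = (\<integral>\<^sup>+t\<in>{a..b}. ennreal (w t * h t) \<partial>lborel) + ennreal (\<delta> * (LINT t:{a..b}|lebesgue. w t))"
  proof -
    have "(\<integral>\<^sup>+t\<in>{a..b}. ennreal (w t * H t) \<partial>lborel)
      = (\<integral>\<^sup>+t. ennreal (w t * h t) * indicator {a..b} t + ennreal \<delta> * (ennreal (w t) * indicator {a..b} t) \<partial>lborel)"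
      using wb(2) h(2) \<delta>
      by (intro nn_integral_cong) (auto simp: indicator_def H_def distrib_left ennreal_plus[symmetric] mult.commute simp del: ennreal_plus simp flip: ennreal_mult)
    also have "\<dots> = (\<integral>\<^sup>+t\<in>{a..b}. ennreal (w t * h t) \<partial>lborel) + ennreal \<delta> * (\<integral>\<^sup>+t\<in>{a..b}. ennreal (w t) \<partial>lborel)"
      by (subst nn_integral_add) (auto simp: nn_integral_cmult)
    finally show ?thesis
      using \<delta> by (simp add: nn_integral_eq_set_integral[OF wb] ennreal_mult')
  qed
  then have wHfin: "(\<integral>\<^sup>+t\<in>{a..b}. ennreal (w t * H t) \<partial>lborel) < \<infinity>"
    using h(4) by simp
  obtain \<rho> \<tau> :: "real \<Rightarrow> real" and L :: real where tc: "L \<ge> 0" "\<tau> a = 0" "\<tau> b = L" "continuous_on UNIV \<tau>" "\<And>r. \<tau> r \<in> {0..L}"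
    "\<rho> \<in> borel_measurable borel"
    "\<And>\<theta>. \<theta> \<in> {0..L} \<Longrightarrow> \<rho> \<theta> \<in> {a..b} \<and> \<tau> (\<rho> \<theta>) = \<theta>"
    "\<And>r. r \<in> {a..b} \<Longrightarrow> u (\<rho> (\<tau> r)) = u r"
    "has_speed {0..L} (\<lambda>\<theta>. u (\<rho> \<theta>)) (\<lambda>\<theta>. H (\<rho> \<theta>))"
    "set_integrable lebesgue {0..L} (\<lambda>\<theta>. (H (\<rho> \<theta>))\<^sup>2)"
    "\<And>F. F \<in> borel_measurable borel \<Longrightarrow>
       (\<integral>\<^sup>+\<theta>\<in>{0..L}. F (\<rho> \<theta>) \<partial>lborel) = (\<integral>\<^sup>+r\<in>{a..b}. (ennreal (w r / H r) * F r) \<partial>lborel)"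
    by (rule has_speed_time_change[OF less_imp_le[OF ab] u Hb \<delta> Hd wHfin]) (assumption | rule that)+
  define U where "U \<theta> = u (\<rho> \<theta>)" for \<theta>
  have U\<tau>: "U (\<tau> r) = u r" if "r \<in> {a..b}" for r using tc(8)[OF that] by (simp add: U_def)
  have Ua: "U 0 = u a" and Ub: "U L = u b" using U\<tau>[of a] U\<tau>[of b] tc(2,3) ab by auto
  show ?thesis
  proof (cases "L = 0")
    case True
    then show ?thesis using Ua Ub by simp
  next
    case False
    then have L: "L > 0" using tc(1) by simp
    have U: "has_speed {0..L} U (\<lambda>\<theta>. H (\<rho> \<theta>))" using tc(9) by (simp add: U_def[abs_def])
    have uc: "continuous_on {a..b} u" by (rule has_speed_continuous_Icc[OF u])
    define F where "F t = (if t \<in> {a..b} then \<phi> (u t) else \<infinity>)" for t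
    have Fb [measurable]: "F \<in> borel_measurable borel"
      unfolding F_def by (rule phi_comp_measurable[OF _ uc]) simp
    have AEk: "AE t in lborel. t \<in> {a..b} \<longrightarrow> w t > 0 \<longrightarrow> V (u t) = ereal (v t) \<and> F t = ereal (v t + \<epsilon> / 2 * (h t)\<^sup>2)"
      using h(3) v(2)
    proof eventually_elim
      case (elim t)
      then show ?case using phi_of_slope(1)[of "u t" "h t"] by (auto simp: F_def)
    qed
    have phi: "(\<integral>\<^sup>+\<theta>\<in>{0..L}. e2ennreal (\<phi> (U \<theta>)) \<partial>lebesgue) < \<infinity>"
    proof -
      have "(\<integral>\<^sup>+\<theta>\<in>{0..L}. e2ennreal (\<phi> (U \<theta>)) \<partial>lebesgue) = (\<integral>\<^sup>+\<theta>\<in>{0..L}. e2ennreal (F (\<rho> \<theta>)) \<partial>lebesgue)"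
        by (intro nn_integral_cong) (use tc(7) in \<open>auto simp: U_def F_def indicator_def\<close>)
      also have "\<dots> = (\<integral>\<^sup>+\<theta>\<in>{0..L}. e2ennreal (F (\<rho> \<theta>)) \<partial>lborel)"
        using measurable_compose[OF tc(6) measurable_compose[OF Fb measurable_e2ennreal]]
        by (intro nn_integral_completion) measurable
      also have "\<dots> = (\<integral>\<^sup>+r\<in>{a..b}. (ennreal (w r / H r) * e2ennreal (F r)) \<partial>lborel)"
        by (rule tc(11)) measurable
      also have "\<dots> \<le> (\<integral>\<^sup>+r. ennreal (1 / \<delta>) * (ennreal (w r * \<bar>v r\<bar>) * indicator {a..b} r) + ennreal (\<epsilon> / 2) * (ennreal (w r * h r) * indicator {a..b} r) \<partial>lborel)"
      proof (rule nn_integral_mono_AE)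
        show "AE r in lborel. ennreal (w r / H r) * e2ennreal (F r) * indicator {a..b} r
          \<le> ennreal (1 / \<delta>) * (ennreal (w r * \<bar>v r\<bar>) * indicator {a..b} r) + ennreal (\<epsilon> / 2) * (ennreal (w r * h r) * indicator {a..b} r)"
          using AEk
        proof eventually_elim
          case (elim r)
          show ?case
          proof (cases "r \<in> {a..b} \<and> w r > 0")
            case True
            then have Fr: "F r = ereal (v r + \<epsilon> / 2 * (h r)\<^sup>2)" using elim by blast
            have "w r / H r * (v r + \<epsilon> / 2 * (h r)\<^sup>2) \<le> w r / H r * \<bar>v r\<bar> + w r / H r * (\<epsilon> / 2 * (h r)\<^sup>2)"
              unfolding distrib_left[symmetric] using wb(2) Hpos[of r] by (intro mult_left_mono) auto
            also have "w r / H r * \<bar>v r\<bar> \<le> w r / \<delta> * \<bar>v r\<bar>"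
              using wb(2) Hd[of r] \<delta> Hpos[of r] by (intro mult_right_mono divide_left_mono) auto
            also have "w r / H r * (\<epsilon> / 2 * (h r)\<^sup>2) \<le> \<epsilon> / 2 * (w r * h r)"
            proof -
              have "(h r)\<^sup>2 / H r \<le> h r"
                using h(2)[of r] Hpos[of r] \<delta> by (simp add: divide_le_eq power2_eq_square H_def mult_left_mono)
              then have "\<epsilon> / 2 * w r * ((h r)\<^sup>2 / H r) \<le> \<epsilon> / 2 * w r * h r"
                using eps wb(2) by (intro mult_left_mono) auto
              then show ?thesis by (simp add: algebra_simps)
            qed
            finally have "w r / H r * (v r + \<epsilon> / 2 * (h r)\<^sup>2) \<le> 1 / \<delta> * (w r * \<bar>v r\<bar>) + \<epsilon> / 2 * (w r * h r)"
              by simp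
            then have "ennreal (w r / H r * (v r + \<epsilon> / 2 * (h r)\<^sup>2)) \<le> ennreal (1 / \<delta> * (w r * \<bar>v r\<bar>) + \<epsilon> / 2 * (w r * h r))"
              by (rule ennreal_leI)
            also have "\<dots> = ennreal (1 / \<delta>) * ennreal (w r * \<bar>v r\<bar>) + ennreal (\<epsilon> / 2) * ennreal (w r * h r)"
            proof -
              have "0 \<le> 1 / \<delta> * (w r * \<bar>v r\<bar>)" "0 \<le> \<epsilon> / 2 * (w r * h r)" "0 \<le> w r * \<bar>v r\<bar>" "0 \<le> w r * h r"
                using wb(2)[of r] h(2)[of r] \<delta> eps by auto
              then show ?thesis using \<delta> eps by (subst ennreal_plus) (auto simp: ennreal_mult[symmetric])
            qed
            also have "ennreal (w r / H r * (v r + \<epsilon> / 2 * (h r)\<^sup>2)) = ennreal (w r / H r) * e2ennreal (F r)"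
              unfolding Fr e2ennreal_ereal using wb(2)[of r] Hpos[of r] by (intro ennreal_mult') simp
            finally show ?thesis using True by simp
          next
            case False
            then have "r \<notin> {a..b} \<or> w r = 0" using wb(2)[of r] by force
            then show ?thesis by auto
          qed
        qed
      qed
      also have "\<dots> = ennreal (1 / \<delta>) * (\<integral>\<^sup>+r\<in>{a..b}. ennreal (w r * \<bar>v r\<bar>) \<partial>lborel) + ennreal (\<epsilon> / 2) * (\<integral>\<^sup>+r\<in>{a..b}. ennreal (w r * h r) \<partial>lborel)"
        by (subst nn_integral_add) (auto simp: nn_integral_cmult)
      also have "\<dots> < \<infinity>" using h(4) v(3) by (simp add: ennreal_mult_less_top)
      finally show ?thesis .
    qed
    obtain p where p: "p \<in> borel_measurable borel" "set_integrable lebesgue {0..L} p"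
      "AE t in lebesgue. t \<in> {0..L} \<longrightarrow> \<phi> (U t) = ereal (p t)"
      using phi_along_curve[OF tc(1) U phi] by blast
    \<comment> \<open>Otherwise \<open>w\<close> would vanish almost everywhere, and no time would pass.\<close>
    obtain r0 where r0: "r0 \<in> {a..b}" "V (u r0) < \<infinity>"
    proof (rule ccontr)
      assume none: "\<not> thesis"
      have "AE t in lborel. ennreal (w t / H t) * 1 * indicator {a..b} t = 0"
        using v(2)
      proof eventually_elim
        case (elim t)
        have "\<not> (t \<in> {a..b} \<and> w t > 0)" using elim that[of t] none by force
        then have "t \<notin> {a..b} \<or> w t = 0" using wb(2)[of t] by force
        then show ?case by auto
      qed
      then have "(\<integral>\<^sup>+r\<in>{a..b}. (ennreal (w r / H r) * 1) \<partial>lborel) = 0"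
        by (subst nn_integral_0_iff_AE) auto
      then have "(\<integral>\<^sup>+\<theta>\<in>{0..L}. 1 \<partial>lborel) = 0" using tc(11)[of "\<lambda>_. 1"] by simp
      then show False using L by simp
    qed
    have t0: "\<tau> r0 \<in> {0..L}" "V (U (\<tau> r0)) < \<infinity>" using r0 tc(5) U\<tau> by auto
    obtain f g where fg: "f = (\<lambda>t. real_of_ereal (V (U t)))" "\<And>t. t \<in> {0..L} \<Longrightarrow> V (U t) = ereal (f t)"
      "g \<in> borel_measurable borel" "integrable lebesgue g"
      "\<And>s t. 0 \<le> s \<Longrightarrow> s \<le> t \<Longrightarrow> t \<le> L \<Longrightarrow> f t - f s = (LINT r:{s..t}|lebesgue. g r)"
      "AE t in lebesgue. t \<in> {0<..<L} \<longrightarrow> (f has_real_derivative g t) (at t)"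
      "AE t in lebesgue. t \<in> {0<..<L} \<longrightarrow> \<bar>g t\<bar> \<le> (H (\<rho> t))\<^sup>2 / 2 + (p t - f t) / \<epsilon>"
      by (rule V_AC_along_curve[OF L U tc(10) p t0]) (rule that)
    \<comment> \<open>A Borel function on the line that equals \<open>f\<close> on \<open>{0..L}\<close>; then \<open>fB \<circ> \<tau> = V \<circ> u\<close> on \<open>{a..b}\<close>.\<close>
    define fB where "fB t = f 0 + ((LINT r:{..t}|lebesgue. g r) - (LINT r:{..0}|lebesgue. g r))" for t
    have fB: "fB t = f t" if "t \<in> {0..L}" for t
      using fg(5)[of 0 t] that set_integral_Iic_diff[OF fg(4), of 0 t] by (simp add: fB_def)
    have fBc: "continuous_on UNIV fB"
      unfolding fB_def using continuous_on_set_integral_Iic[OF fg(4)] by (intro continuous_intros)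
    have "(\<lambda>r. fB (\<tau> r)) \<in> borel_measurable borel"
      using continuous_on_compose2[OF fBc tc(4)] by (intro borel_measurable_continuous_onI) auto
    note [measurable] = this
    \<comment> \<open>\<open>\<Phi> = (\<phi> - V) / \<epsilon>\<close> along \<open>u\<close>, which is \<open>h\<^sup>2 / 2\<close> wherever time is spent. It is Borel as it stands, so the
      substitution rule applies to it.\<close>
    define \<Phi> where "\<Phi> r = e2ennreal ((F r - ereal (fB (\<tau> r))) / ereal \<epsilon>)" for r
    have \<Phi>b [measurable]: "\<Phi> \<in> borel_measurable borel"
      unfolding \<Phi>_def by measurable
    have Vfr: "V (u r) = ereal (fB (\<tau> r))" if "r \<in> {a..b}" for r
      using fg(2)[OF tc(5), of r] fB[OF tc(5), of r] U\<tau>[OF that] by simp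
    have "ennreal \<bar>f L - f 0\<bar> \<le> ennreal (LINT r:{0..L}|lebesgue. \<bar>g r\<bar>)"
      using fg(5)[of 0 L] L abs_set_integral_le[of "{0..L}" g] by (intro ennreal_leI) simp
    also have "\<dots> = (\<integral>\<^sup>+\<theta>\<in>{0..L}. ennreal \<bar>g \<theta>\<bar> \<partial>lborel)"
      using fg(3) set_integrable_abs[OF set_integrable_of_integrable[OF fg(4)]]
      by (intro nn_integral_eq_set_integral[symmetric]) auto
    also have "\<dots> \<le> (\<integral>\<^sup>+\<theta>\<in>{0..L}. (ennreal ((H (\<rho> \<theta>))\<^sup>2 / 2) + \<Phi> (\<rho> \<theta>)) \<partial>lborel)"
    proof (rule nn_integral_mono_AE)
      show "AE \<theta> in lborel. ennreal \<bar>g \<theta>\<bar> * indicator {0..L} \<theta> \<le> (ennreal ((H (\<rho> \<theta>))\<^sup>2 / 2) + \<Phi> (\<rho> \<theta>)) * indicator {0..L} \<theta>"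
        using fg(7)[unfolded AE_completion_iff] p(3)[unfolded AE_completion_iff]
          AE_lborel_singleton[of 0] AE_lborel_singleton[of L]
      proof eventually_elim
        case (elim \<theta>)
        show ?case
        proof (cases "\<theta> \<in> {0<..<L}")
          case True
          then have \<theta>: "\<theta> \<in> {0..L}" by auto
          note r = tc(7)[OF \<theta>]
          have "F (\<rho> \<theta>) = ereal (p \<theta>)" using elim(2) \<theta> r by (simp add: F_def U_def)
          then have \<Phi>: "\<Phi> (\<rho> \<theta>) = ennreal ((p \<theta> - f \<theta>) / \<epsilon>)"
            using r fB[OF \<theta>] eps by (simp add: \<Phi>_def e2ennreal_ereal)
          have "f \<theta> \<le> p \<theta>" using V_le_phi[of "U \<theta>"] fg(2)[OF \<theta>] elim(2) \<theta> by simp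
          then have "0 \<le> (p \<theta> - f \<theta>) / \<epsilon>" using eps by simp
          then have "ennreal ((H (\<rho> \<theta>))\<^sup>2 / 2 + (p \<theta> - f \<theta>) / \<epsilon>) = ennreal ((H (\<rho> \<theta>))\<^sup>2 / 2) + \<Phi> (\<rho> \<theta>)"
            unfolding \<Phi> by (intro ennreal_plus) auto
          moreover have "ennreal \<bar>g \<theta>\<bar> \<le> ennreal ((H (\<rho> \<theta>))\<^sup>2 / 2 + (p \<theta> - f \<theta>) / \<epsilon>)"
            using elim(1) True by (intro ennreal_leI) auto
          ultimately show ?thesis using \<theta> by simp
        qed (use elim in auto)
      qed
    qed
    also have "\<dots> = (\<integral>\<^sup>+r\<in>{a..b}. (ennreal (w r / H r) * (ennreal ((H r)\<^sup>2 / 2) + \<Phi> r)) \<partial>lborel)"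
      by (rule tc(11)) measurable
    also have "\<dots> \<le> (\<integral>\<^sup>+r\<in>{a..b}. ennreal (w r * H r) \<partial>lborel)"
    proof (rule nn_integral_mono_AE)
      show "AE r in lborel. ennreal (w r / H r) * (ennreal ((H r)\<^sup>2 / 2) + \<Phi> r) * indicator {a..b} r \<le> ennreal (w r * H r) * indicator {a..b} r"
        using AEk
      proof eventually_elim
        case (elim r)
        show ?case
        proof (cases "r \<in> {a..b} \<and> w r > 0")
          case True
          then have Fr: "V (u r) = ereal (v r)" "F r = ereal (v r + \<epsilon> / 2 * (h r)\<^sup>2)" using elim by blast+
          have "fB (\<tau> r) = v r" using Vfr[of r] Fr(1) True by simp
          then have "\<Phi> r = ennreal ((h r)\<^sup>2 / 2)"
            using Fr(2) eps by (simp add: \<Phi>_def e2ennreal_ereal)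
          also have "\<dots> \<le> ennreal ((H r)\<^sup>2 / 2)"
            using h(2)[of r] \<delta> by (intro ennreal_leI divide_right_mono power_mono) (auto simp: H_def)
          finally have "ennreal (w r / H r) * (ennreal ((H r)\<^sup>2 / 2) + \<Phi> r) \<le> ennreal (w r / H r) * (ennreal ((H r)\<^sup>2 / 2) + ennreal ((H r)\<^sup>2 / 2))"
            by (intro mult_left_mono add_left_mono) auto
          also have "\<dots> = ennreal (w r / H r) * ennreal ((H r)\<^sup>2)"
            by (simp flip: ennreal_plus)
          also have "\<dots> = ennreal (w r * H r)"
            using wb(2)[of r] Hpos[of r] by (simp add: power2_eq_square flip: ennreal_mult)
          finally show ?thesis using True by simp
        next
          case False
          then have "r \<notin> {a..b} \<or> w r = 0" using wb(2)[of r] by force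
          then show ?thesis by auto
        qed
      qed
    qed
    finally have "ennreal \<bar>f L - f 0\<bar> \<le> (\<integral>\<^sup>+t\<in>{a..b}. ennreal (w t * H t) \<partial>lborel)" .
    then show ?thesis
      unfolding wH using fg(2)[of 0] fg(2)[of L] L Ua Ub by auto
  qed
qed

text \<open>
  Restricted to \<open>{a..b}\<close>, the two integrability assumptions are those of \<open>upper_gradient_core\<close>, whose
  error term \<open>\<delta> \<integral> w\<close> vanishes as \<open>\<delta>\<close> tends to 0.
\<close>

lemma value_slope_upper_gradient: "moderated_upper_gradient 1 V (value_slope \<phi> \<epsilon>)"
  unfolding moderated_upper_gradient_def
proof (intro conjI allI impI ballI)
  show "V x \<noteq> - \<infinity>" for x by (rule V_not_MInf)
  show "0 \<le> value_slope \<phi> \<epsilon> x" for x by (rule slope_nonneg)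
  fix I and u :: "real \<Rightarrow> 'a" and a b
  assume I: "is_interval I" and u: "AC 1 I u"
    and V1: "in_Lp 1 (speed_measure I u) (\<lambda>t. V (u t))"
    and G1: "in_Lp 1 (speed_measure I u) (\<lambda>t. value_slope \<phi> \<epsilon> (u t))"
    and a: "a \<in> I" and b: "b \<in> I" and le: "a \<le> b"
  let ?R = "\<integral>\<^sup>+r\<in>{a..b}. (e2ennreal (value_slope \<phi> \<epsilon> (u r)) * ennreal (metric_deriv I u r)) \<partial>lebesgue"
  have Is: "I \<in> sets lebesgue" by (rule is_interval_sets_lebesgue[OF I])
  have sub: "{a..b} \<subseteq> I" using mem_is_interval_1_I[OF I a b] by auto
  have loc: "AC_loc 1 I u"
    unfolding AC_loc_def using AC_Icc_of_AC[OF u _ _ Is] by auto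
  obtain w where w: "has_speed I u w" "AE t in lebesgue. t \<in> I \<longrightarrow> metric_deriv I u t = w t"
    by (rule AC_loc_speed[OF I loc]) auto
  have w0: "w x \<ge> 0" for x using w(1) by (auto simp: has_speed_def)
  have [measurable]: "w \<in> borel_measurable borel" using w(1) by (auto simp: has_speed_def)
  obtain v where v: "v \<in> borel_measurable borel" "AE t in lebesgue. t \<in> I \<longrightarrow> w t > 0 \<longrightarrow> V (u t) = ereal (v t)"
    "(\<integral>\<^sup>+t. ennreal (w t) * ennreal \<bar>v t\<bar> * indicator I t \<partial>lebesgue) < \<infinity>"
    by (rule in_L1_speed_representative[OF I w V1])
  obtain h0 where h0: "h0 \<in> borel_measurable borel" "AE t in lebesgue. t \<in> I \<longrightarrow> w t > 0 \<longrightarrow> value_slope \<phi> \<epsilon> (u t) = ereal (h0 t)"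
    "(\<integral>\<^sup>+t. ennreal (w t) * ennreal \<bar>h0 t\<bar> * indicator I t \<partial>lebesgue) < \<infinity>"
    by (rule in_L1_speed_representative[OF I w G1])
  define h where "h t = \<bar>h0 t\<bar>" for t
  have hb: "h \<in> borel_measurable borel" unfolding h_def using h0(1) by measurable
  note [measurable] = v(1) hb
  have hs: "AE t in lebesgue. t \<in> I \<longrightarrow> w t > 0 \<longrightarrow> value_slope \<phi> \<epsilon> (u t) = ereal (h t)"
    using h0(2)
  proof eventually_elim
    case (elim t)
    then show ?case using slope_nonneg[of "u t"] by (auto simp: h_def)
  qed
  have restrict: "(\<integral>\<^sup>+t\<in>{a..b}. ennreal (w t * \<bar>k t\<bar>) \<partial>lborel) < \<infinity>"
    if k: "k \<in> borel_measurable borel" "(\<integral>\<^sup>+t. ennreal (w t) * ennreal \<bar>k t\<bar> * indicator I t \<partial>lebesgue) < \<infinity>" for k :: "real \<Rightarrow> real"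
  proof -
    note [measurable] = k(1)
    have "(\<integral>\<^sup>+t\<in>{a..b}. ennreal (w t * \<bar>k t\<bar>) \<partial>lborel) = (\<integral>\<^sup>+t\<in>{a..b}. ennreal (w t * \<bar>k t\<bar>) \<partial>lebesgue)"
      by (intro nn_integral_completion[symmetric]) measurable
    also have "\<dots> \<le> (\<integral>\<^sup>+t. ennreal (w t) * ennreal \<bar>k t\<bar> * indicator I t \<partial>lebesgue)"
      using sub w0 by (intro nn_integral_mono) (auto simp: indicator_def ennreal_mult)
    finally show ?thesis using k(2) by simp
  qed
  have sp: "has_speed {a..b} u w" by (rule has_speed_subset[OF w(1) sub])
  have hsl: "AE t in lborel. t \<in> {a..b} \<longrightarrow> w t > 0 \<longrightarrow> value_slope \<phi> \<epsilon> (u t) = ereal (h t)"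
    and vsl: "AE t in lborel. t \<in> {a..b} \<longrightarrow> w t > 0 \<longrightarrow> V (u t) = ereal (v t)"
  proof -
    show "AE t in lborel. t \<in> {a..b} \<longrightarrow> w t > 0 \<longrightarrow> value_slope \<phi> \<epsilon> (u t) = ereal (h t)"
      using hs[unfolded AE_completion_iff] by eventually_elim (use sub in blast)
    show "AE t in lborel. t \<in> {a..b} \<longrightarrow> w t > 0 \<longrightarrow> V (u t) = ereal (v t)"
      using v(2)[unfolded AE_completion_iff] by eventually_elim (use sub in blast)
  qed
  have hfin: "(\<integral>\<^sup>+t\<in>{a..b}. ennreal (w t * h t) \<partial>lborel) < \<infinity>"
    using restrict[OF h0(1,3)] by (simp add: h_def)
  have vfin: "(\<integral>\<^sup>+t\<in>{a..b}. ennreal (w t * \<bar>v t\<bar>) \<partial>lborel) < \<infinity>"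
    by (rule restrict[OF v(1,3)])
  have R: "?R = (\<integral>\<^sup>+t\<in>{a..b}. ennreal (w t * h t) \<partial>lborel)"
  proof -
    have "?R = (\<integral>\<^sup>+t\<in>{a..b}. ennreal (w t * h t) \<partial>lebesgue)"
    proof (rule nn_integral_cong_AE)
      show "AE r in lebesgue. e2ennreal (value_slope \<phi> \<epsilon> (u r)) * ennreal (metric_deriv I u r) * indicator {a..b} r
         = ennreal (w r * h r) * indicator {a..b} r"
        using hs w(2)
      proof eventually_elim
        case (elim r)
        show ?case
        proof (cases "r \<in> {a..b}")
          case True
          then have rI: "r \<in> I" using sub by blast
          show ?thesis
          proof (cases "w r > 0")
            case True
            then show ?thesis using elim rI by (simp add: e2ennreal_ereal ennreal_mult'[symmetric] mult.commute h_def flip: ennreal_mult)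
          next
            case False
            then have "w r = 0" using w0[of r] by simp
            then show ?thesis using elim rI by simp
          qed
        qed simp
      qed
    qed
    also have "\<dots> = (\<integral>\<^sup>+t\<in>{a..b}. ennreal (w t * h t) \<partial>lborel)"
      by (intro nn_integral_completion) measurable
    finally show ?thesis .
  qed
  define K where "K = (LINT t:{a..b}|lebesgue. w t)"
  have K: "K \<ge> 0" unfolding K_def set_lebesgue_integral_def using w0 by (intro integral_nonneg_AE) auto
  show "ext_absdiff (V (u b)) (V (u a)) \<le> enn2ereal ?R"
  proof (cases "a = b \<or> V (u b) = V (u a)")
    case True
    then show ?thesis by (auto simp: ext_absdiff_def)
  next
    case False
    then have ab: "a < b" using le by simp
    have core: "\<exists>x y. V (u a) = ereal x \<and> V (u b) = ereal y \<and>
       ennreal \<bar>y - x\<bar> \<le> ?R + ennreal (\<delta> * K)" if "\<delta> > 0" for \<delta>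
      using upper_gradient_core[OF ab sp that hb _ hsl hfin v(1) vsl vfin] False unfolding R K_def by (auto simp: h_def)
    from core[of 1] obtain x y where xy: "V (u a) = ereal x" "V (u b) = ereal y" by auto
    have "ennreal \<bar>y - x\<bar> \<le> ?R"
    proof (rule ennreal_le_epsilon)
      fix e :: real assume "e > 0"
      define \<delta> where "\<delta> = e / (K + 1)"
      have d: "\<delta> > 0" "\<delta> * K \<le> e" using \<open>e > 0\<close> K by (auto simp: \<delta>_def field_simps)
      have "ennreal \<bar>y - x\<bar> \<le> ?R + ennreal (\<delta> * K)"
        using core[OF d(1)] xy by auto
      also have "\<dots> \<le> ?R + ennreal e"
        using d(2) by (intro add_left_mono ennreal_leI)
      finally show "ennreal \<bar>y - x\<bar> \<le> ?R + ennreal e" .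
    qed
    then have "enn2ereal (ennreal \<bar>y - x\<bar>) \<le> enn2ereal ?R" by (simp add: less_eq_ennreal.rep_eq)
    then show ?thesis using xy False by (simp add: ext_absdiff_def)
  qed
qed

end

section \<open>The value function and its upper gradient\<close>

theorem theorem4p6:
  fixes \<sigma> :: "'a::complete_space topology"
    and \<phi> :: "'a \<Rightarrow> ereal"
    and u0 :: 'a
    and A B \<epsilon> :: real
  assumes "compatible \<sigma>"
    and "proper \<phi>"
    and "LSCC \<sigma> \<phi> u0 A B"
    and "\<epsilon> > 0"
    and "1 / (16 * \<epsilon>) > B"
  shows "(\<forall>(T::real) (u::real \<Rightarrow> 'a).
            T > 0 \<longrightarrow> AC 2 {0..T} u \<longrightarrow>
            in_Lp 1 (lebesgue_on {0<..<T}) (\<lambda>t. value_fun \<phi> \<epsilon> (u t)) \<longrightarrow>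
            in_Lp 2 (lebesgue_on {0<..<T}) (\<lambda>t. value_slope \<phi> \<epsilon> (u t)) \<longrightarrow>
            (\<forall>t\<in>{0..T}. \<bar>value_fun \<phi> \<epsilon> (u t)\<bar> \<noteq> \<infinity>) \<and>
            AC 1 {0..T} (\<lambda>t. real_of_ereal (value_fun \<phi> \<epsilon> (u t))) \<and>
            (AE t in lebesgue_on {0<..<T}.
               \<exists>D. ((\<lambda>s. real_of_ereal (value_fun \<phi> \<epsilon> (u s))) has_real_derivative D) (at t) \<and>
                   ereal \<bar>D\<bar> \<le> ereal (1/2) * (value_slope \<phi> \<epsilon> (u t))\<^sup>2
                              + ereal (1/2 * (metric_deriv {0..T} u t)\<^sup>2))) \<and>
         moderated_upper_gradient 1 (value_fun \<phi> \<epsilon>) (value_slope \<phi> \<epsilon>)"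
proof -
  interpret wed_problem \<sigma> \<phi> u0 A B \<epsilon>
    by unfold_locales (use assms in auto)
  show ?thesis
    using V_along_AC2_curve value_slope_upper_gradient by blast
qed

end
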